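(* Let $C$ be an arbitrary bivariate copula, let $(U_1,V_1),\ldots,(U_n,V_n)$ be a random sample from $C$, and for $u,v\in[0,1]$ let $C_n(u,v)=\frac1n\sum_{i=1}^n\mathbf 1(U_i\le u,V_i\le v)$ and $\alpha_n=n^{1/2}(C_n-C)$. For $\omega\ge0$ let $q_\omega(x)=x^\omega(1-x)^\omega$ for $x\in[0,1]$, and $$\mathbb G_{n,\omega}(u,v)=\begin{cases}\dfrac{\alpha_n(u,v)}{q_\omega(u\wedge v)},&\text{if }u\wedge v\in(0,1),\\[2mm] 0,&\text{if }u=0\text{ or }v=0\text{ or }(u,v)=(1,1).\end{cases}$$ Then for every $\omega\in[0,1/2)$, as $n\to\infty$ the process $\mathbb G_{n,\omega}$ converges weakly in $\ell^\infty([0,1]^2)$ to a centered Gaussian process $\mathbb G_\omega$ with continuous sample paths such that $\mathbb G_\omega(u,v)=0$ if $u=0$, $v=0$ or $(u,v)=(1,1)$, while $$\mathrm{cov}\{\mathbb G_\omega(u,v),\mathbb G_\omega(u',v')\}=\frac{C(u\wedge u',v\wedge v')-C(u,v)C(u',v')}{q_\omega(u\wedge v)\,q_\omega(u'\wedge v')}$$ if $u\wedge v\in(0,1)$ and $u'\wedge v'\in(0,1)$.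
   Context: A bivariate copula is a distribution function on $[0,1]^2$ with uniform margins on $[0,1]$. Notation: $x\wedge y=\min(x,y)$; $\ell^\infty([0,1]^2)$ is the space of bounded real-valued functions on $[0,1]^2$ with the topology of uniform convergence. Weak convergence is understood in the sense of Hoffmann-Jørgensen (outer expectations of bounded continuous functionals, with the limit a tight Borel measurable element). *)

theory Defs
  imports "HOL-Probability.Probability"
begin

section \<open>Weak convergence in the sense of Hoffmann-Jorgensen\<close>

definition borel_of :: "'b topology \<Rightarrow> 'b measure" where
  "borel_of T = sigma (topspace T) {S. openin T S}"

text \<open>
  The dominating \<open>Y\<close> are usually extended real-valued and dominate pointwise, so that they may
  be infinite on a null set. With real-valued \<open>Y\<close> this amounts to domination almost everywhere.
  Only used for almost surely bounded \<open>Z\<close>, where the infimum is over a nonempty set that is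
  bounded below.
\<close>
definition outer_expectation :: "'a measure \<Rightarrow> ('a \<Rightarrow> real) \<Rightarrow> real" where
  "outer_expectation M Z =
     Inf {integral\<^sup>L M Y | Y. integrable M Y \<and> (AE x in M. Z x \<le> Y x)}"

definition tight_borel_element :: "'c measure \<Rightarrow> 'b metric \<Rightarrow> ('c \<Rightarrow> 'b) \<Rightarrow> bool" where
  "tight_borel_element N L Y \<longleftrightarrow>
     prob_space N \<and> Y \<in> measurable N (borel_of (mtopology_of L)) \<and>
     (\<forall>\<epsilon>>0. \<exists>K. compactin (mtopology_of L) K \<and>
        measure N {x \<in> space N. Y x \<in> K} \<ge> 1 - \<epsilon>)"

text \<open>
  The \<open>X n\<close> need not be measurable, and are only required to take their values in \<open>L\<close> almost
  surely; values of \<open>F\<close> outside \<open>L\<close> are irrelevant.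
\<close>
definition weakly_converges_HJ ::
  "'a measure \<Rightarrow> 'b metric \<Rightarrow> (nat \<Rightarrow> 'a \<Rightarrow> 'b) \<Rightarrow> 'c measure \<Rightarrow> ('c \<Rightarrow> 'b) \<Rightarrow> bool" where
  "weakly_converges_HJ M L X N Y \<longleftrightarrow>
     (\<forall>n. AE x in M. X n x \<in> mspace L) \<and>
     tight_borel_element N L Y \<and>
     (\<forall>F :: 'b \<Rightarrow> real.
        continuous_map (mtopology_of L) euclideanreal F \<and> bounded (F ` mspace L) \<longrightarrow>
        (\<lambda>n. outer_expectation M (\<lambda>x. F (X n x))) \<longlonglongrightarrow> integral\<^sup>L N (\<lambda>y. F (Y y)))"

abbreviation unit_square :: "(real \<times> real) set" where
  "unit_square \<equiv> {0..1} \<times> {0..1}"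

definition linf_square :: "(real \<times> real \<Rightarrow> real) metric" where
  "linf_square = funspace unit_square euclidean_metric"


section \<open>Centered Gaussian processes\<close>

text \<open>\<open>\<sigma>\<close> is the standard deviation; \<open>\<sigma> = 0\<close> gives the point mass.\<close>
definition normal_law :: "real \<Rightarrow> real \<Rightarrow> real measure" where
  "normal_law \<mu> \<sigma> =
     (if \<sigma> = 0 then return borel \<mu> else density lborel (\<lambda>x. ennreal (normal_density \<mu> \<sigma> x)))"

definition gaussian_process :: "'c measure \<Rightarrow> 't set \<Rightarrow> ('c \<Rightarrow> 't \<Rightarrow> real) \<Rightarrow> bool" where
  "gaussian_process N T G \<longleftrightarrow>
     prob_space N \<and>
     (\<forall>t\<in>T. (\<lambda>x. G x t) \<in> borel_measurable N) \<and>
     (\<forall>S a. finite S \<and> S \<subseteq> T \<longrightarrow>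
        (\<exists>\<mu> \<sigma>. \<sigma> \<ge> 0 \<and> distr N borel (\<lambda>x. \<Sum>t\<in>S. a t * G x t) = normal_law \<mu> \<sigma>))"

definition centered_process :: "'c measure \<Rightarrow> 't set \<Rightarrow> ('c \<Rightarrow> 't \<Rightarrow> real) \<Rightarrow> bool" where
  "centered_process N T G \<longleftrightarrow>
     (\<forall>t\<in>T. integrable N (\<lambda>x. G x t) \<and> integral\<^sup>L N (\<lambda>x. G x t) = 0)"

definition covariance :: "'c measure \<Rightarrow> ('c \<Rightarrow> real) \<Rightarrow> ('c \<Rightarrow> real) \<Rightarrow> real" where
  "covariance N X Y = integral\<^sup>L N (\<lambda>x. (X x - integral\<^sup>L N X) * (Y x - integral\<^sup>L N Y))"


section \<open>Copulas and the weighted empirical process\<close>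

text \<open>Values of \<open>C\<close> outside the unit square are irrelevant.\<close>
definition copula :: "(real \<Rightarrow> real \<Rightarrow> real) \<Rightarrow> bool" where
  "copula C \<longleftrightarrow>
     (\<exists>P :: (real \<times> real) measure.
        prob_space P \<and> sets P = sets borel \<and>
        distr P borel fst = uniform_measure lborel {0..1} \<and>
        distr P borel snd = uniform_measure lborel {0..1} \<and>
        (\<forall>u\<in>{0..1}. \<forall>v\<in>{0..1}. C u v = measure P ({..u} \<times> {..v})))"

text \<open>
  For a copula \<open>C\<close> the last condition determines the law of \<open>(U i, V i)\<close>, since \<open>C 1 1 = 1\<close>.
\<close>
definition random_sample ::
  "'a measure \<Rightarrow> (real \<Rightarrow> real \<Rightarrow> real) \<Rightarrow> (nat \<Rightarrow> 'a \<Rightarrow> real) \<Rightarrow> (nat \<Rightarrow> 'a \<Rightarrow> real) \<Rightarrow> bool" where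
  "random_sample M C U V \<longleftrightarrow>
     prob_space M \<and>
     prob_space.indep_vars M (\<lambda>_. borel) (\<lambda>i x. (U i x, V i x)) UNIV \<and>
     (\<forall>i. \<forall>u\<in>{0..1}. \<forall>v\<in>{0..1}.
        measure M {x \<in> space M. U i x \<le> u \<and> V i x \<le> v} = C u v)"

definition empirical_copula ::
  "(nat \<Rightarrow> 'a \<Rightarrow> real) \<Rightarrow> (nat \<Rightarrow> 'a \<Rightarrow> real) \<Rightarrow> nat \<Rightarrow> 'a \<Rightarrow> real \<Rightarrow> real \<Rightarrow> real" where
  "empirical_copula U V n x u v = (1 / real n) * (\<Sum>i<n. of_bool (U i x \<le> u \<and> V i x \<le> v))"

definition empirical_process ::
  "(real \<Rightarrow> real \<Rightarrow> real) \<Rightarrow> (nat \<Rightarrow> 'a \<Rightarrow> real) \<Rightarrow> (nat \<Rightarrow> 'a \<Rightarrow> real) \<Rightarrow>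
   nat \<Rightarrow> 'a \<Rightarrow> real \<Rightarrow> real \<Rightarrow> real" where
  "empirical_process C U V n x u v = sqrt (real n) * (empirical_copula U V n x u v - C u v)"

text \<open>Only used for \<open>0 < x < 1\<close>, so the convention \<open>0 powr 0 = 0\<close> does not matter.\<close>
definition q_weight :: "real \<Rightarrow> real \<Rightarrow> real" where
  "q_weight \<omega> x = x powr \<omega> * (1 - x) powr \<omega>"

definition weighted_process ::
  "(real \<Rightarrow> real \<Rightarrow> real) \<Rightarrow> (nat \<Rightarrow> 'a \<Rightarrow> real) \<Rightarrow> (nat \<Rightarrow> 'a \<Rightarrow> real) \<Rightarrow> real \<Rightarrow>
   nat \<Rightarrow> 'a \<Rightarrow> real \<times> real \<Rightarrow> real" where
  "weighted_process C U V \<omega> n x =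
     (\<lambda>(u, v)\<in>unit_square.
        if min u v \<in> {0<..<1} then empirical_process C U V n x u v / q_weight \<omega> (min u v) else 0)"

end

theory Submission
  imports Defs "HOL-Complex_Analysis.Great_Picard"
begin

text \<open>
  Write \<open>\<GG>\<^sub>n\<close> for the weighted process and \<open>\<pi>\<^sub>m t\<close> for the lower left corner of the dyadic cell of mesh
  \<open>2\<^sup>-\<^sup>m\<close> that contains \<open>t\<close>.

  A weighted increment of \<open>\<GG>\<^sub>n\<close> between neighbours of the grid of mesh \<open>h \<ge> 1/n\<close> has variance of order
  \<open>h\<^sup>1\<^sup>-\<^sup>2\<^sup>\<omega>\<close> and is a sum of independent variables of size \<open>h\<^sup>1\<^sup>/\<^sup>2\<^sup>-\<^sup>\<omega>\<close>, so it has an exponential moment at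
  scale \<open>h\<^sup>1\<^sup>/\<^sup>2\<^sup>-\<^sup>\<omega>\<close>. Chaining down to mesh \<open>1/n\<close> therefore treats the weight and the boundary at
  once. Below that mesh, monotonicity of distribution functions suffices in the interior, while in
  the outermost cells the process is dominated by
  \<open>n\<^sup>-\<^sup>1\<^sup>/\<^sup>2 \<Sum> \<phi>(U\<^sub>i)\<close> with \<open>\<phi>(u) = u\<^sup>-\<^sup>\<omega>\<close> for \<open>u \<le> h\<close>, whose mean tends to \<open>0\<close>.

  The limit is built on the dyadic points as a Gaussian family, by Gram--Schmidt in \<open>L\<^sup>2\<close> of the
  copula, and obeys the same chaining bound, which gives continuous paths and tightness. For bounded
  Lipschitz functionals the step functions \<open>\<GG>\<^sub>n \<circ> \<pi>\<^sub>m\<close> reduce convergence to the central limit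
  theorem on a finite grid; bounded continuous functionals are monotone limits of Lipschitz ones from
  both sides.
\<close>

section \<open>Weak convergence by approximation\<close>


text \<open>Two tail scales explain the constants. At level \<open>k\<close>, with mesh h = 2^(-k)
  and \<rho> = \<open>chain_ratio\<close>, exponential moments are available at scale
  h^(1/2-\<omega>) = \<rho>^(2k), while an oscillation of size A \<rho>^k is allowed. The surplus
  \<rho>^(-k) in the exponent beats the roughly 4^k edges of the grid. Hence
  \<open>chain_ratio\<close> carries only half of the available exponent, and \<omega> < 1/2 is what
  makes \<rho> < 1. The empirical process has these moments only while n h is at least 1, because
  its summands are as large as h^(-\<omega>). So chaining stops at mesh about 1/n, where sqrt n
  h^(1-\<omega>) is of order n^(\<omega>-1/2) and the remainder is negligible. Suprema over the
  square need not be measurable, and a sample point on the edge of the square can make a path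
  unbounded. All path estimates are therefore deterministic, on measurable events described by grid
  values and by a sum over sample points near the edges; outer expectations enter only through
  integrable bounds on both sides.\<close>

lemma borel_measurable_continuous_metric:
  assumes Y: "Y \<in> measurable N (borel_of T)"
    and F: "continuous_map T euclideanreal F"
  shows "(\<lambda>y. F (Y y)) \<in> borel_measurable N"
proof -
  have sp: "space (borel_of T) = topspace T" and st: "sets (borel_of T) = sigma_sets (topspace T) {S. openin T S}"
    unfolding borel_of_def by (subst space_measure_of sets_measure_of; use openin_subset in blast; simp)+
  have "F \<in> borel_measurable (borel_of T)"
  proof (rule borel_measurableI)
    fix S :: "real set" assume "open S"
    then have "openin T {x \<in> topspace T. F x \<in> S}"
      using F by (simp add: continuous_map_def)
    moreover have "F -` S \<inter> space (borel_of T) = {x \<in> topspace T. F x \<in> S}" by (auto simp: sp)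
    ultimately show "F -` S \<inter> space (borel_of T) \<in> sets (borel_of T)" by (auto simp: st)
  qed
  from measurable_compose[OF Y this] show ?thesis .
qed

section \<open>Lipschitz functionals on a metric space\<close>

abbreviation lipschitz_functional :: "'b metric \<Rightarrow> ('b \<Rightarrow> real) \<Rightarrow> bool" where
  "lipschitz_functional L F \<equiv> Lipschitz_continuous_map L euclidean_metric F"

text \<open>A one-sided inequality is enough, because exchanging \<open>x\<close> and
  \<open>y\<close> gives the other side.\<close>

lemma lipschitz_functionalI:
  assumes "\<And>x y. x \<in> mspace L \<Longrightarrow> y \<in> mspace L \<Longrightarrow> F x - F y \<le> c * mdist L x y"
  shows "lipschitz_functional L F"
  unfolding Lipschitz_continuous_map_def
proof (intro conjI exI[of _ c] ballI)
  fix x y assume "x \<in> mspace L" "y \<in> mspace L"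
  then show "mdist euclidean_metric (F x) (F y) \<le> c * mdist L x y"
    using assms[of x y] assms[of y x] by (simp add: dist_real_def mdist_commute abs_le_iff)
qed auto

text \<open>The constant is enlarged to be strictly positive, since tolerances are later divided by
  it.\<close>

lemma lipschitz_functionalD:
  assumes "lipschitz_functional L F"
  obtains c where "c > 0" "\<And>x y. x \<in> mspace L \<Longrightarrow> y \<in> mspace L \<Longrightarrow> \<bar>F x - F y\<bar> \<le> c * mdist L x y"
proof -
  obtain B where B: "\<forall>x\<in>mspace L. \<forall>y\<in>mspace L. dist (F x) (F y) \<le> B * mdist L x y"
    using assms by (auto simp: Lipschitz_continuous_map_def)
  have "\<bar>F x - F y\<bar> \<le> (\<bar>B\<bar> + 1) * mdist L x y" if "x \<in> mspace L" "y \<in> mspace L" for x y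
  proof -
    have "\<bar>F x - F y\<bar> \<le> B * mdist L x y" using B that by (auto simp: dist_real_def)
    also have "\<dots> \<le> (\<bar>B\<bar> + 1) * mdist L x y" by (intro mult_right_mono) auto
    finally show ?thesis .
  qed
  then show thesis using that[of "\<bar>B\<bar> + 1"] by auto
qed

text \<open>\<open>F\<close> is the infimal convolution of \<open>g\<close> with \<open>k\<close>
  times the distance: each function under the infimum is \<open>k\<close>-Lipschitz, hence so is the
  infimum. Two instances matter. \<open>g = 0\<close> gives the distance to a set, and a bounded
  continuous \<open>g\<close> with growing \<open>k\<close> gives Lipschitz approximations from
  below.\<close>

lemma infdist_functional:
  fixes g :: "'b \<Rightarrow> real"
  assumes k: "k \<ge> 0" and C: "C \<subseteq> mspace L" "C \<noteq> {}" and g: "\<And>z. z \<in> C \<Longrightarrow> -B \<le> g z"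
  defines "F \<equiv> \<lambda>x. INF z\<in>C. g z + k * mdist L x z"
  shows "lipschitz_functional L F" "\<And>x. -B \<le> F x" "\<And>x z. z \<in> C \<Longrightarrow> F x \<le> g z + k * mdist L x z"
    "\<And>x a. (\<And>z. z \<in> C \<Longrightarrow> a \<le> g z + k * mdist L x z) \<Longrightarrow> a \<le> F x"
proof -
  have "-B \<le> g z + k * mdist L x z" if "z \<in> C" for x z
  proof -
    have "0 \<le> k * mdist L x z" using k by simp
    then show ?thesis using g[OF that] by linarith
  qed
  then have bdd: "bdd_below ((\<lambda>z. g z + k * mdist L x z) ` C)" for x by (intro bdd_belowI[of _ "-B"]) auto
  show low: "F x \<le> g z + k * mdist L x z" if "z \<in> C" for x z
    unfolding F_def using bdd that by (intro cINF_lower) auto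
  show gr: "a \<le> F x" if "\<And>z. z \<in> C \<Longrightarrow> a \<le> g z + k * mdist L x z" for x a
    unfolding F_def using C that by (intro cINF_greatest) auto
  show "-B \<le> F x" for x using \<open>\<And>x z. z \<in> C \<Longrightarrow> -B \<le> g z + k * mdist L x z\<close> by (intro gr)
  show "lipschitz_functional L F"
  proof (rule lipschitz_functionalI[of _ _ k])
    fix x y assume xy: "x \<in> mspace L" "y \<in> mspace L"
    have "F x - k * mdist L x y \<le> F y"
    proof (rule gr)
      fix z assume z: "z \<in> C"
      have "F x \<le> g z + k * mdist L x z" by (rule low[OF z])
      also have "k * mdist L x z \<le> k * (mdist L x y + mdist L y z)"
        using z C xy k by (intro mult_left_mono mdist_triangle) auto
      finally show "F x - k * mdist L x y \<le> g z + k * mdist L y z" by (simp add: algebra_simps)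
    qed
    then show "F x - F y \<le> k * mdist L x y" by simp
  qed
qed

text \<open>An open set is exactly where the distance to its complement is positive, so Lipschitz
  test functionals already decide Borel measurability, without any separability. Truncating the
  distance at 1 makes it a bounded functional.\<close>

lemma measurable_borel_of_metricI:
  assumes Y: "\<And>y. y \<in> space N \<Longrightarrow> Y y \<in> mspace L"
    and meas: "\<And>F. \<lbrakk>lipschitz_functional L F; bounded (F ` mspace L)\<rbrakk> \<Longrightarrow> (\<lambda>y. F (Y y)) \<in> borel_measurable N"
  shows "Y \<in> measurable N (borel_of (mtopology_of L))"
  unfolding borel_of_def
proof (rule measurable_measure_of)
  show "{S. openin (mtopology_of L) S} \<subseteq> Pow (topspace (mtopology_of L))"
    using openin_subset by blast
  show "Y \<in> space N \<rightarrow> topspace (mtopology_of L)" using Y by auto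
  fix S assume "S \<in> {S. openin (mtopology_of L) S}"
  then have S: "openin (mtopology_of L) S" by simp
  have Ssub: "S \<subseteq> mspace L" using openin_subset[OF S] by simp
  interpret Ms: Metric_space "mspace L" "mdist L" by auto
  show "Y -` S \<inter> space N \<in> sets N"
  \<comment> \<open>The infimum defining the distance is meaningful only over a nonempty
    complement.\<close>
  proof (cases "mspace L - S = {}")
    case True
    then have "Y -` S \<inter> space N = space N" using Y by auto
    then show ?thesis by simp
  next
    case False
    define D where "D x = (INF z\<in>mspace L - S. 0 + 1 * mdist L x z)" for x
    have D: "lipschitz_functional L D" "\<And>x. 0 \<le> D x" "\<And>x z. z \<in> mspace L - S \<Longrightarrow> D x \<le> mdist L x z"
      "\<And>x a. (\<And>z. z \<in> mspace L - S \<Longrightarrow> a \<le> mdist L x z) \<Longrightarrow> a \<le> D x"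
      using infdist_functional[of 1 "mspace L - S" L 0 "\<lambda>_. 0", OF _ _ False] unfolding D_def by auto
    define F where "F x = min 1 (D x)" for x
    obtain c where c: "\<And>x y. x \<in> mspace L \<Longrightarrow> y \<in> mspace L \<Longrightarrow> \<bar>D x - D y\<bar> \<le> c * mdist L x y"
      using lipschitz_functionalD[OF D(1)] by blast
    have "lipschitz_functional L F"
    proof (rule lipschitz_functionalI)
      fix x y assume "x \<in> mspace L" "y \<in> mspace L"
      then show "F x - F y \<le> c * mdist L x y" using c[of x y] unfolding F_def by linarith
    qed
    moreover have "bounded (F ` mspace L)"
      unfolding bounded_iff using D(2) by (intro exI[of _ 1]) (auto simp: F_def abs_le_iff min_le_iff_disj intro: order_trans[of _ 0])
    ultimately have Fm: "(\<lambda>y. F (Y y)) \<in> borel_measurable N" by (rule meas)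
    have eq: "x \<in> S \<longleftrightarrow> F x > 0" if x: "x \<in> mspace L" for x
    proof
      assume "x \<in> S"
      then obtain r where r: "r > 0" "Ms.mball x r \<subseteq> S"
        using S unfolding mtopology_of_def Ms.openin_mtopology by blast
      have "r \<le> D x"
      proof (rule D(4))
        fix z assume "z \<in> mspace L - S"
        then show "r \<le> mdist L x z" using r x by (force simp: Ms.mball_def)
      qed
      then show "F x > 0" using r by (simp add: F_def)
    next
      assume "F x > 0"
      then show "x \<in> S" using D(3)[of x x] x by (force simp: F_def)
    qed
    have "Y -` S \<inter> space N = {y \<in> space N. F (Y y) > 0}" using eq Y by auto
    also have "\<dots> \<in> sets N" using Fm by simp
    finally show ?thesis .
  qed
qed

text \<open>The approximations are the infimal convolutions of \<open>F\<close> with slope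
  \<open>k\<close>: points near \<open>x\<close> have almost the value \<open>F x\<close> by
  continuity, and distant points are penalised by \<open>k\<close> times the distance.\<close>

lemma lipschitz_approx_below:
  assumes F: "continuous_map (mtopology_of L) euclideanreal F"
    and B: "\<And>x. x \<in> mspace L \<Longrightarrow> \<bar>F x\<bar> \<le> B"
  obtains G :: "nat \<Rightarrow> 'b \<Rightarrow> real" where "\<And>k. lipschitz_functional L (G k)"
    "\<And>k x. x \<in> mspace L \<Longrightarrow> \<bar>G k x\<bar> \<le> B" "\<And>k x. x \<in> mspace L \<Longrightarrow> G k x \<le> F x"
    "\<And>x. x \<in> mspace L \<Longrightarrow> (\<lambda>k. G k x) \<longlonglongrightarrow> F x"
proof (cases "mspace L = {}")
  case True
  then show ?thesis using that[of "\<lambda>_ _. 0"] by (simp add: Lipschitz_continuous_map_def)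
next
  case False
  interpret Ms: Metric_space "mspace L" "mdist L" by auto
  define G where "G k x = (INF z\<in>mspace L. F z + real k * mdist L x z)" for k :: nat and x
  have FB: "-B \<le> F z" if "z \<in> mspace L" for z using B[OF that] by linarith
  have G: "lipschitz_functional L (G k)" "\<And>x. -B \<le> G k x"
      "\<And>x z. z \<in> mspace L \<Longrightarrow> G k x \<le> F z + real k * mdist L x z"
      "\<And>x a. (\<And>z. z \<in> mspace L \<Longrightarrow> a \<le> F z + real k * mdist L x z) \<Longrightarrow> a \<le> G k x" for k
    using infdist_functional[of "real k" "mspace L" L B F, OF _ _ False FB] unfolding G_def by auto
  have le: "G k x \<le> F x" if "x \<in> mspace L" for k x using G(3)[of x k x] that by simp
  show thesis
  proof (rule that[of G])
    show "lipschitz_functional L (G k)" for k by (rule G(1))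
    show "G k x \<le> F x" if "x \<in> mspace L" for k x by (rule le[OF that])
    show "\<bar>G k x\<bar> \<le> B" if "x \<in> mspace L" for k x
      using le[OF that, of k] B[OF that] G(2)[of k x] by (simp add: abs_le_iff)
    show "(\<lambda>k. G k x) \<longlonglongrightarrow> F x" if x: "x \<in> mspace L" for x
    proof (rule LIMSEQ_I)
      fix r :: real assume r: "r > 0"
      have op: "openin Ms.mtopology {z \<in> topspace Ms.mtopology. F z \<in> {F x - r/2 <..}}"
        using F unfolding continuous_map_def mtopology_of_def by (metis open_greaterThan open_openin)
      have "x \<in> {z \<in> topspace Ms.mtopology. F z \<in> {F x - r/2 <..}}" using x r by auto
      then obtain d where d: "d > 0" "Ms.mball x d \<subseteq> {z \<in> topspace Ms.mtopology. F z \<in> {F x - r/2 <..}}"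
        using op unfolding Ms.openin_mtopology by blast
      \<comment> \<open>From distance \<open>d\<close> on, the penalty is then at least 2 B, the
        largest possible drop of \<open>F\<close>.\<close>
      obtain k0 :: nat where k0: "2 * B / d < real k0" using reals_Archimedean2 by blast
      have "F x - r/2 \<le> G k x" if k: "k \<ge> k0" for k
      proof (rule G(4))
        fix z assume z: "z \<in> mspace L"
        have nn: "0 \<le> real k * mdist L x z" by simp
        show "F x - r/2 \<le> F z + real k * mdist L x z"
        proof (cases "mdist L x z < d")
          case True
          then have "F x - r/2 < F z" using d(2) x z by (auto simp: subset_iff)
          then show ?thesis using nn by linarith
        next
          case False
          have "2 * B \<le> real k0 * d" using k0 d(1) by (simp add: field_simps)
          also have "\<dots> \<le> real k * mdist L x z" using k False d by (intro mult_mono) auto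
          finally show ?thesis using B[OF x] B[OF z] r by linarith
        qed
      qed
      then have "\<forall>k\<ge>k0. norm (G k x - F x) < r" using le[OF x] r by (force simp: abs_less_iff)
      then show "\<exists>k0. \<forall>k\<ge>k0. norm (G k x - F x) < r" by blast
    qed
  qed
qed

text \<open>The lower bound \<open>b\<close> keeps the set of integrals bounded below, without which
  its real infimum would carry no meaning.\<close>

lemma outer_expectation_le:
  assumes "prob_space M" "integrable M Y" "AE x in M. Z x \<le> Y x" "AE x in M. b \<le> Z x"
  shows "outer_expectation M Z \<le> integral\<^sup>L M Y"
  unfolding outer_expectation_def
proof (rule cInf_lower)
  interpret prob_space M by fact
  show "bdd_below {integral\<^sup>L M Y |Y. integrable M Y \<and> (AE x in M. Z x \<le> Y x)}"
  proof (rule bdd_belowI, clarify)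
    fix Y assume Y: "integrable M Y" "AE x in M. Z x \<le> Y x"
    have "integral\<^sup>L M (\<lambda>_. b) \<le> integral\<^sup>L M Y"
      using Y assms(4) by (intro integral_mono_AE) auto
    then show "b \<le> integral\<^sup>L M Y" by (simp add: prob_space)
  qed
qed (use assms in auto)

text \<open>The upper bound \<open>b\<close> supplies a dominating function, so the infimum is over
  a nonempty set.\<close>

lemma outer_expectation_ge:
  assumes "prob_space M" "integrable M Y" "AE x in M. Y x \<le> Z x" "AE x in M. Z x \<le> b"
  shows "integral\<^sup>L M Y \<le> outer_expectation M Z"
  unfolding outer_expectation_def
proof (rule cInf_greatest)
  interpret prob_space M by fact
  show "{integral\<^sup>L M Y |Y. integrable M Y \<and> (AE x in M. Z x \<le> Y x)} \<noteq> {}"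
    using assms(4) by (auto intro!: exI[of _ "\<lambda>_. b"])
  fix a assume "a \<in> {integral\<^sup>L M Y |Y. integrable M Y \<and> (AE x in M. Z x \<le> Y x)}"
  then obtain Y' where Y': "a = integral\<^sup>L M Y'" "integrable M Y'" "AE x in M. Z x \<le> Y' x" by auto
  have "AE x in M. Y x \<le> Y' x" using assms(3) Y'(3) by eventually_elim auto
  then show "integral\<^sup>L M Y \<le> a" using Y' assms by (auto intro: integral_mono_AE)
qed

lemma outer_expectation_mono:
  assumes "prob_space M" "AE x in M. Z x \<le> Z' x" "AE x in M. b \<le> Z x" "AE x in M. Z' x \<le> b'"
  shows "outer_expectation M Z \<le> outer_expectation M Z'"
  unfolding outer_expectation_def[of M Z']
proof (rule cInf_greatest)
  interpret prob_space M by fact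
  show "{integral\<^sup>L M Y |Y. integrable M Y \<and> (AE x in M. Z' x \<le> Y x)} \<noteq> {}"
    using assms(4) by (auto intro!: exI[of _ "\<lambda>_. b'"])
  fix a assume "a \<in> {integral\<^sup>L M Y |Y. integrable M Y \<and> (AE x in M. Z' x \<le> Y x)}"
  then obtain Y' where Y': "a = integral\<^sup>L M Y'" "integrable M Y'" "AE x in M. Z' x \<le> Y' x" by auto
  have "AE x in M. Z x \<le> Y' x" using assms(2) Y'(3) by eventually_elim auto
  then show "outer_expectation M Z \<le> a" using outer_expectation_le[OF assms(1) Y'(2) _ assms(3)] Y' by simp
qed

text \<open>\<open>X\<close> need not be measurable, but \<open>F (X x)\<close> lies between
  \<open>F (X' x) - e x\<close> and \<open>F (X' x) + e x\<close>, where \<open>e\<close> charges c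
  \<epsilon> off \<open>D\<close> and an additional 2 B on \<open>D\<close>. The integrals of these
  two bounds enclose the outer expectation.\<close>

lemma outer_expectation_approx:
  assumes M: "prob_space M" and F: "\<And>x. x \<in> mspace L \<Longrightarrow> \<bar>F x\<bar> \<le> B"
    and c: "c > 0" "\<And>x y. x \<in> mspace L \<Longrightarrow> y \<in> mspace L \<Longrightarrow> \<bar>F x - F y\<bar> \<le> c * mdist L x y"
    and X: "AE x in M. X x \<in> mspace L" and X': "AE x in M. X' x \<in> mspace L"
    and FX': "(\<lambda>x. F (X' x)) \<in> borel_measurable M"
    and D: "D \<in> sets M" "measure M D \<le> \<eta>" "AE x in M. x \<notin> D \<longrightarrow> mdist L (X x) (X' x) \<le> \<epsilon>"
    and nn: "0 \<le> B" "0 \<le> \<epsilon>"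
  shows "\<bar>outer_expectation M (\<lambda>x. F (X x)) - (\<integral>x. F (X' x) \<partial>M)\<bar> \<le> c * \<epsilon> + 2 * B * \<eta>"
proof -
  interpret prob_space M by fact
  have intX': "integrable M (\<lambda>x. F (X' x))"
    using X' by (intro integrable_const_bound[where B=B] FX') (auto elim!: eventually_mono intro: F)
  define e where "e x = c * \<epsilon> + 2 * B * indicator D x" for x
  have int_e: "integrable M e" unfolding e_def using D by (auto simp: integrable_indicator_iff less_top[symmetric])
  have e_le: "(\<integral>x. e x \<partial>M) \<le> c * \<epsilon> + 2 * B * \<eta>"
    unfolding e_def using D nn by (simp add: prob_space less_top[symmetric] mult_left_mono)
  have close: "AE x in M. \<bar>F (X x) - F (X' x)\<bar> \<le> e x"
    using X X' D(3)
  proof eventually_elim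
    case (elim x)
    show ?case
    proof (cases "x \<in> D")
      case True
      have "0 \<le> c * \<epsilon>" using c(1) nn by simp
      moreover have "\<bar>F (X x) - F (X' x)\<bar> \<le> B + B" using F[OF elim(1)] F[OF elim(2)] by linarith
      ultimately show ?thesis using True by (simp add: e_def)
    next
      case False
      have "\<bar>F (X x) - F (X' x)\<bar> \<le> c * mdist L (X x) (X' x)" using c elim by auto
      also have "\<dots> \<le> c * \<epsilon>" using elim False c by (intro mult_left_mono) auto
      finally show ?thesis using False by (simp add: e_def)
    qed
  qed
  have bd: "AE x in M. -B \<le> F (X x)" "AE x in M. F (X x) \<le> B"
    using X by (auto elim!: eventually_mono dest!: F)
  have "outer_expectation M (\<lambda>x. F (X x)) \<le> (\<integral>x. F (X' x) + e x \<partial>M)"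
    using close by (intro outer_expectation_le[OF M _ _ bd(1)]) (auto simp: int_e intX' elim!: eventually_mono)
  moreover have "(\<integral>x. F (X' x) - e x \<partial>M) \<le> outer_expectation M (\<lambda>x. F (X x))"
    using close by (intro outer_expectation_ge[OF M _ _ bd(2)]) (auto simp: int_e intX' elim!: eventually_mono)
  ultimately show ?thesis using e_le int_e intX' by (simp add: abs_le_iff)
qed

text \<open>The usual approximation scheme for weak convergence: \<open>XA m n\<close> is close to
  \<open>X n\<close>, \<open>XA m n\<close> converges to \<open>YA m\<close> as n grows, and
  \<open>YA m\<close> converges to \<open>Y\<close>. Closeness is asked for off a measurable set
  \<open>D\<close>, because the distance between \<open>X n\<close> and \<open>XA m n\<close> need
  not be measurable; how large \<open>n\<close> has to be may depend on \<open>m\<close>.\<close>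

theorem weakly_converges_HJ_approx:
  fixes X :: "nat \<Rightarrow> 'a \<Rightarrow> 'b" and Y :: "'c \<Rightarrow> 'b"
    and XA :: "nat \<Rightarrow> nat \<Rightarrow> 'a \<Rightarrow> 'b" and YA :: "nat \<Rightarrow> 'c \<Rightarrow> 'b"
  assumes M: "prob_space M" and tight: "tight_borel_element N L Y"
    and X: "\<And>n. AE x in M. X n x \<in> mspace L"
    and XA: "\<And>m n x. XA m n x \<in> mspace L"
    and YA: "\<And>m y. YA m y \<in> mspace L"
    and XA_meas: "\<And>F m n. \<lbrakk>lipschitz_functional L F; bounded (F ` mspace L)\<rbrakk> \<Longrightarrow>
        (\<lambda>x. F (XA m n x)) \<in> borel_measurable M"
    and YA_meas: "\<And>F m. \<lbrakk>lipschitz_functional L F; bounded (F ` mspace L)\<rbrakk> \<Longrightarrow>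
        (\<lambda>y. F (YA m y)) \<in> borel_measurable N"
    and conv: "\<And>F m. \<lbrakk>lipschitz_functional L F; bounded (F ` mspace L)\<rbrakk> \<Longrightarrow>
        (\<lambda>n. \<integral>x. F (XA m n x) \<partial>M) \<longlonglongrightarrow> (\<integral>y. F (YA m y) \<partial>N)"
    and approx: "\<And>\<epsilon> \<eta>. \<lbrakk>\<epsilon> > 0; \<eta> > 0\<rbrakk> \<Longrightarrow> \<exists>m0. \<forall>m\<ge>m0. \<exists>n0. \<forall>n\<ge>n0. \<exists>D\<in>sets M.
        measure M D \<le> \<eta> \<and> (AE x in M. x \<notin> D \<longrightarrow> mdist L (X n x) (XA m n x) \<le> \<epsilon>)"
    and lim: "AE y in N. (\<lambda>m. mdist L (YA m y) (Y y)) \<longlonglongrightarrow> 0"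
  shows "weakly_converges_HJ M L X N Y"
proof -
  interpret prob_space M by fact
  interpret N: prob_space N using tight by (simp add: tight_borel_element_def)
  have Ym: "Y \<in> measurable N (borel_of (mtopology_of L))"
    using tight by (simp add: tight_borel_element_def)
  have Ysp: "Y y \<in> mspace L" if "y \<in> space N" for y
    using measurable_space[OF Ym that] openin_subset[of "mtopology_of L"]
    unfolding borel_of_def by (subst (asm) space_measure_of) auto
  have Fbound: "\<exists>B\<ge>0. \<forall>x\<in>mspace L. \<bar>F x\<bar> \<le> B" if "bounded (F ` mspace L)" for F :: "'b \<Rightarrow> real"
    using that unfolding bounded_iff by (metis abs_ge_zero abs_le_D1 image_eqI order_trans real_norm_def abs_ge_self)
  have lip: "(\<lambda>n. outer_expectation M (\<lambda>x. F (X n x))) \<longlonglongrightarrow> (\<integral>y. F (Y y) \<partial>N)"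
    if F: "lipschitz_functional L F" "bounded (F ` mspace L)" for F
  proof -
    obtain B where B: "B \<ge> 0" "\<And>x. x \<in> mspace L \<Longrightarrow> \<bar>F x\<bar> \<le> B" using Fbound[OF F(2)] by blast
    obtain c where c: "c > 0" "\<And>x y. x \<in> mspace L \<Longrightarrow> y \<in> mspace L \<Longrightarrow> \<bar>F x - F y\<bar> \<le> c * mdist L x y"
      using lipschitz_functionalD[OF F(1)] by blast
    have "(\<lambda>m. \<integral>y. F (YA m y) \<partial>N) \<longlonglongrightarrow> (\<integral>y. F (Y y) \<partial>N)"
    proof (rule integral_dominated_convergence[where w="\<lambda>_. B"])
      show "(\<lambda>y. F (Y y)) \<in> borel_measurable N"
        by (rule borel_measurable_continuous_metric[OF Ym])
           (metis F(1) Lipschitz_continuous_imp_continuous_map mtopology_of_euclidean)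
      show "AE y in N. (\<lambda>m. F (YA m y)) \<longlonglongrightarrow> F (Y y)"
        using lim AE_space
      proof eventually_elim
        case (elim y)
        have "(\<lambda>m. c * mdist L (YA m y) (Y y)) \<longlonglongrightarrow> c * 0" by (intro tendsto_intros elim)
        then show ?case
          by (intro Lim_transform_bound[of "\<lambda>m. F (YA m y) - F (Y y)" _ sequentially, THEN LIM_zero_cancel])
             (auto intro!: always_eventually order_trans[OF c(2)] YA Ysp elim)
      qed
    qed (auto intro!: YA_meas F B YA)
    note Ylim = this
    show ?thesis
    proof (rule LIMSEQ_I)
      fix r :: real assume r: "r > 0"
      obtain m1 where m1: "\<And>m. m \<ge> m1 \<Longrightarrow> \<bar>(\<integral>y. F (YA m y) \<partial>N) - (\<integral>y. F (Y y) \<partial>N)\<bar> < r/4"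
        using LIMSEQ_D[OF Ylim, of "r/4"] r by auto
      define \<epsilon> where "\<epsilon> = r / (4 * c)"
      define \<eta> where "\<eta> = r / (8 * (B + 1))"
      have pos: "\<epsilon> > 0" "\<eta> > 0" using r c B by (auto simp: \<epsilon>_def \<eta>_def)
      obtain m0 where m0: "\<forall>m\<ge>m0. \<exists>n0. \<forall>n\<ge>n0. \<exists>D\<in>sets M.
        measure M D \<le> \<eta> \<and> (AE x in M. x \<notin> D \<longrightarrow> mdist L (X n x) (XA m n x) \<le> \<epsilon>)"
        using approx[OF pos] by blast
      define m where "m = max m0 m1"
      obtain n0 where n0: "\<forall>n\<ge>n0. \<exists>D\<in>sets M.
        measure M D \<le> \<eta> \<and> (AE x in M. x \<notin> D \<longrightarrow> mdist L (X n x) (XA m n x) \<le> \<epsilon>)"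
        using m0 unfolding m_def by (meson max.cobounded1)
      obtain n1 where n1: "\<And>n. n \<ge> n1 \<Longrightarrow> \<bar>(\<integral>x. F (XA m n x) \<partial>M) - (\<integral>y. F (YA m y) \<partial>N)\<bar> < r/4"
        using LIMSEQ_D[OF conv[OF F, of m], of "r/4"] r by auto
      have "\<bar>outer_expectation M (\<lambda>x. F (X n x)) - (\<integral>y. F (Y y) \<partial>N)\<bar> < r" if n: "n \<ge> max n0 n1" for n
      proof -
        obtain D where D: "D \<in> sets M" "measure M D \<le> \<eta>"
          "AE x in M. x \<notin> D \<longrightarrow> mdist L (X n x) (XA m n x) \<le> \<epsilon>"
          using n0 n by auto
        have "\<bar>outer_expectation M (\<lambda>x. F (X n x)) - (\<integral>x. F (XA m n x) \<partial>M)\<bar> \<le> c * \<epsilon> + 2 * B * \<eta>"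
          using pos B by (intro outer_expectation_approx[OF M B(2) c X _ XA_meas[OF F] D]) (auto simp: XA)
        also have "c * \<epsilon> = r/4" using c by (simp add: \<epsilon>_def)
        also have "2 * B * \<eta> \<le> r/4" using B r by (simp add: \<eta>_def field_simps)
        finally have "\<bar>outer_expectation M (\<lambda>x. F (X n x)) - (\<integral>x. F (XA m n x) \<partial>M)\<bar> \<le> r/4 + r/4" by simp
        moreover have "m \<ge> m1" "n \<ge> n1" using n by (auto simp: m_def)
        ultimately show ?thesis using n1[of n] m1[of m] r by linarith
      qed
      then show "\<exists>n0. \<forall>n\<ge>n0. norm (outer_expectation M (\<lambda>x. F (X n x)) - (\<integral>y. F (Y y) \<partial>N)) < r"
        by (intro exI[of _ "max n0 n1"]) auto
    qed
  qed
  \<comment> \<open>Outer expectation is not linear, so convergence along \<open>- G\<close> is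
    recorded as well. Applied to \<open>- F\<close>, this supplies a Lipschitz functional above
    \<open>F\<close>.\<close>
  have lower: "\<exists>G H. (\<lambda>n. outer_expectation M (\<lambda>x. G (X n x))) \<longlonglongrightarrow> (\<integral>y. G (Y y) \<partial>N) \<and>
      (\<lambda>n. outer_expectation M (\<lambda>x. - G (X n x))) \<longlonglongrightarrow> (\<integral>y. - G (Y y) \<partial>N) \<and>
      (\<forall>x\<in>mspace L. \<bar>G x\<bar> \<le> B \<and> G x \<le> F x) \<and> (\<integral>y. F (Y y) \<partial>N) - r < (\<integral>y. G (Y y) \<partial>N)"
    if F: "continuous_map (mtopology_of L) euclideanreal F"
      and B: "\<And>x. x \<in> mspace L \<Longrightarrow> \<bar>F x\<bar> \<le> B" and r: "r > 0" for F :: "'b \<Rightarrow> real" and B r :: real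
  proof -
    obtain G :: "nat \<Rightarrow> 'b \<Rightarrow> real" where G: "\<And>k. lipschitz_functional L (G k)"
      "\<And>k x. x \<in> mspace L \<Longrightarrow> \<bar>G k x\<bar> \<le> B" "\<And>k x. x \<in> mspace L \<Longrightarrow> G k x \<le> F x"
      "\<And>x. x \<in> mspace L \<Longrightarrow> (\<lambda>k. G k x) \<longlonglongrightarrow> F x"
      using lipschitz_approx_below[OF F B] by blast
    have Gm: "(\<lambda>y. G k (Y y)) \<in> borel_measurable N" for k
      by (rule borel_measurable_continuous_metric[OF Ym])
         (metis G(1) Lipschitz_continuous_imp_continuous_map mtopology_of_euclidean)
    have "(\<lambda>k. \<integral>y. G k (Y y) \<partial>N) \<longlonglongrightarrow> (\<integral>y. F (Y y) \<partial>N)"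
      by (rule integral_dominated_convergence[where w="\<lambda>_. B"])
         (auto intro!: G Ysp Gm borel_measurable_continuous_metric[OF Ym F])
    then obtain k where k: "\<bar>(\<integral>y. G k (Y y) \<partial>N) - (\<integral>y. F (Y y) \<partial>N)\<bar> < r"
      using LIMSEQ_D[of _ _ r] r by fastforce
    have b: "bounded (G k ` mspace L)" "bounded ((\<lambda>x. - G k x) ` mspace L)"
      using G(2) unfolding bounded_iff by (auto intro!: exI[of _ B])
    have "lipschitz_functional L (\<lambda>x. - G k x)"
    proof -
      obtain c where "\<And>x y. x \<in> mspace L \<Longrightarrow> y \<in> mspace L \<Longrightarrow> \<bar>G k x - G k y\<bar> \<le> c * mdist L x y"
        using lipschitz_functionalD[OF G(1)] by blast
      then show ?thesis by (intro lipschitz_functionalI[of _ _ c]) (fastforce simp: abs_le_iff)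
    qed
    then show ?thesis using lip[OF G(1) b(1)] lip[of "\<lambda>x. - G k x"] b(2) G(2,3) k by (intro exI[of _ "G k"]) auto
  qed
  show ?thesis
    unfolding weakly_converges_HJ_def
  proof (intro conjI allI impI X tight)
    fix F :: "'b \<Rightarrow> real"
    assume F: "continuous_map (mtopology_of L) euclideanreal F \<and> bounded (F ` mspace L)"
    obtain B where B: "B \<ge> 0" "\<And>x. x \<in> mspace L \<Longrightarrow> \<bar>F x\<bar> \<le> B" using Fbound F by blast
    have F': "continuous_map (mtopology_of L) euclideanreal (\<lambda>x. - F x)"
      using F continuous_map_minus by blast
    show "(\<lambda>n. outer_expectation M (\<lambda>x. F (X n x))) \<longlonglongrightarrow> (\<integral>y. F (Y y) \<partial>N)"
    proof (rule LIMSEQ_I)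
      fix r :: real assume r: "r > 0"
      obtain G where G: "(\<lambda>n. outer_expectation M (\<lambda>x. G (X n x))) \<longlonglongrightarrow> (\<integral>y. G (Y y) \<partial>N)"
        "\<And>x. x \<in> mspace L \<Longrightarrow> \<bar>G x\<bar> \<le> B \<and> G x \<le> F x"
        "(\<integral>y. F (Y y) \<partial>N) - r/2 < (\<integral>y. G (Y y) \<partial>N)"
        using lower[of F B "r/2"] F B r by auto
      obtain H where H: "(\<lambda>n. outer_expectation M (\<lambda>x. - H (X n x))) \<longlonglongrightarrow> (\<integral>y. - H (Y y) \<partial>N)"
        "\<And>x. x \<in> mspace L \<Longrightarrow> \<bar>H x\<bar> \<le> B \<and> H x \<le> - F x"
        "(\<integral>y. - F (Y y) \<partial>N) - r/2 < (\<integral>y. H (Y y) \<partial>N)"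
        using lower[OF F', of B "r/2"] B r by auto
      obtain n1 where n1: "\<And>n. n \<ge> n1 \<Longrightarrow> \<bar>outer_expectation M (\<lambda>x. G (X n x)) - (\<integral>y. G (Y y) \<partial>N)\<bar> < r/2"
        using LIMSEQ_D[OF G(1), of "r/2"] r by auto
      obtain n2 where n2: "\<And>n. n \<ge> n2 \<Longrightarrow> \<bar>outer_expectation M (\<lambda>x. - H (X n x)) - (\<integral>y. - H (Y y) \<partial>N)\<bar> < r/2"
        using LIMSEQ_D[OF H(1), of "r/2"] r by auto
      have "\<bar>outer_expectation M (\<lambda>x. F (X n x)) - (\<integral>y. F (Y y) \<partial>N)\<bar> < r" if n: "n \<ge> max n1 n2" for n
      proof -
        have GF: "G x \<le> F x \<and> -B \<le> G x \<and> F x \<le> B \<and> F x \<le> - H x \<and> -B \<le> F x \<and> - H x \<le> B"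
          if "x \<in> mspace L" for x
          using G(2)[OF that] H(2)[OF that] B(2)[OF that] by (auto simp: abs_le_iff)
        have "outer_expectation M (\<lambda>x. G (X n x)) \<le> outer_expectation M (\<lambda>x. F (X n x))"
          using X[of n] by (intro outer_expectation_mono[OF M, where b="-B" and b'=B])
            (auto elim!: eventually_mono simp: GF)
        moreover have "outer_expectation M (\<lambda>x. F (X n x)) \<le> outer_expectation M (\<lambda>x. - H (X n x))"
          using X[of n] by (intro outer_expectation_mono[OF M, where b="-B" and b'=B])
            (auto elim!: eventually_mono simp: GF)
        moreover have "(\<integral>y. - F (Y y) \<partial>N) = - (\<integral>y. F (Y y) \<partial>N)"
            "(\<integral>y. - H (Y y) \<partial>N) = - (\<integral>y. H (Y y) \<partial>N)" by simp_all
        ultimately show ?thesis using n1[of n] n2[of n] n G(3) H(3) unfolding abs_less_iff by auto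
      qed
      then show "\<exists>n0. \<forall>n\<ge>n0. norm (outer_expectation M (\<lambda>x. F (X n x)) - (\<integral>y. F (Y y) \<partial>N)) < r"
        by (intro exI[of _ "max n1 n2"]) auto
    qed
  qed
qed

section \<open>Dyadic chaining\<close>


definition dyadic :: "nat \<Rightarrow> nat \<Rightarrow> real" where
  "dyadic k i = real i / 2 ^ k"

text \<open>Cells are closed on the left and the point 1 gets index 2^k, a cell of its own. Rounding
  thus fixes both 0 and 1 and preserves the points where the weighted process is set to 0.\<close>

definition dyadic_index :: "nat \<Rightarrow> real \<Rightarrow> nat" where
  "dyadic_index k u = nat \<lfloor>u * 2 ^ k\<rfloor>"

definition dyadic_floor :: "nat \<Rightarrow> real \<Rightarrow> real" where
  "dyadic_floor k u = dyadic k (dyadic_index k u)"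

definition square_floor :: "nat \<Rightarrow> real \<times> real \<Rightarrow> real \<times> real" where
  "square_floor k = (\<lambda>(u, v). (dyadic_floor k u, dyadic_floor k v))"

text \<open>\<open>i\<close> runs over the 2^k edges of a grid line and \<open>j\<close> over all
  2^k + 1 grid lines; the two inequalities are the two directions of edges. Only finitely many
  values of \<open>x\<close> enter.\<close>

definition level_osc :: "(real \<times> real \<Rightarrow> real) \<Rightarrow> real \<Rightarrow> nat \<Rightarrow> bool" where
  "level_osc x a k \<longleftrightarrow> (\<forall>i<2^k. \<forall>j\<le>2^k.
     \<bar>x (dyadic k (Suc i), dyadic k j) - x (dyadic k i, dyadic k j)\<bar> \<le> a \<and>
     \<bar>x (dyadic k j, dyadic k (Suc i)) - x (dyadic k j, dyadic k i)\<bar> \<le> a)"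

lemma dyadic_0 [simp]: "dyadic k 0 = 0" and dyadic_top [simp]: "dyadic k (2 ^ k) = 1"
  by (simp_all add: dyadic_def)

lemma dyadic_mono: "i \<le> j \<Longrightarrow> dyadic k i \<le> dyadic k j"
  by (simp add: dyadic_def divide_right_mono)

lemma dyadic_mem: "i \<le> 2 ^ k \<Longrightarrow> dyadic k i \<in> {0..1}"
  using dyadic_mono[of 0 i k] dyadic_mono[of i "2^k" k] by simp

lemma dyadic_Suc: "dyadic k (Suc i) = dyadic k i + 1 / 2 ^ k"
  by (simp add: dyadic_def field_simps)

lemma dyadic_double: "dyadic (Suc k) (2 * i) = dyadic k i"
  by (simp add: dyadic_def)

lemma dyadic_index_mono: "u \<le> v \<Longrightarrow> dyadic_index k u \<le> dyadic_index k v"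
  unfolding dyadic_index_def by (intro nat_mono floor_mono mult_right_mono) auto

lemma dyadic_index_dyadic [simp]: "dyadic_index k (dyadic k i) = i"
  by (simp add: dyadic_index_def dyadic_def)

lemma dyadic_floor_dyadic [simp]: "dyadic_floor k (dyadic k i) = dyadic k i"
  by (simp add: dyadic_floor_def)

lemma dyadic_floor_0 [simp]: "dyadic_floor k 0 = 0"
  by (simp add: dyadic_floor_def dyadic_index_def)

lemma dyadic_index_1 [simp]: "dyadic_index k 1 = 2 ^ k"
  using dyadic_index_dyadic[of k "2^k"] by (simp del: dyadic_index_dyadic)

lemma dyadic_floor_1 [simp]: "dyadic_floor k 1 = 1"
  by (simp add: dyadic_floor_def)

lemma dyadic_index_le: "u \<le> 1 \<Longrightarrow> dyadic_index k u \<le> 2 ^ k"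
  using dyadic_index_mono[of u 1 k] by simp

lemma dyadic_floor_mono: "u \<le> v \<Longrightarrow> dyadic_floor k u \<le> dyadic_floor k v"
  unfolding dyadic_floor_def by (intro dyadic_mono dyadic_index_mono)

lemma dyadic_floor_min: "dyadic_floor k (min u v) = min (dyadic_floor k u) (dyadic_floor k v)"
  using dyadic_floor_mono[of u v k] dyadic_floor_mono[of v u k] by (auto simp: min_def)

lemma dyadic_floor_bounds:
  assumes "0 \<le> u"
  shows "dyadic_floor k u \<le> u" "u < dyadic_floor k u + 1 / 2 ^ k"
proof -
  have e: "real (dyadic_index k u) = of_int \<lfloor>u * 2 ^ k\<rfloor>"
    using assms by (simp add: dyadic_index_def)
  have "real (dyadic_index k u) \<le> u * 2 ^ k" unfolding e by simp
  then show "dyadic_floor k u \<le> u" by (simp add: dyadic_floor_def dyadic_def field_simps)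
  have "u * 2 ^ k < real (dyadic_index k u) + 1" unfolding e by linarith
  then show "u < dyadic_floor k u + 1 / 2 ^ k" by (simp add: dyadic_floor_def dyadic_def field_simps)
qed

lemma dyadic_floor_mem: "u \<in> {0..1} \<Longrightarrow> dyadic_floor k u \<in> {0..1}"
  unfolding dyadic_floor_def by (intro dyadic_mem dyadic_index_le) auto

lemma square_floor_mem: "t \<in> unit_square \<Longrightarrow> square_floor k t \<in> unit_square"
  using dyadic_floor_mem by (cases t) (auto simp: square_floor_def)

lemma dyadic_index_Suc:
  assumes "0 \<le> u"
  shows "dyadic_index (Suc k) u = 2 * dyadic_index k u \<or> dyadic_index (Suc k) u = Suc (2 * dyadic_index k u)"
proof -
  have "\<lfloor>u * 2 ^ Suc k\<rfloor> = 2 * \<lfloor>u * 2 ^ k\<rfloor> \<or> \<lfloor>u * 2 ^ Suc k\<rfloor> = 2 * \<lfloor>u * 2 ^ k\<rfloor> + 1"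
    by (simp add: mult.assoc[symmetric]) linarith
  moreover have "\<lfloor>u * 2 ^ k\<rfloor> \<ge> 0" using assms by simp
  ultimately show ?thesis unfolding dyadic_index_def by linarith
qed

lemma dyadic_index_near:
  assumes "0 \<le> u" "0 \<le> v" "v \<le> u + 1 / 2 ^ k"
  shows "dyadic_index k v \<le> Suc (dyadic_index k u)"
proof -
  have "v * 2 ^ k \<le> u * 2 ^ k + 1" using assms by (simp add: field_simps)
  then have "\<lfloor>v * 2 ^ k\<rfloor> \<le> \<lfloor>u * 2 ^ k\<rfloor> + 1" by linarith
  then show ?thesis unfolding dyadic_index_def by linarith
qed

text \<open>A diagonal move is split at the grid point with indices \<open>i'\<close> and
  \<open>j\<close> into two edges.\<close>

lemma level_osc_near:
  assumes osc: "level_osc x a k" and a: "0 \<le> a"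
    and le: "i \<le> 2^k" "i' \<le> 2^k" "j \<le> 2^k" "j' \<le> 2^k"
    and near: "i \<le> Suc i'" "i' \<le> Suc i" "j \<le> Suc j'" "j' \<le> Suc j"
  shows "\<bar>x (dyadic k i, dyadic k j) - x (dyadic k i', dyadic k j')\<bar> \<le> 2 * a"
proof -
  have 1: "\<bar>x (dyadic k i, dyadic k j) - x (dyadic k i', dyadic k j)\<bar> \<le> a"
  proof -
    consider "i = i'" | "i = Suc i'" | "i' = Suc i" using near by linarith
    then show ?thesis
    proof cases
      case 2 then show ?thesis using osc le unfolding level_osc_def by auto
    next
      case 3 then show ?thesis using osc le unfolding level_osc_def by (auto simp: abs_minus_commute)
    qed (use a in auto)
  qed
  have 2: "\<bar>x (dyadic k i', dyadic k j) - x (dyadic k i', dyadic k j')\<bar> \<le> a"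
  proof -
    consider "j = j'" | "j = Suc j'" | "j' = Suc j" using near by linarith
    then show ?thesis
    proof cases
      case 2 then show ?thesis using osc le unfolding level_osc_def by auto
    next
      case 3 then show ?thesis using osc le unfolding level_osc_def by (auto simp: abs_minus_commute)
    qed (use a in auto)
  qed
  show ?thesis using 1 2 by linarith
qed

text \<open>Points at most one mesh apart lie in equal or adjacent cells in each coordinate.\<close>

lemma level_osc_square_floor:
  assumes osc: "level_osc x a k" and a: "0 \<le> a" and s: "s \<in> unit_square" and t: "t \<in> unit_square"
    and d: "\<bar>fst s - fst t\<bar> \<le> 1 / 2 ^ k" "\<bar>snd s - snd t\<bar> \<le> 1 / 2 ^ k"
  shows "\<bar>x (square_floor k s) - x (square_floor k t)\<bar> \<le> 2 * a"
proof -
  obtain u v u' v' where st: "s = (u, v)" "t = (u', v')" by (cases s, cases t)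
  show ?thesis
    unfolding st square_floor_def dyadic_floor_def prod.case
    using s t d unfolding st
    by (intro level_osc_near[OF osc a] dyadic_index_le dyadic_index_near) auto
qed

text \<open>The chaining bound telescopes over the levels; the form of the right-hand side is what
  makes the induction on the finer level go through.\<close>
lemma square_floor_chain:
  assumes osc: "\<And>k. k \<le> K \<Longrightarrow> level_osc x (A * \<rho> ^ k) k"
    and A: "0 \<le> A" and \<rho>: "0 < \<rho>" "\<rho> < 1" and t: "t \<in> unit_square"
    and mk: "m \<le> k" "k \<le> K"
  shows "\<bar>x (square_floor k t) - x (square_floor m t)\<bar> \<le> 2 * A / (1 - \<rho>) * (\<rho> ^ m - \<rho> ^ k)"
  using mk
proof (induction k rule: dec_induct)
  case base
  then show ?case by simp
next
  case (step k)
  obtain u v where uv: "t = (u, v)" "0 \<le> u" "u \<le> 1" "0 \<le> v" "v \<le> 1" using t by (cases t) auto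
  \<comment> \<open>The corner of level \<open>k\<close> is a grid point of level
    \<open>Suc k\<close> with even indices, and there the next corner differs from it by at most one
    index in each coordinate.\<close>
  have c: "square_floor k t = (dyadic (Suc k) (2 * dyadic_index k u), dyadic (Suc k) (2 * dyadic_index k v))"
    by (simp add: uv square_floor_def dyadic_floor_def dyadic_double)
  have le: "2 * dyadic_index k u \<le> 2 ^ Suc k" "2 * dyadic_index k v \<le> 2 ^ Suc k"
    using dyadic_index_le uv by auto
  have "\<bar>x (square_floor (Suc k) t) - x (square_floor k t)\<bar> \<le> 2 * (A * \<rho> ^ Suc k)"
    unfolding c
    unfolding uv square_floor_def dyadic_floor_def prod.case
    using dyadic_index_Suc[OF uv(2), of k] dyadic_index_Suc[OF uv(4), of k] uv A \<rho>
    by (intro level_osc_near[OF osc[OF step.prems]] le dyadic_index_le) auto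
  also have "\<dots> \<le> 2 * (A * \<rho> ^ k)"
    using A \<rho> by (intro mult_left_mono power_decreasing) auto
  also have "\<dots> = 2 * A / (1 - \<rho>) * (\<rho> ^ k - \<rho> ^ Suc k)"
    using \<rho> by (simp add: field_simps)
  finally have "\<bar>x (square_floor (Suc k) t) - x (square_floor k t)\<bar> \<le> 2 * A / (1 - \<rho>) * (\<rho> ^ k - \<rho> ^ Suc k)" .
  moreover have "2 * A / (1 - \<rho>) * (\<rho> ^ k - \<rho> ^ Suc k) + 2 * A / (1 - \<rho>) * (\<rho> ^ m - \<rho> ^ k)
      = 2 * A / (1 - \<rho>) * (\<rho> ^ m - \<rho> ^ Suc k)"
    by (simp only: distrib_left[symmetric]) simp
  ultimately show ?case using step.IH step.prems by linarith 
qed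

lemma square_floor_chain_bound:
  assumes osc: "\<And>k. k \<le> K \<Longrightarrow> level_osc x (A * \<rho> ^ k) k"
    and A: "0 \<le> A" and \<rho>: "0 < \<rho>" "\<rho> < 1" and t: "t \<in> unit_square"
    and mk: "m \<le> k" "k \<le> K"
  shows "\<bar>x (square_floor k t) - x (square_floor m t)\<bar> \<le> 2 * A / (1 - \<rho>) * \<rho> ^ m"
proof -
  have "2 * A / (1 - \<rho>) * (\<rho> ^ m - \<rho> ^ k) \<le> 2 * A / (1 - \<rho>) * \<rho> ^ m"
    using A \<rho> by (intro mult_left_mono) auto
  then show ?thesis using square_floor_chain[OF assms] by linarith
qed

section \<open>The weight function\<close>


text \<open>The value 0 at the ends of the interval absorbs the case distinction of
  \<open>weighted_process\<close>: the product of \<open>inv_weight\<close> with the unweighted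
  process vanishes at once on the lower and left edges and at (1, 1).\<close>

definition inv_weight :: "real \<Rightarrow> real \<Rightarrow> real" where
  "inv_weight \<omega> x = (if 0 < x \<and> x < 1 then 1 / q_weight \<omega> x else 0)"

lemma q_weight_eq: "0 \<le> x \<Longrightarrow> x \<le> 1 \<Longrightarrow> q_weight \<omega> x = (x * (1 - x)) powr \<omega>"
  by (simp add: q_weight_def powr_mult)

lemma inv_weight_eq: "0 < x \<Longrightarrow> x < 1 \<Longrightarrow> inv_weight \<omega> x = (x * (1 - x)) powr (-\<omega>)"
  by (simp add: inv_weight_def q_weight_eq powr_minus divide_inverse)

lemma inv_weight_nonneg [simp]: "0 \<le> inv_weight \<omega> x"
  by (simp add: inv_weight_def q_weight_def)

lemma inv_weight_0 [simp]: "inv_weight \<omega> 0 = 0" and inv_weight_1 [simp]: "inv_weight \<omega> 1 = 0"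
  by (simp_all add: inv_weight_def)

lemma mult_powr_square: "0 < p \<Longrightarrow> p * (p powr a)\<^sup>2 = p powr (1 + 2 * a)" for p a :: real
  unfolding mult_2 powr_add power2_eq_square by simp

lemma mult_compl_lower:
  fixes h x :: real
  assumes "0 < h" "h \<le> 1/2" "h \<le> x" "x \<le> 1 - h"
  shows "h / 2 \<le> x * (1 - x)"
proof -
  have "0 \<le> (x - h) * (1 - h - x)" using assms by simp
  then have "h * (1 - h) \<le> x * (1 - x)" by (simp add: algebra_simps)
  moreover have "h * (1/2) \<le> h * (1 - h)" using assms by (intro mult_left_mono) auto
  ultimately show ?thesis by simp
qed

context
  fixes \<omega> :: real
  assumes \<omega>: "0 \<le> \<omega>" "\<omega> < 1/2"
begin

lemma two_powr_le: "2 powr \<omega> \<le> 2"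
  using powr_mono[of \<omega> 1 2] \<omega> by simp

lemma inv_weight_upper:
  assumes h: "0 < h" "h \<le> 1/2" "h \<le> x" "x \<le> 1 - h"
  shows "inv_weight \<omega> x \<le> 2 * h powr (-\<omega>)"
proof -
  have "inv_weight \<omega> x = (x * (1 - x)) powr (-\<omega>)" using h by (intro inv_weight_eq) auto
  also have "\<dots> \<le> (h / 2) powr (-\<omega>)"
    using mult_compl_lower[OF h] h \<omega> by (intro powr_mono2') auto
  also have "\<dots> = 2 powr \<omega> * h powr (-\<omega>)"
    using h by (simp add: powr_divide powr_minus field_simps)
  also have "\<dots> \<le> 2 * h powr (-\<omega>)" by (intro mult_right_mono two_powr_le) auto
  finally show ?thesis .
qed

text \<open>The factor y (1 - y) is the order of the variance of the indicator that the weight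
  increment will multiply. With p(z) = z (1 - z), the mean value theorem bounds the increment by h
  p(z)^(-\<omega>-1), so the product is of order h^2 p(z)^(-1-2\<omega>), and p(z) is at least
  h/2.\<close>

lemma inv_weight_increment_interior:
  assumes h: "0 < h" "h \<le> 1/2" and x: "h \<le> x" "x \<le> 1 - h" and y: "h \<le> y" "y \<le> 1 - h"
    and xy: "\<bar>x - y\<bar> \<le> h"
  shows "y * (1 - y) * (inv_weight \<omega> x - inv_weight \<omega> y)\<^sup>2 \<le> 4 * h powr (1 - 2 * \<omega>)"
proof -
  let ?p = "\<lambda>z::real. z * (1 - z)"
  let ?r = "\<lambda>z. ?p z powr (-\<omega>)"
  have "\<exists>z. h \<le> z \<and> z \<le> 1 - h \<and> \<bar>z - y\<bar> \<le> h \<and> \<bar>?r x - ?r y\<bar> \<le> \<omega> * ?p z powr (-\<omega> - 1) * h"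
  proof (cases "x = y")
    case True
    then show ?thesis using h y \<omega> by (intro exI[of _ y]) auto
  next
    case False
    define a b where "a = min x y" and "b = max x y"
    have ab: "a < b" "h \<le> a" "b \<le> 1 - h" "b - a \<le> h" using False x y xy by (auto simp: a_def b_def)
    have der: "(?r has_real_derivative (-\<omega> * ?p z powr (-\<omega> - 1) * (1 - 2 * z))) (at z)"
      if "a \<le> z" "z \<le> b" for z
    proof -
      have "0 < ?p z" using that ab h by (intro mult_pos_pos) auto
      moreover have "(?p has_real_derivative (1 - 2 * z)) (at z)" by (auto intro!: derivative_eq_intros)
      ultimately show ?thesis using DERIV_fun_powr[of ?p "1 - 2 * z" z "-\<omega>"] by simp
    qed
    obtain z where z: "a < z" "z < b" "?r b - ?r a = (b - a) * (-\<omega> * ?p z powr (-\<omega> - 1) * (1 - 2 * z))"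
      using MVT2[OF ab(1) der] by blast
    have "\<bar>?r x - ?r y\<bar> = \<bar>?r b - ?r a\<bar>" by (auto simp: a_def b_def min_def max_def)
    also have "\<dots> = \<omega> * ?p z powr (-\<omega> - 1) * ((b - a) * \<bar>1 - 2 * z\<bar>)"
      unfolding z(3) using \<omega> ab by (simp add: abs_mult)
    also have "\<dots> \<le> \<omega> * ?p z powr (-\<omega> - 1) * (h * 1)"
      using \<omega> ab z h by (intro mult_left_mono mult_mono) auto
    finally have "\<bar>?r x - ?r y\<bar> \<le> \<omega> * ?p z powr (-\<omega> - 1) * h" by simp
    moreover have "a \<le> y" "y \<le> b" by (auto simp: a_def b_def)
    then have "h \<le> z" "z \<le> 1 - h" "\<bar>z - y\<bar> \<le> h" using z(1,2) ab by linarith+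
    ultimately show ?thesis by blast
  qed
  then obtain z where z: "h \<le> z" "z \<le> 1 - h" "\<bar>z - y\<bar> \<le> h"
    "\<bar>?r x - ?r y\<bar> \<le> \<omega> * ?p z powr (-\<omega> - 1) * h" by blast
  have pz: "h / 2 \<le> ?p z" by (intro mult_compl_lower h z)
  \<comment> \<open>Both \<open>z\<close> and \<open>1 - z\<close> are at least \<open>h\<close>,
    and \<open>y\<close> is within \<open>h\<close> of \<open>z\<close>.\<close>
  have "?p y \<le> (2 * z) * (2 * (1 - z))" using h x y z by (intro mult_mono) auto
  then have py: "?p y \<le> 4 * ?p z" by (simp add: algebra_simps)
  have r: "inv_weight \<omega> x = ?r x" "inv_weight \<omega> y = ?r y" by (rule inv_weight_eq; use h x y in linarith)+
  have "?p y * (inv_weight \<omega> x - inv_weight \<omega> y)\<^sup>2 = ?p y * \<bar>?r x - ?r y\<bar>\<^sup>2"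
    by (simp only: r power2_abs)
  also have "\<dots> \<le> (4 * ?p z) * (\<omega> * ?p z powr (-\<omega> - 1) * h)\<^sup>2"
    using pz h by (intro mult_mono py power_mono z) auto
  also have "\<dots> = (2 * \<omega>)\<^sup>2 * h\<^sup>2 * (?p z * (?p z powr (-\<omega> - 1))\<^sup>2)"
    by (simp only: power_mult_distrib) algebra
  also have "?p z * (?p z powr (-\<omega> - 1))\<^sup>2 = ?p z powr (-1 - 2 * \<omega>)"
    by (subst mult_powr_square) (use pz h in linarith, simp)
  also have "(2 * \<omega>)\<^sup>2 * h\<^sup>2 * \<dots> \<le> 1 * h\<^sup>2 * (h / 2) powr (-1 - 2 * \<omega>)"
    using \<omega> pz h by (intro mult_mono powr_mono2' power_le_one) auto
  also have "(h / 2) powr (-1 - 2 * \<omega>) = 2 powr (1 + 2 * \<omega>) * h powr (-1 - 2 * \<omega>)"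
    using h powr_minus_divide[of "h / 2" "1 + 2 * \<omega>"] powr_minus_divide[of h "1 + 2 * \<omega>"]
    by (simp add: powr_divide)
  also have "1 * h\<^sup>2 * (2 powr (1 + 2 * \<omega>) * h powr (-1 - 2 * \<omega>))
      = 2 powr (1 + 2 * \<omega>) * (h powr 2 * h powr (-1 - 2 * \<omega>))"
    using h by simp
  also have "h powr 2 * h powr (-1 - 2 * \<omega>) = h powr (1 - 2 * \<omega>)"
    by (simp flip: powr_add)
  also have "2 powr (1 + 2 * \<omega>) \<le> (4::real)"
    using powr_mono[of "1 + 2 * \<omega>" 2 2] \<omega> by simp
  finally show ?thesis using h by simp
qed

text \<open>If \<open>x\<close> is an end of the interval, its weight is 0 and the increment is the
  whole weight at \<open>y\<close>. Then p = y (1 - y) is at most \<open>h\<close>, because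
  \<open>y\<close> is within \<open>h\<close> of that end, and the left side equals
  p^(1-2\<omega>).\<close>

lemma inv_weight_increment:
  assumes h: "0 < h" "h \<le> 1/2"
    and x: "x = 0 \<or> x = 1 \<or> h \<le> x \<and> x \<le> 1 - h" and y: "y = 0 \<or> y = 1 \<or> h \<le> y \<and> y \<le> 1 - h"
    and xy: "\<bar>x - y\<bar> \<le> h"
  shows "y * (1 - y) * (inv_weight \<omega> x - inv_weight \<omega> y)\<^sup>2 \<le> 4 * h powr (1 - 2 * \<omega>)"
proof -
  consider "y = 0 \<or> y = 1" | "h \<le> y \<and> y \<le> 1 - h" "x = 0 \<or> x = 1"
    | "h \<le> y \<and> y \<le> 1 - h" "h \<le> x \<and> x \<le> 1 - h" using x y by auto
  then show ?thesis
  proof cases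
    case 1 then show ?thesis by auto
  next
    case 2
    let ?p = "y * (1 - y)"
    have y01: "0 < y" "y < 1" using 2 h by auto
    have "?p \<le> h"
    proof (cases "x = 0")
      case True
      then have "?p \<le> h * 1" using xy y01 by (intro mult_mono) auto
      then show ?thesis by simp
    next
      case False
      then have "?p \<le> 1 * h" using 2 xy y01 by (intro mult_mono) auto
      then show ?thesis by simp
    qed
    have "?p * (inv_weight \<omega> x - inv_weight \<omega> y)\<^sup>2 = ?p * (?p powr (-\<omega>))\<^sup>2"
      using 2(2) inv_weight_eq[OF y01, of \<omega>] by auto
    also have "\<dots> = ?p powr (1 - 2 * \<omega>)"
      using y01 by (simp add: mult_powr_square)
    also have "\<dots> \<le> h powr (1 - 2 * \<omega>)"
      using \<open>?p \<le> h\<close> y01 \<omega> by (intro powr_mono2) auto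
    also have "\<dots> \<le> 4 * h powr (1 - 2 * \<omega>)" by simp
    finally show ?thesis .
  next
    case 3 then show ?thesis using h xy by (intro inv_weight_increment_interior) auto
  qed
qed

text \<open>The derivative of p^\<omega>, with p = z (1 - z), is \<omega> p^(\<omega>-1) (1 - 2 z).
  As p lies between d/2 and 1, p^(\<omega>-1) is at most 2/d, and \<omega> < 1/2 cancels the
  2.\<close>

lemma q_weight_lipschitz:
  assumes d: "0 < d" "d \<le> 1/2" and x: "d \<le> x" "x \<le> 1 - d" and y: "d \<le> y" "y \<le> 1 - d"
  shows "\<bar>q_weight \<omega> x - q_weight \<omega> y\<bar> \<le> \<bar>x - y\<bar> / d"
proof -
  let ?p = "\<lambda>z::real. z * (1 - z)"
  let ?r = "\<lambda>z. ?p z powr \<omega>"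
  have main: "\<bar>?r b - ?r a\<bar> \<le> (b - a) / d" if ab: "a < b" "d \<le> a" "b \<le> 1 - d" for a b
  proof -
    have der: "(?r has_real_derivative (\<omega> * ?p z powr (\<omega> - 1) * (1 - 2 * z))) (at z)"
      if "a \<le> z" "z \<le> b" for z
    proof -
      have "0 < ?p z" using that ab d by (intro mult_pos_pos) auto
      moreover have "(?p has_real_derivative (1 - 2 * z)) (at z)" by (auto intro!: derivative_eq_intros)
      ultimately show ?thesis using DERIV_fun_powr[of ?p "1 - 2 * z" z "\<omega>"] by simp
    qed
    obtain z where z: "a < z" "z < b" "?r b - ?r a = (b - a) * (\<omega> * ?p z powr (\<omega> - 1) * (1 - 2 * z))"
      using MVT2[OF ab(1) der] by blast
    have pz: "d / 2 \<le> ?p z" using z ab d by (intro mult_compl_lower) auto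
    have pz1: "?p z \<le> 1" using z ab d by (intro mult_le_one) auto
    have "\<bar>?r b - ?r a\<bar> = (b - a) * (\<omega> * ?p z powr (\<omega> - 1) * \<bar>1 - 2 * z\<bar>)"
      unfolding z(3) using \<omega> ab by (simp add: abs_mult)
    also have "\<dots> \<le> (b - a) * (1/2 * ?p z powr (-1) * 1)"
      using \<omega> ab z d pz pz1 by (intro mult_left_mono mult_mono powr_mono') auto
    also have "\<dots> \<le> (b - a) * (1/2 * (d/2) powr (-1) * 1)"
      using \<omega> ab z d pz pz1 by (intro mult_left_mono mult_mono powr_mono2') auto
    also have "\<dots> = (b - a) / d" using d by (simp add: powr_minus field_simps)
    finally show ?thesis .
  qed
  have "q_weight \<omega> x = ?r x" "q_weight \<omega> y = ?r y" using d x y by (auto simp: q_weight_eq)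
  then show ?thesis using main[of x y] main[of y x] x y d by (cases x y rule: linorder_cases) auto
qed

lemma q_weight_le_1:
  assumes "0 \<le> x" "x \<le> 1"
  shows "q_weight \<omega> x \<le> 1"
proof -
  have "x * (1 - x) \<le> 1" using assms by (intro mult_le_one) auto
  then have "(x * (1 - x)) powr \<omega> \<le> 1" using \<omega> assms by (intro powr_le1) auto
  then show ?thesis using assms by (simp add: q_weight_eq)
qed

text \<open>Passing from \<open>x\<close> to \<open>y\<close> enlarges only one of the two factors
  of x (1 - x), and that one at most doubles.\<close>

lemma q_weight_ratio:
  assumes "0 < x" "x < 1" "0 \<le> y" "y \<le> 1" "y \<le> 2 * x" "1 - y \<le> 2 * (1 - x)" "y \<le> x \<or> x \<le> y"
  shows "q_weight \<omega> y * inv_weight \<omega> x \<le> 2"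
proof -
  have "y * (1 - y) \<le> 2 * (x * (1 - x))"
  proof (cases "y \<le> x")
    case True
    then have "y * (1 - y) \<le> x * (2 * (1 - x))" using assms by (intro mult_mono) auto
    then show ?thesis by (simp add: algebra_simps)
  next
    case False
    then have "y * (1 - y) \<le> (2 * x) * (1 - x)" using assms by (intro mult_mono) auto
    then show ?thesis by simp
  qed
  then have "q_weight \<omega> y \<le> (2 * (x * (1 - x))) powr \<omega>"
    using assms \<omega> by (simp add: q_weight_eq powr_mono2)
  also have "\<dots> = 2 powr \<omega> * (x * (1 - x)) powr \<omega>" using assms by (simp add: powr_mult)
  finally have "q_weight \<omega> y * inv_weight \<omega> x \<le> 2 powr \<omega> * (x * (1 - x)) powr \<omega> * (x * (1 - x)) powr (-\<omega>)"
    using assms by (simp add: inv_weight_eq mult_right_mono)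
  also have "\<dots> = 2 powr \<omega>" using assms by (simp add: powr_minus field_simps)
  finally show ?thesis using two_powr_le by linarith
qed

lemma inv_weight_le_left:
  assumes "0 < x" "x \<le> 1/2"
  shows "inv_weight \<omega> x \<le> 2 * x powr (-\<omega>)"
  by (rule inv_weight_upper) (use assms in linarith)+

lemma inv_weight_le_right:
  assumes "x < 1" "1/2 \<le> x"
  shows "inv_weight \<omega> x \<le> 2 * (1 - x) powr (-\<omega>)"
  by (rule inv_weight_upper) (use assms in linarith)+

end

section \<open>Between the grid points\<close>


definition min_coord :: "real \<times> real \<Rightarrow> real" where
  "min_coord t = min (fst t) (snd t)"

lemma min_coord_square_floor: "min_coord (square_floor k t) = dyadic_floor k (min_coord t)"
  by (cases t) (simp add: min_coord_def square_floor_def dyadic_floor_min)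

lemma min_coord_mem: "t \<in> unit_square \<Longrightarrow> min_coord t \<in> {0..1}"
  by (cases t) (auto simp: min_coord_def)

lemma min_coord_eq_1: "t \<in> unit_square \<Longrightarrow> min_coord t = 1 \<Longrightarrow> t = (1, 1)"
  by (cases t) (auto simp: min_coord_def min_def split: if_splits)

text \<open>\<open>C\<close> plays the copula and \<open>D\<close> the empirical distribution function of a sample that avoids
  the boundary of the square; \<open>S\<close> controls the sample in the outermost cells of the grid of
  mesh \<open>h\<close>.\<close>
locale weighted_difference =
  fixes C D :: "real \<times> real \<Rightarrow> real" and N \<omega> A \<rho> S h :: real and K :: nat
    and X :: "real \<times> real \<Rightarrow> real"
  defines "X \<equiv> \<lambda>t. N * (D t - C t) * inv_weight \<omega> (min_coord t)"
    and "h \<equiv> 1 / 2 ^ K"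
  assumes \<omega>: "0 \<le> \<omega>" "\<omega> < 1/2" and N: "0 \<le> N" and K: "1 \<le> K"
    and A: "0 \<le> A" and \<rho>: "0 < \<rho>" "\<rho> < 1"
    and C_mono: "\<And>s t. \<lbrakk>s \<in> unit_square; t \<in> unit_square; fst s \<le> fst t; snd s \<le> snd t\<rbrakk> \<Longrightarrow>
        C s \<le> C t \<and> C t \<le> C s + (fst t - fst s) + (snd t - snd s)"
    and D_mono: "\<And>s t. \<lbrakk>s \<in> unit_square; t \<in> unit_square; fst s \<le> fst t; snd s \<le> snd t\<rbrakk> \<Longrightarrow> D s \<le> D t"
    and C_low: "\<And>t. t \<in> unit_square \<Longrightarrow> 0 \<le> C t \<and> C t \<le> min_coord t"
    and C_high: "\<And>t. t \<in> unit_square \<Longrightarrow> C t \<le> 1 \<and> 1 - C t \<le> 2 * (1 - min_coord t)"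
    and D01: "\<And>t. t \<in> unit_square \<Longrightarrow> 0 \<le> D t \<and> D t \<le> 1" and D_top: "D (1, 1) = 1"
    and S0: "0 \<le> S"
    and S_low: "\<And>t. \<lbrakk>t \<in> unit_square; 0 < min_coord t; min_coord t < h\<rbrakk> \<Longrightarrow>
        N * D t * inv_weight \<omega> (min_coord t) \<le> S"
    and S_high: "\<And>t. \<lbrakk>t \<in> unit_square; min_coord t < 1; 1 - h < min_coord t\<rbrakk> \<Longrightarrow>
        N * (1 - D t) * inv_weight \<omega> (min_coord t) \<le> S"
    and osc: "\<And>k. k \<le> K \<Longrightarrow> level_osc X (A * \<rho> ^ k) k"
begin

text \<open>The sum of the geometric series of chaining steps 2 A \<rho>^k.\<close>

abbreviation "B \<equiv> 2 * A / (1 - \<rho>)"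

lemma h: "0 < h" "h \<le> 1/2"
proof -
  have "(2::real) ^ 1 \<le> 2 ^ K" by (rule power_increasing[OF K]) simp
  then show "h \<le> 1/2" by (simp add: h_def field_simps)
qed (simp add: h_def)

lemma A_le_B: "2 * A \<le> B"
  using A \<rho> by (simp add: field_simps)

lemma B0: "0 \<le> B" using A \<rho> by simp

lemma X_0: "min_coord t = 0 \<or> min_coord t = 1 \<Longrightarrow> X t = 0"
  by (auto simp: X_def)

lemma chain: "t \<in> unit_square \<Longrightarrow> m \<le> k \<Longrightarrow> k \<le> K \<Longrightarrow>
    \<bar>X (square_floor k t) - X (square_floor m t)\<bar> \<le> B * \<rho> ^ m"
  by (rule square_floor_chain_bound[OF osc A \<rho>])

text \<open>Chaining down to level 0 ends at a corner of the unit square, where \<open>X\<close>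
  vanishes.\<close>

lemma X_grid_bound: assumes t: "t \<in> unit_square" shows "\<bar>X (square_floor K t)\<bar> \<le> B"
proof -
  have "min_coord (square_floor 0 t) \<in> {0, 1}"
  proof -
    have "dyadic_index 0 (min_coord t) \<le> 1"
      using dyadic_index_le[of "min_coord t" 0] min_coord_mem[OF t] by simp
    then show ?thesis
      unfolding min_coord_square_floor dyadic_floor_def
      by (cases "dyadic_index 0 (min_coord t)") (auto simp: dyadic_def)
  qed
  then have "X (square_floor 0 t) = 0" by (intro X_0) auto
  then show ?thesis using chain[OF t, of 0 K] by simp
qed

lemma powr_1_minus: "0 < x \<Longrightarrow> x \<le> h \<Longrightarrow> x * x powr (-\<omega>) \<le> h powr (1 - \<omega>)"
proof -
  assume x: "0 < x" "x \<le> h"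
  have "x * x powr (-\<omega>) = x powr (1 - \<omega>)"
    using x powr_mult_base[of x "-\<omega>"] by simp
  also have "\<dots> \<le> h powr (1 - \<omega>)" using x \<omega> by (intro powr_mono2) auto
  finally show ?thesis .
qed

text \<open>In the outermost cells no cancellation between \<open>D\<close> and \<open>C\<close> is
  used: the weighted \<open>D\<close> is at most \<open>S\<close>, and the weighted \<open>C\<close>
  is of order a^(1-\<omega>) with a = \<open>min_coord t\<close>.\<close>

lemma outer_cell_low:
  assumes t: "t \<in> unit_square" and a: "min_coord t < h"
  shows "\<bar>X t\<bar> \<le> S + 2 * (N * h powr (1 - \<omega>))"
proof (cases "min_coord t = 0")
  case True
  then show ?thesis using X_0 S0 N by simp
next
  case False
  let ?a = "min_coord t"
  have a0: "0 < ?a" using min_coord_mem[OF t] False by simp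
  have "C t * inv_weight \<omega> ?a \<le> ?a * (2 * ?a powr (-\<omega>))"
    using C_low[OF t] a0 a h by (intro mult_mono inv_weight_le_left \<omega>) auto
  also have "\<dots> \<le> 2 * h powr (1 - \<omega>)" using powr_1_minus[OF a0] a by simp
  finally have c: "N * (C t * inv_weight \<omega> ?a) \<le> N * (2 * h powr (1 - \<omega>))"
    by (intro mult_left_mono N)
  have nn: "0 \<le> N * D t * inv_weight \<omega> ?a" "0 \<le> N * (C t * inv_weight \<omega> ?a)"
    using N D01[OF t] C_low[OF t] by auto
  have "X t = N * D t * inv_weight \<omega> ?a - N * (C t * inv_weight \<omega> ?a)"
    by (simp add: X_def algebra_simps)
  then show ?thesis using c nn S_low[OF t a0 a] by (simp add: abs_le_iff)
qed

text \<open>Near (1, 1) the same argument works after writing D - C as (1 - C) - (1 - D).\<close>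

lemma outer_cell_high:
  assumes t: "t \<in> unit_square" and a: "1 - h < min_coord t"
  shows "\<bar>X t\<bar> \<le> S + 4 * (N * h powr (1 - \<omega>))"
proof (cases "min_coord t = 1")
  case True
  then show ?thesis using X_0 S0 N by simp
next
  case False
  let ?a = "min_coord t"
  have a1: "?a < 1" using min_coord_mem[OF t] False by simp
  have "(1 - C t) * inv_weight \<omega> ?a \<le> (2 * (1 - ?a)) * (2 * (1 - ?a) powr (-\<omega>))"
    using C_high[OF t] a1 a h by (intro mult_mono inv_weight_le_right \<omega>) auto
  also have "\<dots> = 4 * ((1 - ?a) * (1 - ?a) powr (-\<omega>))" by simp
  also have "\<dots> \<le> 4 * h powr (1 - \<omega>)"
    by (intro mult_left_mono powr_1_minus) (use a a1 in auto)
  finally have c: "N * ((1 - C t) * inv_weight \<omega> ?a) \<le> N * (4 * h powr (1 - \<omega>))"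
    by (intro mult_left_mono N)
  have nn: "0 \<le> N * (1 - D t) * inv_weight \<omega> ?a" "0 \<le> N * ((1 - C t) * inv_weight \<omega> ?a)"
    using N D01[OF t] C_high[OF t] by auto
  have "X t = N * ((1 - C t) * inv_weight \<omega> ?a) - N * (1 - D t) * inv_weight \<omega> ?a"
    by (simp add: X_def algebra_simps)
  then show ?thesis using c nn S_high[OF t a1 a] by (simp add: abs_le_iff)
qed

text \<open>The index is capped because the cell of a coordinate equal to 1 has no right neighbour
  inside the square.\<close>

definition upper_corner :: "real \<times> real \<Rightarrow> real \<times> real" where
  "upper_corner = (\<lambda>(u, v). (dyadic K (min (Suc (dyadic_index K u)) (2 ^ K)),
                             dyadic K (min (Suc (dyadic_index K v)) (2 ^ K))))"

lemma upper_coord: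
  assumes "u \<in> {0..1}"
  shows "u \<le> dyadic K (min (Suc (dyadic_index K u)) (2 ^ K))"
    "dyadic K (min (Suc (dyadic_index K u)) (2 ^ K)) \<le> dyadic_floor K u + h"
    "dyadic K (min (Suc (dyadic_index K u)) (2 ^ K)) \<in> {0..1}"
proof -
  have e: "dyadic K (Suc (dyadic_index K u)) = dyadic_floor K u + h"
    by (simp add: dyadic_Suc dyadic_floor_def h_def)
  have "u \<le> dyadic K (Suc (dyadic_index K u))"
    unfolding e using dyadic_floor_bounds(2)[of u K] assms by (simp add: h_def)
  then show "u \<le> dyadic K (min (Suc (dyadic_index K u)) (2 ^ K))"
    using assms by (auto simp: min_def)
  show "dyadic K (min (Suc (dyadic_index K u)) (2 ^ K)) \<le> dyadic_floor K u + h"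
    unfolding e[symmetric] by (intro dyadic_mono) auto
  show "dyadic K (min (Suc (dyadic_index K u)) (2 ^ K)) \<in> {0..1}"
    by (intro dyadic_mem) auto
qed

text \<open>Monotonicity brackets \<open>t\<close> between the corners \<open>s\<close> and
  \<open>p\<close> of its cell. As \<open>C\<close> grows by at most 2 h from \<open>s\<close> to
  \<open>p\<close>, the unweighted process at \<open>t\<close> is determined by its corner values up
  to 2 N h.\<close>

lemma corners:
  assumes t: "t \<in> unit_square" and a: "h \<le> min_coord t" "min_coord t \<le> 1 - h"
  defines "s \<equiv> square_floor K t" and "p \<equiv> upper_corner t"
  shows "s \<in> unit_square" "p \<in> unit_square"
    "h \<le> min_coord s" "min_coord s \<le> min_coord t" "min_coord t \<le> min_coord s + h"
    "min_coord t \<le> min_coord p" "min_coord p \<le> min_coord t + h"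
    "\<bar>N * (D t - C t)\<bar> \<le> \<bar>N * (D s - C s)\<bar> + \<bar>N * (D p - C p)\<bar> + 2 * (N * h)"
    "\<bar>N * (D t - C t) - N * (D s - C s)\<bar> \<le> \<bar>N * (D p - C p) - N * (D s - C s)\<bar> + 2 * (N * h)"
    "\<bar>X p - X s\<bar> \<le> 2 * (A * \<rho> ^ K)"
proof -
  obtain u v where uv: "t = (u, v)" "u \<in> {0..1}" "v \<in> {0..1}" using t by (cases t) auto
  have sq: "s = (dyadic_floor K u, dyadic_floor K v)" by (simp add: s_def square_floor_def uv)
  have pq: "p = (dyadic K (min (Suc (dyadic_index K u)) (2 ^ K)), dyadic K (min (Suc (dyadic_index K v)) (2 ^ K)))"
    by (simp add: p_def upper_corner_def uv)
  show s: "s \<in> unit_square" unfolding s_def by (rule square_floor_mem[OF t])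
  show p: "p \<in> unit_square" unfolding pq using upper_coord uv by auto
  note fb = dyadic_floor_bounds[of u K] dyadic_floor_bounds[of v K]
  have st: "fst s \<le> fst t" "snd s \<le> snd t" using fb uv by (auto simp: sq)
  have tp: "fst t \<le> fst p" "snd t \<le> snd p" using upper_coord uv by (auto simp: pq)
  have ps: "fst p \<le> fst s + h" "snd p \<le> snd s + h" using upper_coord uv by (auto simp: sq pq)
  show "min_coord s \<le> min_coord t" "min_coord t \<le> min_coord p" "min_coord p \<le> min_coord t + h"
      "min_coord t \<le> min_coord s + h"
    using st tp ps unfolding min_coord_def by linarith+
  \<comment> \<open>\<open>h\<close> is itself a grid value, so rounding down from above
    \<open>h\<close> cannot fall below it.\<close>
  have "h = dyadic_floor K h" using dyadic_floor_dyadic[of K 1] by (simp add: h_def dyadic_def)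
  also have "\<dots> \<le> min_coord s" unfolding s_def min_coord_square_floor by (rule dyadic_floor_mono[OF a(1)])
  finally show "h \<le> min_coord s" .
  have Cst: "C s \<le> C t" "C t \<le> C p" "C p \<le> C s + 2 * h"
    using C_mono[OF s t st] C_mono[OF t p tp] C_mono[OF s p] st tp ps by auto
  have Dst: "D s \<le> D t" "D t \<le> D p" using D_mono[OF s t st] D_mono[OF t p tp] by auto
  have NC: "N * C s \<le> N * C t" "N * C t \<le> N * C p" "N * C p \<le> N * C s + 2 * (N * h)"
    "N * D s \<le> N * D t" "N * D t \<le> N * D p"
    using mult_left_mono[OF Cst(1) N] mult_left_mono[OF Cst(2) N] mult_left_mono[OF Cst(3) N]
      mult_left_mono[OF Dst(1) N] mult_left_mono[OF Dst(2) N] by (auto simp: algebra_simps)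
  then show "\<bar>N * (D t - C t)\<bar> \<le> \<bar>N * (D s - C s)\<bar> + \<bar>N * (D p - C p)\<bar> + 2 * (N * h)"
    "\<bar>N * (D t - C t) - N * (D s - C s)\<bar> \<le> \<bar>N * (D p - C p) - N * (D s - C s)\<bar> + 2 * (N * h)"
    unfolding right_diff_distrib by linarith+
  show "\<bar>X p - X s\<bar> \<le> 2 * (A * \<rho> ^ K)"
    unfolding sq pq dyadic_floor_def using A \<rho> uv dyadic_index_le[of u K] dyadic_index_le[of v K]
    by (intro level_osc_near[OF osc]) (auto simp: min_def)
qed

text \<open>This serves points outside the outermost cells whose corner at the coarse level
  \<open>m\<close> already has a small value. The distances of \<open>t\<close> and of its fine
  corners to the two ends differ by at most a factor 2, so the weights are comparable and
  \<open>X t\<close> inherits the corner bounds.\<close>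

lemma inner_cell_boundary:
  assumes t: "t \<in> unit_square" and a: "h \<le> min_coord t" "min_coord t \<le> 1 - h"
    and m: "m \<le> K" and b: "\<bar>X (square_floor m t)\<bar> \<le> 2 * (A * \<rho> ^ m)"
  shows "\<bar>X t\<bar> \<le> 10 * (B * \<rho> ^ m) + 4 * (N * h powr (1 - \<omega>))"
proof -
  let ?s = "square_floor K t" and ?p = "upper_corner t" and ?a = "min_coord t"
  note c = corners[OF t a]
  have a01: "0 < ?a" "?a < 1" using a h by auto
  have s01: "0 < min_coord ?s" "min_coord ?s < 1" using c h a by auto
  have AB: "2 * (A * \<rho> ^ m) \<le> B * \<rho> ^ m" using mult_right_mono[OF A_le_B, of "\<rho> ^ m"] \<rho> by simp
  have AK: "A * \<rho> ^ K \<le> A * \<rho> ^ m" using A \<rho> m by (intro mult_left_mono power_decreasing) auto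
  have Xs: "\<bar>X ?s\<bar> \<le> 2 * (B * \<rho> ^ m)" using chain[OF t m] b AB by simp
  have Xp: "\<bar>X ?p\<bar> \<le> 3 * (B * \<rho> ^ m)" using Xs c(10) AK AB by linarith
  have q: "N * (D z - C z) = X z * q_weight \<omega> (min_coord z)" if "0 < min_coord z" "min_coord z < 1" for z
  proof -
    have "q_weight \<omega> (min_coord z) \<noteq> 0" using that by (simp add: q_weight_def)
    then show ?thesis using that by (simp add: X_def inv_weight_def)
  qed
  have e1: "\<bar>N * (D ?s - C ?s)\<bar> * inv_weight \<omega> ?a \<le> 2 * \<bar>X ?s\<bar>"
  proof -
    have "q_weight \<omega> (min_coord ?s) * inv_weight \<omega> ?a \<le> 2"
      using c a h s01 a01 by (intro q_weight_ratio \<omega>) auto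
    then have "\<bar>X ?s\<bar> * (q_weight \<omega> (min_coord ?s) * inv_weight \<omega> ?a) \<le> \<bar>X ?s\<bar> * 2"
      by (intro mult_left_mono) auto
    then show ?thesis by (simp add: q[OF s01] abs_mult q_weight_def mult_ac)
  qed
  have e2: "\<bar>N * (D ?p - C ?p)\<bar> * inv_weight \<omega> ?a \<le> 2 * \<bar>X ?p\<bar>"
  \<comment> \<open>At (1, 1) the value of \<open>X\<close> is 0 by convention and says nothing
    about D - C; but there both functions equal 1.\<close>
  proof (cases "min_coord ?p = 1")
    case True
    have "?p = (1, 1)" using min_coord_eq_1[OF c(2) True] .
    moreover have "C (1, 1) = 1" using C_high[of "(1,1)"] by (simp add: min_coord_def)
    ultimately show ?thesis using D_top by simp
  next
    case False
    have p01: "0 < min_coord ?p" "min_coord ?p < 1" using False min_coord_mem[OF c(2)] c(6) a01 by auto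
    have "q_weight \<omega> (min_coord ?p) * inv_weight \<omega> ?a \<le> 2"
      using c a h p01 a01 by (intro q_weight_ratio \<omega>) auto
    then have "\<bar>X ?p\<bar> * (q_weight \<omega> (min_coord ?p) * inv_weight \<omega> ?a) \<le> \<bar>X ?p\<bar> * 2"
      by (intro mult_left_mono) auto
    then show ?thesis by (simp add: q[OF p01] abs_mult q_weight_def mult_ac)
  qed
  have e3: "2 * (N * h) * inv_weight \<omega> ?a \<le> 4 * (N * h powr (1 - \<omega>))"
  proof -
    have "2 * (N * h) * inv_weight \<omega> ?a \<le> 2 * (N * h) * (2 * h powr (-\<omega>))"
      using N h a by (intro mult_left_mono inv_weight_upper \<omega>) auto
    also have "\<dots> = 4 * (N * (h * h powr (-\<omega>)))" by simp
    also have "h * h powr (-\<omega>) = h powr (1 - \<omega>)" using powr_mult_base[of h "-\<omega>"] h by simp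
    finally show ?thesis .
  qed
  have "\<bar>X t\<bar> = \<bar>N * (D t - C t)\<bar> * inv_weight \<omega> ?a" by (simp add: X_def abs_mult)
  also have "\<dots> \<le> (\<bar>N * (D ?s - C ?s)\<bar> + \<bar>N * (D ?p - C ?p)\<bar> + 2 * (N * h)) * inv_weight \<omega> ?a"
    by (intro mult_right_mono c(8)) auto
  also have "\<dots> \<le> 2 * \<bar>X ?s\<bar> + 2 * \<bar>X ?p\<bar> + 4 * (N * h powr (1 - \<omega>))"
    using e1 e2 e3 by (simp only: distrib_right) 
  \<comment> \<open>Here 10 arises as twice 2 from the lower corner plus twice 3 from the upper
    one.\<close>
  also have "\<dots> \<le> 10 * (B * \<rho> ^ m) + 4 * (N * h powr (1 - \<omega>))" using Xs Xp by linarith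
  finally show ?thesis .
qed

text \<open>At distance 2^(-m) from both ends the weight and its reciprocal are Lipschitz with
  constants depending on \<open>m\<close> alone. Every term of the bound contains \<rho>^K, h or N
  h, so for fixed \<open>m\<close> it becomes negligible when the mesh is about 1/n and N = sqrt
  n.\<close>

lemma inner_cell:
  fixes c :: real
  assumes t: "t \<in> unit_square" and m: "m < K"
    and a: "1 / 2 ^ m \<le> min_coord t" "min_coord t \<le> 1 - 1 / 2 ^ m"
  defines "c \<equiv> 2 ^ Suc m"
  shows "\<bar>X t - X (square_floor K t)\<bar> \<le>
    (2 * (A * \<rho> ^ K) + B * (2 * h * c) + 2 * (N * h)) * (2 * c) + B * (4 * (h * c ^ 3))"
proof -
  let ?s = "square_floor K t" and ?p = "upper_corner t" and ?a = "min_coord t"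
  \<comment> \<open>Half of 2^(-m): the corners of the fine cell are within \<open>h\<close> of
    \<open>t\<close>, and \<open>h\<close> is at most \<open>d\<close>, so they stay between
    \<open>d\<close> and \<open>1 - d\<close>.\<close>
  define d where "d = 1 / c"
  have c0: "2 \<le> c" unfolding c_def by simp
  have d: "0 < d" "d \<le> 1/2" using c0 by (auto simp: d_def field_simps)
  have dm: "2 * d = 1 / 2 ^ m" by (simp add: d_def c_def)
  have "h \<le> d"
  proof -
    have "(2::real) ^ Suc m \<le> 2 ^ K" using m by (intro power_increasing) auto
    then show ?thesis by (simp add: h_def d_def c_def field_simps)
  qed
  then have ah: "h \<le> ?a" "?a \<le> 1 - h" using a d dm by linarith+
  note k = corners[OF t ah]
  have da: "d \<le> ?a" "?a \<le> 1 - d" "d \<le> min_coord ?s" "min_coord ?s \<le> 1 - d"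
     "d \<le> min_coord ?p" "min_coord ?p \<le> 1 - d"
    using k a dm \<open>h \<le> d\<close> d by linarith+
  have q: "N * (D z - C z) = X z * q_weight \<omega> (min_coord z)" "\<bar>N * (D z - C z)\<bar> \<le> \<bar>X z\<bar>"
    if "d \<le> min_coord z" "min_coord z \<le> 1 - d" for z
  proof -
    have z: "0 < min_coord z" "min_coord z < 1" using that d by auto
    have "q_weight \<omega> (min_coord z) \<noteq> 0" using z by (simp add: q_weight_def)
    then show *: "N * (D z - C z) = X z * q_weight \<omega> (min_coord z)" using z by (simp add: X_def inv_weight_def)
    have "\<bar>X z\<bar> * q_weight \<omega> (min_coord z) \<le> \<bar>X z\<bar> * 1"
      using z by (intro mult_left_mono q_weight_le_1 \<omega>) auto
    then show "\<bar>N * (D z - C z)\<bar> \<le> \<bar>X z\<bar>" unfolding * by (simp add: abs_mult q_weight_def)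
  qed
  have Xs: "\<bar>X ?s\<bar> \<le> B" by (rule X_grid_bound[OF t])
  have dc: "d powr (-\<omega>) \<le> c"
  proof -
    have "d powr (-\<omega>) \<le> d powr (-1)" using d \<omega> by (intro powr_mono') auto
    then show ?thesis using d by (simp add: powr_minus d_def)
  qed
  have r: "inv_weight \<omega> x \<le> 2 * c" if "d \<le> x" "x \<le> 1 - d" for x
    using inv_weight_upper[OF \<omega> d that] dc by linarith
  have sp: "\<bar>min_coord ?p - min_coord ?s\<bar> \<le> 2 * h" "\<bar>?a - min_coord ?s\<bar> \<le> h" using k(3-7) by linarith+
  have e1: "\<bar>N * (D ?p - C ?p) - N * (D ?s - C ?s)\<bar> \<le> 2 * (A * \<rho> ^ K) + B * (2 * h * c)"
  proof -
    have "N * (D ?p - C ?p) - N * (D ?s - C ?s)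
        = (X ?p - X ?s) * q_weight \<omega> (min_coord ?p) + X ?s * (q_weight \<omega> (min_coord ?p) - q_weight \<omega> (min_coord ?s))"
      using q(1)[OF da(3,4)] q(1)[OF da(5,6)] by (simp add: algebra_simps)
    also have "\<bar>\<dots>\<bar> \<le> \<bar>X ?p - X ?s\<bar> * q_weight \<omega> (min_coord ?p) + \<bar>X ?s\<bar> * \<bar>q_weight \<omega> (min_coord ?p) - q_weight \<omega> (min_coord ?s)\<bar>"
      by (rule order_trans[OF abs_triangle_ineq]) (simp add: abs_mult q_weight_def)
    also have "\<dots> \<le> (2 * (A * \<rho> ^ K)) * 1 + B * (2 * h / d)"
    proof (intro add_mono mult_mono k(10) Xs q_weight_le_1 \<omega>)
      have "\<bar>q_weight \<omega> (min_coord ?p) - q_weight \<omega> (min_coord ?s)\<bar> \<le> \<bar>min_coord ?p - min_coord ?s\<bar> / d"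
        by (intro q_weight_lipschitz \<omega> d da)
      also have "\<dots> \<le> 2 * h / d" using sp d by (intro divide_right_mono) auto
      finally show "\<bar>q_weight \<omega> (min_coord ?p) - q_weight \<omega> (min_coord ?s)\<bar> \<le> 2 * h / d" .
    qed (use da d B0 A \<rho> in \<open>auto simp: q_weight_def\<close>)
    finally show ?thesis by (simp add: d_def)
  qed
  have "\<bar>inv_weight \<omega> ?a - inv_weight \<omega> (min_coord ?s)\<bar>
      = inv_weight \<omega> ?a * inv_weight \<omega> (min_coord ?s) * \<bar>q_weight \<omega> ?a - q_weight \<omega> (min_coord ?s)\<bar>"
  proof -
    have "0 < q_weight \<omega> ?a" "0 < q_weight \<omega> (min_coord ?s)" using da d by (auto simp: q_weight_def)
    moreover have "0 < ?a" "?a < 1" "0 < min_coord ?s" "min_coord ?s < 1" using da d by auto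
    ultimately show ?thesis
      by (simp add: inv_weight_def divide_simps abs_minus_commute)
  qed
  also have "\<dots> \<le> (2 * c) * (2 * c) * (h / d)"
  proof (intro mult_mono r da)
    have "\<bar>q_weight \<omega> ?a - q_weight \<omega> (min_coord ?s)\<bar> \<le> \<bar>?a - min_coord ?s\<bar> / d"
      by (intro q_weight_lipschitz \<omega> d da)
    also have "\<dots> \<le> h / d" using sp d by (intro divide_right_mono) auto
    finally show "\<bar>q_weight \<omega> ?a - q_weight \<omega> (min_coord ?s)\<bar> \<le> h / d" .
  qed (use c0 in auto)
  also have "\<dots> = 4 * (h * c ^ 3)" by (simp add: d_def power3_eq_cube)
  finally have e2: "\<bar>inv_weight \<omega> ?a - inv_weight \<omega> (min_coord ?s)\<bar> \<le> 4 * (h * c ^ 3)" .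
  have "X t - X ?s = (N * (D t - C t) - N * (D ?s - C ?s)) * inv_weight \<omega> ?a
      + N * (D ?s - C ?s) * (inv_weight \<omega> ?a - inv_weight \<omega> (min_coord ?s))"
    by (simp add: X_def algebra_simps)
  also have "\<bar>\<dots>\<bar> \<le> \<bar>N * (D t - C t) - N * (D ?s - C ?s)\<bar> * inv_weight \<omega> ?a
      + \<bar>N * (D ?s - C ?s)\<bar> * \<bar>inv_weight \<omega> ?a - inv_weight \<omega> (min_coord ?s)\<bar>"
    by (rule order_trans[OF abs_triangle_ineq]) (simp add: abs_mult)
  also have "\<dots> \<le> (2 * (A * \<rho> ^ K) + B * (2 * h * c) + 2 * (N * h)) * (2 * c) + B * (4 * (h * c ^ 3))"
    using k(9) e1 q(2)[OF da(3,4)] Xs c0 A \<rho> N h B0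
    by (intro add_mono mult_mono r da e2) auto
  finally show ?thesis .
qed

text \<open>Away from the boundary, \<open>t\<close> is compared with its fine corner and that with
  the coarse one. In a boundary strip of width 2^(-m) the values at \<open>t\<close> and at the
  coarse corner are each small by themselves.\<close>

theorem square_floor_approx:
  fixes c :: real
  assumes t: "t \<in> unit_square" and m: "m < K"
  defines "c \<equiv> 2 ^ Suc m"
  shows "\<bar>X t - X (square_floor m t)\<bar> \<le> 12 * (B * \<rho> ^ m) + S + 4 * (N * h powr (1 - \<omega>)) +
    ((2 * (A * \<rho> ^ K) + B * (2 * h * c) + 2 * (N * h)) * (2 * c) + B * (4 * (h * c ^ 3)))"
    (is "_ \<le> _ + _ + _ + ?I")
proof -
  let ?a = "min_coord t"
  have Bm: "0 \<le> B * \<rho> ^ m" by (rule mult_nonneg_nonneg[OF B0]) (use \<rho> in simp)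
  have Nh: "0 \<le> N * h powr (1 - \<omega>)" using N by simp
  have I0: "0 \<le> ?I" using B0 A \<rho> N h by (auto simp: c_def intro!: add_nonneg_nonneg mult_nonneg_nonneg)
  have AB: "2 * (A * \<rho> ^ m) \<le> B * \<rho> ^ m" using mult_right_mono[OF A_le_B, of "\<rho> ^ m"] \<rho> by simp
  have hm: "h \<le> 1 / 2 ^ m"
    using m power_increasing[of m K "2::real"] by (simp add: h_def field_simps)
  consider "1 / 2 ^ m \<le> ?a" "?a \<le> 1 - 1 / 2 ^ m" | "?a < 1 / 2 ^ m" | "1 - 1 / 2 ^ m < ?a" by linarith
  then show ?thesis
  proof cases
    case 1
    have "\<bar>X t - X (square_floor K t)\<bar> \<le> ?I"
      unfolding c_def by (rule inner_cell[OF t m 1])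
    moreover have "\<bar>X (square_floor K t) - X (square_floor m t)\<bar> \<le> B * \<rho> ^ m"
      using m by (intro chain[OF t]) auto
    ultimately show ?thesis using Bm Nh S0 by linarith
  next
    case 2
    \<comment> \<open>The coarse corner lies on the left or lower edge, where \<open>X\<close>
      vanishes.\<close>
    have "dyadic_index m ?a = 0"
      using 2 min_coord_mem[OF t] by (simp add: dyadic_index_def floor_eq_iff field_simps)
    then have z: "X (square_floor m t) = 0"
      by (intro X_0) (simp add: min_coord_square_floor dyadic_floor_def)
    have "\<bar>X t\<bar> \<le> 10 * (B * \<rho> ^ m) + S + 4 * (N * h powr (1 - \<omega>))"
    proof -
      consider "?a < h" | "1 - h < ?a" | "h \<le> ?a" "?a \<le> 1 - h" by linarith
      then show ?thesis
      proof cases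
        case 1 then show ?thesis using outer_cell_low[OF t] Bm Nh by fastforce
      next
        case 2 then show ?thesis using outer_cell_high[OF t] Bm Nh by fastforce
      next
        case 3 then show ?thesis using inner_cell_boundary[OF t 3, of m] z m A \<rho> S0 by simp
      qed
    qed
    then show ?thesis using z I0 Bm by simp
  next
    case 3
    \<comment> \<open>Both coordinates of \<open>t\<close> are within 2^(-m) of 1, so its coarse
      corner can be compared with (1, 1).\<close>
    have "\<bar>X (square_floor m t) - X (square_floor m (1, 1))\<bar> \<le> 2 * (A * \<rho> ^ m)"
      using t m 3 A \<rho> by (intro level_osc_square_floor[OF osc]) (auto simp: min_coord_def)
    moreover have "X (square_floor m (1, 1)) = 0"
      by (intro X_0) (simp add: square_floor_def min_coord_def)
    ultimately have z: "\<bar>X (square_floor m t)\<bar> \<le> 2 * (A * \<rho> ^ m)" by simp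
    have "\<bar>X t\<bar> \<le> 10 * (B * \<rho> ^ m) + S + 4 * (N * h powr (1 - \<omega>))"
    proof -
      consider "?a < h" | "1 - h < ?a" | "h \<le> ?a" "?a \<le> 1 - h" by linarith
      then show ?thesis
      proof cases
        case 1 then show ?thesis using outer_cell_low[OF t] Bm Nh by fastforce
      next
        case 2 then show ?thesis using outer_cell_high[OF t] Bm Nh by fastforce
      next
        case 3 then show ?thesis using inner_cell_boundary[OF t 3, of m] z m A \<rho> S0 by simp
      qed
    qed
    then show ?thesis using z AB I0 Bm by linarith
  qed
qed

end

section \<open>Chaining probability bounds\<close>


text \<open>Edges are listed in both directions, because an exponential moment controls only the
  upper tail of an increment.\<close>

definition grid_adjacent :: "nat \<Rightarrow> real \<times> real \<Rightarrow> real \<times> real \<Rightarrow> bool" where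
  "grid_adjacent k s t \<longleftrightarrow> (\<exists>i<2^k. \<exists>j\<le>2^k.
     (s, t) \<in> {((dyadic k (Suc i), dyadic k j), (dyadic k i, dyadic k j)),
               ((dyadic k i, dyadic k j), (dyadic k (Suc i), dyadic k j)),
               ((dyadic k j, dyadic k (Suc i)), (dyadic k j, dyadic k i)),
               ((dyadic k j, dyadic k i), (dyadic k j, dyadic k (Suc i)))})"

lemma grid_adjacent_sym: "grid_adjacent k s t \<Longrightarrow> grid_adjacent k t s"
  unfolding grid_adjacent_def by blast

text \<open>This is z/r \<le> e^(z/r), raised to the power \<open>r\<close> and inverted.\<close>

lemma exp_minus_le_power:
  fixes z :: real
  assumes "0 < z" "1 \<le> r"
  shows "exp (- z) \<le> (real r / z) ^ r"
proof -
  have "z / r \<le> exp (z / r)" using exp_ge_add_one_self[of "z / r"] by linarith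
  then have "(z / r) ^ r \<le> exp (z / r) ^ r" using assms by (intro power_mono) auto
  also have "\<dots> = exp z" using assms by (simp flip: exp_of_nat_mult)
  finally have "inverse (exp z) \<le> inverse ((z / r) ^ r)"
    using assms by (intro le_imp_inverse_le) auto
  then show ?thesis by (simp add: exp_minus power_divide)
qed

context prob_space
begin

text \<open>Chernoff's bound. The nonnegative integral makes finiteness of the moment part of the
  hypothesis.\<close>

lemma exp_moment_tail:
  fixes Y :: "'a \<Rightarrow> real"
  assumes Y[measurable]: "Y \<in> borel_measurable M" and \<theta>: "0 < \<theta>" and D: "0 \<le> D"
    and mgf: "(\<integral>\<^sup>+y. ennreal (exp (\<theta> * Y y)) \<partial>M) \<le> ennreal D"
  shows "prob {y\<in>space M. a < Y y} \<le> D * exp (- (\<theta> * a))"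
proof -
  have "emeasure M {y\<in>space M. a < Y y} = (\<integral>\<^sup>+y. indicator {y\<in>space M. a < Y y} y \<partial>M)"
    by (subst nn_integral_indicator) auto
  also have "\<dots> \<le> (\<integral>\<^sup>+y. ennreal (exp (- (\<theta> * a))) * ennreal (exp (\<theta> * Y y)) \<partial>M)"
  proof (rule nn_integral_mono)
    fix y
    have "1 \<le> exp (- (\<theta> * a)) * exp (\<theta> * Y y)" if "a < Y y"
    proof -
      have "\<theta> * a \<le> \<theta> * Y y" using that \<theta> by simp
      then show ?thesis by (simp flip: exp_add)
    qed
    then show "indicator {y\<in>space M. a < Y y} y \<le> ennreal (exp (- (\<theta> * a))) * ennreal (exp (\<theta> * Y y))"
      by (auto simp: indicator_def simp flip: ennreal_mult ennreal_1)
  qed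
  also have "\<dots> = ennreal (exp (- (\<theta> * a))) * (\<integral>\<^sup>+y. ennreal (exp (\<theta> * Y y)) \<partial>M)"
    by (rule nn_integral_cmult) auto
  also have "\<dots> \<le> ennreal (exp (- (\<theta> * a))) * ennreal D"
    by (intro mult_left_mono mgf) auto
  also have "\<dots> = ennreal (D * exp (- (\<theta> * a)))"
    using D by (simp add: ennreal_mult mult.commute)
  finally show ?thesis using D by (simp add: emeasure_eq_measure)
qed

lemma level_osc_measurable:
  fixes x :: "'a \<Rightarrow> real \<times> real \<Rightarrow> real"
  assumes [measurable]: "\<And>i j. (\<lambda>y. x y (dyadic k i, dyadic k j)) \<in> borel_measurable M"
  shows "{y\<in>space M. \<not> level_osc (x y) a k} \<in> sets M"
  unfolding level_osc_def by measurable

text \<open>A union bound over 2^k (2^k + 1) pairs of indices with four directed edges each, hence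
  at most 8 times 4^k events.\<close>

lemma level_osc_prob:
  fixes x :: "'a \<Rightarrow> real \<times> real \<Rightarrow> real"
  assumes x: "\<And>i j. (\<lambda>y. x y (dyadic k i, dyadic k j)) \<in> borel_measurable M"
    and \<theta>: "0 < \<theta>" and D: "0 \<le> D"
    and mgf: "\<And>s t. grid_adjacent k s t \<Longrightarrow> (\<integral>\<^sup>+y. ennreal (exp (\<theta> * (x y s - x y t))) \<partial>M) \<le> ennreal D"
  shows "prob {y\<in>space M. \<not> level_osc (x y) a k} \<le> 8 * 4 ^ k * (D * exp (- (\<theta> * a)))"
proof -
  let ?E = "\<lambda>s t. {y\<in>space M. a < x y s - x y t}"
  define F where "F = (\<lambda>(i, j). (?E (dyadic k (Suc i), dyadic k j) (dyadic k i, dyadic k j) \<union>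
      ?E (dyadic k i, dyadic k j) (dyadic k (Suc i), dyadic k j)) \<union>
      (?E (dyadic k j, dyadic k (Suc i)) (dyadic k j, dyadic k i) \<union>
      ?E (dyadic k j, dyadic k i) (dyadic k j, dyadic k (Suc i))))"
  define I where "I = {..<(2::nat)^k} \<times> {..(2::nat)^k}"
  let ?b = "D * exp (- (\<theta> * a))"
  have E: "?E s t \<in> sets M" "prob (?E s t) \<le> ?b" if "grid_adjacent k s t" for s t
  proof -
    have "(\<lambda>y. x y s - x y t) \<in> borel_measurable M"
      using that x unfolding grid_adjacent_def by (auto intro!: borel_measurable_diff)
    then show "?E s t \<in> sets M" "prob (?E s t) \<le> ?b"
      using exp_moment_tail[OF _ \<theta> D mgf[OF that], of a] by auto
  qed
  have F: "F p \<in> sets M \<and> prob (F p) \<le> 4 * ?b" if "p \<in> I" for p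
  proof -
    obtain i j where p: "p = (i, j)" "i < 2^k" "j \<le> 2^k" using \<open>p \<in> I\<close> by (auto simp: I_def)
    let ?A1 = "?E (dyadic k (Suc i), dyadic k j) (dyadic k i, dyadic k j)"
    let ?A2 = "?E (dyadic k i, dyadic k j) (dyadic k (Suc i), dyadic k j)"
    let ?A3 = "?E (dyadic k j, dyadic k (Suc i)) (dyadic k j, dyadic k i)"
    let ?A4 = "?E (dyadic k j, dyadic k i) (dyadic k j, dyadic k (Suc i))"
    have adj: "grid_adjacent k (dyadic k (Suc i), dyadic k j) (dyadic k i, dyadic k j)"
      "grid_adjacent k (dyadic k i, dyadic k j) (dyadic k (Suc i), dyadic k j)"
      "grid_adjacent k (dyadic k j, dyadic k (Suc i)) (dyadic k j, dyadic k i)"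
      "grid_adjacent k (dyadic k j, dyadic k i) (dyadic k j, dyadic k (Suc i))"
      unfolding grid_adjacent_def using p by blast+
    note s = E(1)[OF adj(1)] E(1)[OF adj(2)] E(1)[OF adj(3)] E(1)[OF adj(4)]
    have "prob (F p) \<le> prob (?A1 \<union> ?A2) + prob (?A3 \<union> ?A4)"
      unfolding F_def p prod.case by (intro measure_Un_le sets.Un s)
    also have "\<dots> \<le> (prob ?A1 + prob ?A2) + (prob ?A3 + prob ?A4)"
      by (intro add_mono measure_Un_le s)
    also have "\<dots> \<le> 4 * ?b" using E(2)[OF adj(1)] E(2)[OF adj(2)] E(2)[OF adj(3)] E(2)[OF adj(4)] by linarith
    finally show ?thesis using s by (auto simp: F_def p)
  qed
  have "{y\<in>space M. \<not> level_osc (x y) a k} \<subseteq> (\<Union>p\<in>I. F p)"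
    by (fastforce simp: level_osc_def F_def I_def not_le abs_le_iff)
  then have "prob {y\<in>space M. \<not> level_osc (x y) a k} \<le> prob (\<Union>p\<in>I. F p)"
    using F by (intro finite_measure_mono) (auto simp: I_def)
  also have "\<dots> \<le> (\<Sum>p\<in>I. prob (F p))"
    using F by (intro finite_measure_subadditive_finite) (auto simp: I_def)
  also have "\<dots> \<le> (\<Sum>p\<in>I. 4 * ?b)" using F by (intro sum_mono) auto
  also have "\<dots> = real (card I) * (4 * ?b)" by simp
  also have "real (card I) = 2 ^ k * (2 ^ k + 1)" by (simp add: I_def algebra_simps)
  also have "\<dots> \<le> (2::real) ^ k * (2 * 2 ^ k)" by (intro mult_left_mono) auto
  also have "\<dots> = 2 * 4 ^ k" by (simp flip: power_mult_distrib)
  finally show ?thesis using D by (simp add: mult_right_mono)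
qed

text \<open>Crudely replacing the exponential tails by a high enough power makes the sum over all
  levels geometric.\<close>
theorem chaining_prob:
  fixes x :: "'a \<Rightarrow> real \<times> real \<Rightarrow> real"
  assumes x: "\<And>k i j. (\<lambda>y. x y (dyadic k i, dyadic k j)) \<in> borel_measurable M"
    and c: "0 < c" and D: "0 \<le> D" and A: "0 < A" and \<rho>: "0 < \<rho>" and r: "1 \<le> r" "\<rho> ^ r \<le> 1/8"
    and mgf: "\<And>k s t. k \<le> K \<Longrightarrow> grid_adjacent k s t \<Longrightarrow>
      (\<integral>\<^sup>+y. ennreal (exp (c / \<rho> ^ (2 * k) * (x y s - x y t))) \<partial>M) \<le> ennreal D"
  shows "prob {y\<in>space M. \<exists>k\<le>K. \<not> level_osc (x y) (A * \<rho> ^ k) k} \<le> 16 * D * (real r / (c * A)) ^ r"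
proof -
  let ?L = "\<lambda>k. {y\<in>space M. \<not> level_osc (x y) (A * \<rho> ^ k) k}"
  have L: "prob (?L k) \<le> 8 * D * (real r / (c * A)) ^ r * (1/2) ^ k" if k: "k \<le> K" for k
  proof -
    have "prob (?L k) \<le> 8 * 4 ^ k * (D * exp (- (c / \<rho> ^ (2 * k) * (A * \<rho> ^ k))))"
      using c \<rho> by (intro level_osc_prob x D mgf k) auto
    \<comment> \<open>The exponential scale is the square of \<rho>^k, the relative size of the
      oscillation, so the exponent grows like \<rho>^(-k).\<close>
    also have "c / \<rho> ^ (2 * k) * (A * \<rho> ^ k) = c * A / \<rho> ^ k"
      using \<rho> by (simp add: power_mult power2_eq_square mult_2 power_add)
    also have "exp (- (c * A / \<rho> ^ k)) \<le> (real r / (c * A / \<rho> ^ k)) ^ r"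
      using c A \<rho> r by (intro exp_minus_le_power) auto
    also have "\<dots> = (real r / (c * A)) ^ r * (\<rho> ^ r) ^ k"
      by (simp add: power_divide power_mult_distrib mult.commute flip: power_mult)
    \<comment> \<open>Against 4^k events, the factor 1/8 per level leaves a factor 1/2 per
      level.\<close>
    also have "\<dots> \<le> (real r / (c * A)) ^ r * (1/8) ^ k"
      using \<rho> r c A by (intro mult_left_mono power_mono) auto
    finally have "prob (?L k) \<le> 8 * 4 ^ k * (D * ((real r / (c * A)) ^ r * (1/8) ^ k))"
      using D by (simp add: mult_left_mono)
    also have "\<dots> = 8 * D * (real r / (c * A)) ^ r * (4 * (1/8)) ^ k"
      unfolding power_mult_distrib by (simp add: mult_ac)
    finally show ?thesis by simp
  qed
  have "{y\<in>space M. \<exists>k\<le>K. \<not> level_osc (x y) (A * \<rho> ^ k) k} = (\<Union>k\<in>{..K}. ?L k)" by auto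
  then have "prob {y\<in>space M. \<exists>k\<le>K. \<not> level_osc (x y) (A * \<rho> ^ k) k} \<le> (\<Sum>k\<le>K. prob (?L k))"
    using level_osc_measurable[of x, OF x] by (auto intro!: finite_measure_subadditive_finite)
  also have "\<dots> \<le> (\<Sum>k\<le>K. 8 * D * (real r / (c * A)) ^ r * (1/2) ^ k)" using L by (intro sum_mono) auto
  also have "\<dots> = 8 * D * (real r / (c * A)) ^ r * (\<Sum>k\<le>K. (1/2) ^ k)" by (simp add: sum_distrib_left)
  also have "\<dots> \<le> 8 * D * (real r / (c * A)) ^ r * 2"
  proof (intro mult_left_mono)
    have "(\<Sum>k\<le>K. (1/2::real) ^ k) = 2 - (1/2) ^ K" by (induction K) (auto simp: field_simps)
    then show "(\<Sum>k\<le>K. (1/2::real) ^ k) \<le> 2" by simp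
  qed (use D A c in auto)
  finally show ?thesis by simp
qed

end

section \<open>Copulas\<close>


definition quadrant :: "real \<times> real \<Rightarrow> (real \<times> real) set" where
  "quadrant t = {..fst t} \<times> {..snd t}"

definition meet :: "real \<times> real \<Rightarrow> real \<times> real \<Rightarrow> real \<times> real" where
  "meet s t = (min (fst s) (fst t), min (snd s) (snd t))"

lemma quadrant_borel [measurable]: "quadrant t \<in> sets borel"
  unfolding quadrant_def by (intro borel_closed closed_Times closed_atMost)

lemma quadrant_mono: "fst s \<le> fst t \<Longrightarrow> snd s \<le> snd t \<Longrightarrow> quadrant s \<subseteq> quadrant t"
  by (auto simp: quadrant_def)

lemma quadrant_meet: "quadrant (meet s t) = quadrant s \<inter> quadrant t"
  by (auto simp: quadrant_def meet_def)

lemma meet_mem: "s \<in> unit_square \<Longrightarrow> t \<in> unit_square \<Longrightarrow> meet s t \<in> unit_square"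
  by (cases s, cases t) (auto simp: meet_def min_def)

lemma quadrant_pair: "quadrant t = {..t}"
  by (cases t) (auto simp: quadrant_def less_eq_prod_def)

text \<open>Quadrants form an intersection-stable generator of the Borel sets, and countably many of
  them exhaust the plane.\<close>

lemma measure_eqI_quadrants:
  fixes P Q :: "(real \<times> real) measure"
  assumes "prob_space P" "sets P = sets borel" "prob_space Q" "sets Q = sets borel"
    and eq: "\<And>t. measure P (quadrant t) = measure Q (quadrant t)"
  shows "P = Q"
proof -
  interpret P: prob_space P by fact
  interpret Q: prob_space Q by fact
  let ?E = "range quadrant"
  have b: "sets (borel :: (real \<times> real) measure) = sigma_sets UNIV ?E"
    by (subst borel_eq_atMost) (simp add: quadrant_pair)
  have cov: "(\<Union>i::nat. quadrant (real i, real i)) = UNIV"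
  proof -
    have "\<exists>i::nat. z \<in> quadrant (real i, real i)" for z
    proof -
      obtain i :: nat where "max (fst z) (snd z) < real i" using reals_Archimedean2 by blast
      then show ?thesis by (intro exI[of _ i]) (cases z; simp add: quadrant_def)
    qed
    then show ?thesis by blast
  qed
  show ?thesis
  proof (rule measure_eqI_generator_eq[where E = ?E and \<Omega> = UNIV and A = "\<lambda>i. quadrant (real i, real i)"])
    show "Int_stable ?E"
      by (rule Int_stableI) (auto simp flip: quadrant_meet)
    show "emeasure P X = emeasure Q X" if "X \<in> ?E" for X
      using that eq by (auto simp: P.emeasure_eq_measure Q.emeasure_eq_measure)
  qed (use assms b cov in \<open>auto simp: P.emeasure_eq_measure\<close>)
qed

text \<open>A sample is described only by its distribution function on the unit square. The values
  at (1, 1), (0, 1) and (1, 0) carry over to \<open>Q\<close> and confine both measures to the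
  square, up to null sets; so the mass of any quadrant is 0 or that of a quadrant whose corner is
  clipped to the square.\<close>

lemma measure_eqI_unit_quadrants:
  fixes P Q :: "(real \<times> real) measure"
  assumes P: "prob_space P" "sets P = sets borel" and Q: "prob_space Q" "sets Q = sets borel"
    and eq: "\<And>t. t \<in> unit_square \<Longrightarrow> measure P (quadrant t) = measure Q (quadrant t)"
    and top: "measure P (quadrant (1, 1)) = 1"
    and bot: "measure P (quadrant (0, 1)) = 0" "measure P (quadrant (1, 0)) = 0"
  shows "P = Q"
proof (rule measure_eqI_quadrants[OF P Q])
  have clip: "measure R (quadrant t) =
      (if fst t < 0 \<or> snd t < 0 then 0 else measure R (quadrant (min 1 (fst t), min 1 (snd t))))"
    if R: "prob_space R" "sets R = sets borel" and top: "measure R (quadrant (1, 1)) = 1"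
      and bot: "measure R (quadrant (0, 1)) = 0" "measure R (quadrant (1, 0)) = 0" for R t
  proof -
    interpret R: prob_space R by fact
    have m [measurable]: "quadrant s \<in> sets R" for s using R by simp
    have spR: "space R = UNIV" using sets_eq_imp_space_eq[OF R(2)] by simp
    have cut: "measure R S = measure R (S \<inter> quadrant (1, 1))" if "S \<in> sets R" for S
    proof -
      have "AE z in R. z \<in> quadrant (1, 1)" using top R.prob_eq_1[of "quadrant (1,1)"] by simp
      then show ?thesis using that by (intro R.finite_measure_eq_AE) (auto elim!: eventually_mono)
    qed
    have clipped: "quadrant t \<inter> quadrant (1, 1) = quadrant (min 1 (fst t), min 1 (snd t))"
      by (auto simp: quadrant_def)
    show ?thesis
    proof (cases "fst t < 0 \<or> snd t < 0")
      case True
      then have "quadrant t \<inter> quadrant (1, 1) \<subseteq> quadrant (0, 1) \<union> quadrant (1, 0)"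
        by (auto simp: quadrant_def)
      then have "measure R (quadrant t) \<le> measure R (quadrant (0, 1) \<union> quadrant (1, 0))"
        unfolding cut[OF m, of t] by (intro R.finite_measure_mono) auto
      also have "\<dots> \<le> 0" using measure_Un_le[OF m m, of "(0,1)" "(1,0)"] bot by simp
      finally show ?thesis using True by (simp add: measure_le_0_iff)
    next
      case False
      then show ?thesis using cut[OF m, of t] clipped by simp
    qed
  qed
  fix t
  have Q3: "measure Q (quadrant (1, 1)) = 1" "measure Q (quadrant (0, 1)) = 0" "measure Q (quadrant (1, 0)) = 0"
    using eq[of "(1,1)"] eq[of "(0,1)"] eq[of "(1,0)"] top bot by auto
  show "measure P (quadrant t) = measure Q (quadrant t)"
  proof (cases "fst t < 0 \<or> snd t < 0")
    case True
    then show ?thesis using clip[OF P top bot, of t] clip[OF Q Q3, of t] by simp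
  next
    case False
    then have "(min 1 (fst t), min 1 (snd t)) \<in> unit_square" by auto
    then show ?thesis using eq clip[OF P top bot, of t] clip[OF Q Q3, of t] False by simp
  qed
qed

locale copula_law = prob_space P for P :: "(real \<times> real) measure" +
  fixes \<omega> :: real
  assumes \<omega>: "0 \<le> \<omega>" "\<omega> < 1/2"
    and sets_P [measurable_cong]: "sets P = sets borel"
    and margin1: "distr P borel fst = uniform_measure lborel {0..1}"
    and margin2: "distr P borel snd = uniform_measure lborel {0..1}"
begin

definition cdf2 :: "real \<times> real \<Rightarrow> real" where
  "cdf2 t = prob (quadrant t)"

definition centered_ind :: "real \<times> real \<Rightarrow> real \<times> real \<Rightarrow> real" where
  "centered_ind t z = indicator (quadrant t) z - cdf2 t"

text \<open>The weighted process is n^(-1/2) times the sum of \<open>wfun t\<close> over the sample,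
  that is, the empirical process indexed by these functions; \<open>wcov\<close> is their covariance
  under the copula.\<close>

definition wfun :: "real \<times> real \<Rightarrow> real \<times> real \<Rightarrow> real" where
  "wfun t z = inv_weight \<omega> (min_coord t) * centered_ind t z"

definition wcov :: "real \<times> real \<Rightarrow> real \<times> real \<Rightarrow> real" where
  "wcov s t = inv_weight \<omega> (min_coord s) * inv_weight \<omega> (min_coord t) *
     (cdf2 (meet s t) - cdf2 s * cdf2 t)"

lemma space_P: "space P = UNIV"
  using sets_eq_imp_space_eq[OF sets_P] by simp

lemma fst_measurable [measurable]: "fst \<in> measurable P borel"
  and snd_measurable [measurable]: "snd \<in> measurable P borel"
  unfolding measurable_cong_sets[OF sets_P refl]
  by (auto intro!: borel_measurable_continuous_onI continuous_intros)

lemma prob_fst: "S \<in> sets borel \<Longrightarrow> prob {z. fst z \<in> S} = measure lborel ({0..1} \<inter> S)"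
  and prob_snd: "S \<in> sets borel \<Longrightarrow> prob {z. snd z \<in> S} = measure lborel ({0..1} \<inter> S)"
proof -
  assume S: "S \<in> sets borel"
  have "measure (distr P borel fst) S = prob {z. fst z \<in> S}"
    using S by (subst measure_distr) (auto simp: space_P vimage_def)
  then show "prob {z. fst z \<in> S} = measure lborel ({0..1} \<inter> S)"
    unfolding margin1 using S by simp
  have "measure (distr P borel snd) S = prob {z. snd z \<in> S}"
    using S by (subst measure_distr) (auto simp: space_P vimage_def)
  then show "prob {z. snd z \<in> S} = measure lborel ({0..1} \<inter> S)"
    unfolding margin2 using S by simp
qed

lemma prob_strip:
  assumes "0 \<le> a" "a \<le> b" "b \<le> 1"
  shows "prob {z. a < fst z \<and> fst z \<le> b} = b - a" "prob {z. a < snd z \<and> snd z \<le> b} = b - a"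
proof -
  have "{0..1} \<inter> {a<..b} = {a<..b}" using assms by auto
  then have "measure lborel ({0..1} \<inter> {a<..b}) = b - a" using assms by simp
  then show "prob {z. a < fst z \<and> fst z \<le> b} = b - a" "prob {z. a < snd z \<and> snd z \<le> b} = b - a"
    using prob_fst[of "{a<..b}"] prob_snd[of "{a<..b}"] by auto
qed

lemma prob_lower:
  assumes "0 \<le> b" "b \<le> 1"
  shows "prob {z. fst z \<le> b} = b" "prob {z. snd z \<le> b} = b"
proof -
  have "{0..1} \<inter> {..b} = {0..b}" using assms by auto
  then have "measure lborel ({0..1} \<inter> {..b}) = b" using assms by simp
  then show "prob {z. fst z \<le> b} = b" "prob {z. snd z \<le> b} = b"
    using prob_fst[of "{..b}"] prob_snd[of "{..b}"] by auto
qed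

lemma quadrant_sets [measurable]: "quadrant t \<in> sets P"
  by (simp add: sets_P)

lemma half_planes [measurable]:
  "{z. fst z \<le> b} \<in> sets P" "{z. snd z \<le> b} \<in> sets P"
  "{z. a < fst z \<and> fst z \<le> b} \<in> sets P" "{z. a < snd z \<and> snd z \<le> b} \<in> sets P"
proof -
  have "{z \<in> space P. fst z \<le> b} \<in> sets P" "{z \<in> space P. snd z \<le> b} \<in> sets P"
    "{z \<in> space P. a < fst z \<and> fst z \<le> b} \<in> sets P" "{z \<in> space P. a < snd z \<and> snd z \<le> b} \<in> sets P"
    by measurable
  then show "{z. fst z \<le> b} \<in> sets P" "{z. snd z \<le> b} \<in> sets P"
  "{z. a < fst z \<and> fst z \<le> b} \<in> sets P" "{z. a < snd z \<and> snd z \<le> b} \<in> sets P"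
    by (simp_all add: space_P)
qed

lemma cdf2_mono: "fst s \<le> fst t \<Longrightarrow> snd s \<le> snd t \<Longrightarrow> cdf2 s \<le> cdf2 t"
  unfolding cdf2_def by (intro finite_measure_mono quadrant_mono) auto

text \<open>The difference of the quadrants is covered by a vertical and a horizontal strip, whose
  masses are fixed by the uniform margins.\<close>

lemma cdf2_lipschitz:
  assumes s: "s \<in> unit_square" and t: "t \<in> unit_square" and le: "fst s \<le> fst t" "snd s \<le> snd t"
  shows "cdf2 t \<le> cdf2 s + (fst t - fst s) + (snd t - snd s)"
proof -
  let ?U = "{z. fst s < fst z \<and> fst z \<le> fst t}" and ?V = "{z. snd s < snd z \<and> snd z \<le> snd t}"
  have "quadrant t \<subseteq> quadrant s \<union> (?U \<union> ?V)" by (auto simp: quadrant_def)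
  then have "cdf2 t \<le> prob (quadrant s \<union> (?U \<union> ?V))"
    unfolding cdf2_def by (intro finite_measure_mono) auto
  also have "\<dots> \<le> cdf2 s + (prob ?U + prob ?V)"
    unfolding cdf2_def by (intro order_trans[OF measure_Un_le] add_left_mono measure_Un_le) auto
  finally have "cdf2 t \<le> cdf2 s + (prob ?U + prob ?V)" .
  moreover have "prob ?U = fst t - fst s" "prob ?V = snd t - snd s"
    using s t le by (cases s; cases t; auto intro!: prob_strip)+
  ultimately show ?thesis by simp
qed

text \<open>Consequences of the Frechet-Hoeffding bounds, in the form that matches the weight:
  \<open>cdf2\<close> is small where the smaller coordinate is near 0, and near 1 where that
  coordinate is near 1.\<close>

lemma cdf2_bounds:
  assumes t: "t \<in> unit_square"
  shows "0 \<le> cdf2 t" "cdf2 t \<le> 1" "cdf2 t \<le> min_coord t" "1 - cdf2 t \<le> 2 * (1 - min_coord t)"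
proof -
  show "0 \<le> cdf2 t" "cdf2 t \<le> 1" by (simp_all add: cdf2_def)
  have t01: "0 \<le> fst t" "fst t \<le> 1" "0 \<le> snd t" "snd t \<le> 1" using t by (cases t; auto)+
  have "cdf2 t \<le> prob {z. fst z \<le> fst t}" "cdf2 t \<le> prob {z. snd z \<le> snd t}"
    unfolding cdf2_def by (intro finite_measure_mono; auto simp: quadrant_def)+
  then show "cdf2 t \<le> min_coord t" using prob_lower t01 by (simp add: min_coord_def)
  have "1 - cdf2 t = prob (space P - quadrant t)" unfolding cdf2_def by (rule prob_compl[symmetric]) auto
  also have "\<dots> \<le> prob ((space P - {z. fst z \<le> fst t}) \<union> (space P - {z. snd z \<le> snd t}))"
    by (intro finite_measure_mono) (auto simp: quadrant_def)
  also have "\<dots> \<le> prob (space P - {z. fst z \<le> fst t}) + prob (space P - {z. snd z \<le> snd t})"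
    by (intro measure_Un_le) auto
  also have "\<dots> = (1 - fst t) + (1 - snd t)"
    using prob_lower t01 by (simp add: prob_compl)
  finally show "1 - cdf2 t \<le> 2 * (1 - min_coord t)" by (simp add: min_coord_def min_def split: if_splits)
qed

lemma cdf2_top: "cdf2 (1, 1) = 1"
  using cdf2_bounds[of "(1, 1)"] by (simp add: min_coord_def)

lemma cdf2_zero: "t \<in> unit_square \<Longrightarrow> min_coord t = 0 \<Longrightarrow> cdf2 t = 0"
  using cdf2_bounds[of t] by simp

lemma centered_ind_bound: "\<bar>centered_ind t z\<bar> \<le> 1"
proof -
  have "0 \<le> cdf2 t" "cdf2 t \<le> 1" by (simp_all add: cdf2_def)
  then show ?thesis by (auto simp: centered_ind_def indicator_def abs_le_iff)
qed

lemma centered_ind_measurable [measurable]: "centered_ind t \<in> borel_measurable P"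
  unfolding centered_ind_def by measurable

lemma wfun_measurable [measurable]: "wfun t \<in> borel_measurable P"
  unfolding wfun_def by measurable

lemma wfun_borel [measurable]: "wfun t \<in> borel_measurable borel"
  using wfun_measurable measurable_cong_sets[OF sets_P refl] by blast

lemma wfun_bound: "\<bar>wfun t z\<bar> \<le> inv_weight \<omega> (min_coord t)"
  unfolding wfun_def abs_mult using centered_ind_bound[of t z] by (simp add: mult_left_le)

lemma integral_centered_ind:
  "(\<integral>z. centered_ind t z \<partial>P) = 0"
  "(\<integral>z. centered_ind s z * centered_ind t z \<partial>P) = cdf2 (meet s t) - cdf2 s * cdf2 t"
proof -
  have i: "integrable P (indicator (quadrant t) :: _ \<Rightarrow> real)" for t
    by (simp add: integrable_indicator_iff less_top[symmetric])
  have e: "(\<integral>z. indicator (quadrant t) z \<partial>P) = cdf2 t" for t by (simp add: cdf2_def)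
  show "(\<integral>z. centered_ind t z \<partial>P) = 0"
    unfolding centered_ind_def using i e by (simp add: prob_space)
  have "centered_ind s z * centered_ind t z = indicator (quadrant (meet s t)) z
      - cdf2 t * indicator (quadrant s) z - cdf2 s * indicator (quadrant t) z + cdf2 s * cdf2 t" for z
    unfolding centered_ind_def quadrant_meet indicator_inter_arith by (simp add: algebra_simps)
  then show "(\<integral>z. centered_ind s z * centered_ind t z \<partial>P) = cdf2 (meet s t) - cdf2 s * cdf2 t"
    using i e by (simp add: prob_space)
qed

lemma integrable_centered_ind: "integrable P (centered_ind t)"
  "integrable P (\<lambda>z. centered_ind s z * centered_ind t z)"
proof -
  have "\<bar>centered_ind s z * centered_ind t z\<bar> \<le> 1" for z
    unfolding abs_mult using centered_ind_bound by (intro mult_le_one) auto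
  then show "integrable P (centered_ind t)" "integrable P (\<lambda>z. centered_ind s z * centered_ind t z)"
    by (auto intro!: integrable_const_bound[where B=1] AE_I2 simp: centered_ind_bound simp del: split_paired_All)
qed

lemma integrable_wfun: "integrable P (wfun t)" "integrable P (\<lambda>z. wfun s z * wfun t z)"
proof -
  show "integrable P (wfun t)" unfolding wfun_def using integrable_centered_ind by simp
  have "(\<lambda>z. wfun s z * wfun t z) = (\<lambda>z. (inv_weight \<omega> (min_coord s) * inv_weight \<omega> (min_coord t)) *
      (centered_ind s z * centered_ind t z))" by (simp add: wfun_def mult_ac)
  then show "integrable P (\<lambda>z. wfun s z * wfun t z)" using integrable_centered_ind by simp
qed

lemma integral_wfun: "(\<integral>z. wfun t z \<partial>P) = 0" "(\<integral>z. wfun s z * wfun t z \<partial>P) = wcov s t"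
proof -
  show "(\<integral>z. wfun t z \<partial>P) = 0" unfolding wfun_def using integral_centered_ind by simp
  have "(\<lambda>z. wfun s z * wfun t z) = (\<lambda>z. (inv_weight \<omega> (min_coord s) * inv_weight \<omega> (min_coord t)) *
      (centered_ind s z * centered_ind t z))" by (simp add: wfun_def mult_ac)
  then show "(\<integral>z. wfun s z * wfun t z \<partial>P) = wcov s t" using integral_centered_ind by (simp add: wcov_def)
qed

lemma wcov_sum:
  assumes "finite I"
  shows "integrable P (\<lambda>z. (\<Sum>i\<in>I. a i * wfun (p i) z)\<^sup>2)"
    "(\<integral>z. (\<Sum>i\<in>I. a i * wfun (p i) z)\<^sup>2 \<partial>P) = (\<Sum>i\<in>I. \<Sum>j\<in>I. a i * a j * wcov (p i) (p j))"
proof -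
  have e: "(\<Sum>i\<in>I. a i * wfun (p i) z)\<^sup>2 = (\<Sum>i\<in>I. \<Sum>j\<in>I. a i * a j * (wfun (p i) z * wfun (p j) z))" for z
    by (simp add: power2_eq_square sum_product mult_ac)
  show "integrable P (\<lambda>z. (\<Sum>i\<in>I. a i * wfun (p i) z)\<^sup>2)"
    unfolding e using integrable_wfun by auto
  show "(\<integral>z. (\<Sum>i\<in>I. a i * wfun (p i) z)\<^sup>2 \<partial>P) = (\<Sum>i\<in>I. \<Sum>j\<in>I. a i * a j * wcov (p i) (p j))"
    unfolding e using integrable_wfun integral_wfun by simp
qed

lemma wcov_sym: "wcov s t = wcov t s"
  by (simp add: wcov_def meet_def min.commute mult_ac)

end


section \<open>Neighbouring points of the dyadic grid\<close>

lemma grid_min_coord: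
  assumes k: "1 \<le> k" and ij: "i \<le> 2 ^ k" "j \<le> 2 ^ k"
  defines "h \<equiv> 1 / 2 ^ k" and "a \<equiv> min_coord (dyadic k i, dyadic k j)"
  shows "a = 0 \<or> a = 1 \<or> h \<le> a \<and> a \<le> 1 - h"
proof -
  have a: "a = dyadic k (min i j)"
    using dyadic_mono[of i j k] dyadic_mono[of j i k] by (auto simp: a_def min_coord_def min_def)
  consider "min i j = 0" | "min i j = 2 ^ k" | "1 \<le> min i j" "min i j + 1 \<le> 2 ^ k" using ij by linarith
  then show ?thesis
  proof cases
    case 3
    have "dyadic k 1 \<le> dyadic k (min i j)" "dyadic k (min i j + 1) \<le> dyadic k (2 ^ k)"
      using 3 by (intro dyadic_mono; simp)+
    then show ?thesis unfolding a using dyadic_Suc[of k "min i j"] dyadic_Suc[of k 0] by (simp add: h_def)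
  qed (auto simp: a)
qed

lemma grid_adjacent_coords:
  assumes "grid_adjacent k s t"
  obtains i j where "i \<le> 2 ^ k" "j \<le> 2 ^ k" "s = (dyadic k i, dyadic k j)"
proof -
  obtain i j where ij: "i < 2^k" "j \<le> 2^k" and
    "s = (dyadic k (Suc i), dyadic k j) \<or> s = (dyadic k i, dyadic k j) \<or>
     s = (dyadic k j, dyadic k (Suc i)) \<or> s = (dyadic k j, dyadic k i)"
    using assms unfolding grid_adjacent_def by blast
  then show thesis using that[of "Suc i" j] that[of i j] that[of j "Suc i"] that[of j i] by linarith
qed

lemma grid_adjacent_mem:
  assumes "grid_adjacent k s t"
  shows "s \<in> unit_square"
  using grid_adjacent_coords[OF assms] by (metis dyadic_mem mem_Sigma_iff)

lemma grid_adjacent_cases: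
  assumes "grid_adjacent k s t"
  obtains "s \<in> unit_square" "t \<in> unit_square" "fst s \<le> fst t" "snd s \<le> snd t"
      "(fst t - fst s) + (snd t - snd s) = 1 / 2 ^ k"
    | "s \<in> unit_square" "t \<in> unit_square" "fst t \<le> fst s" "snd t \<le> snd s"
      "(fst s - fst t) + (snd s - snd t) = 1 / 2 ^ k"
proof -
  have st: "s \<in> unit_square" "t \<in> unit_square"
    using grid_adjacent_mem[OF assms] grid_adjacent_mem[OF grid_adjacent_sym[OF assms]] by auto
  have "(fst s \<le> fst t \<and> snd s \<le> snd t \<and> (fst t - fst s) + (snd t - snd s) = 1 / 2 ^ k) \<or>
      (fst t \<le> fst s \<and> snd t \<le> snd s \<and> (fst s - fst t) + (snd s - snd t) = 1 / 2 ^ k)"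
    using assms unfolding grid_adjacent_def by (auto simp: dyadic_Suc)
  then show thesis using that st by blast
qed

lemma grid_adjacent_0:
  assumes "grid_adjacent 0 s t"
  shows "min_coord s \<in> {0, 1}"
proof -
  have d: "dyadic 0 i \<in> {0, 1}" if "i \<le> 1" for i using that by (cases i) (auto simp: dyadic_def)
  obtain i j where "i \<le> 1" "j \<le> 1" "s = (dyadic 0 i, dyadic 0 j)"
    using grid_adjacent_coords[OF assms] by (metis power_0)
  then show ?thesis using d[of i] d[of j] by (auto simp: min_coord_def)
qed

text \<open>These are the hypotheses of \<open>inv_weight_increment\<close>: grid points off the
  boundary keep a full mesh away from it, which caps their weight.\<close>

lemma grid_adjacent_min_coord:
  assumes adj: "grid_adjacent k s t" and k: "1 \<le> k"
  defines "h \<equiv> 1 / 2 ^ k"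
  shows "min_coord s = 0 \<or> min_coord s = 1 \<or> h \<le> min_coord s \<and> min_coord s \<le> 1 - h"
    "\<bar>min_coord s - min_coord t\<bar> \<le> h"
proof -
  show "min_coord s = 0 \<or> min_coord s = 1 \<or> h \<le> min_coord s \<and> min_coord s \<le> 1 - h"
    using grid_adjacent_coords[OF adj] grid_min_coord[OF k] unfolding h_def by metis
  show "\<bar>min_coord s - min_coord t\<bar> \<le> h"
    using adj
  proof (cases rule: grid_adjacent_cases)
    case 1 then show ?thesis unfolding h_def min_coord_def by linarith
  next
    case 2 then show ?thesis unfolding h_def min_coord_def by linarith
  qed
qed

section \<open>Increments of the weighted indicators along grid edges\<close>

context copula_law
begin

text \<open>Adjacent points are comparable, so their meet is one of the two.\<close>

lemma cdf2_adjacent: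
  assumes "grid_adjacent k s t"
  shows "\<bar>cdf2 s - cdf2 t\<bar> \<le> 1 / 2 ^ k" "cdf2 (meet s t) = min (cdf2 s) (cdf2 t)"
proof -
  have m: "cdf2 (meet s t) = cdf2 s \<and> cdf2 s \<le> cdf2 t" if "fst s \<le> fst t" "snd s \<le> snd t" for s t
    using that cdf2_mono[OF that] by (simp add: meet_def min_absorb1)
  have sym: "meet s t = meet t s" by (simp add: meet_def min.commute)
  show "\<bar>cdf2 s - cdf2 t\<bar> \<le> 1 / 2 ^ k" "cdf2 (meet s t) = min (cdf2 s) (cdf2 t)"
    using assms
    by (atomize (full), cases rule: grid_adjacent_cases)
       (use m[of s t] m[of t s] sym cdf2_lipschitz[of s t] cdf2_lipschitz[of t s] in \<open>auto simp: min_def\<close>)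
qed

text \<open>With r the reciprocal weight and c the centered indicator, the increment is r_s (c_s -
  c_t) + (r_s - r_t) c_t. In the first part c_s - c_t has second moment at most h and r_s^2 is of
  order h^(-2\<omega>). In the second, c_t has variance at most 2 a (1 - a) with a =
  \<open>min_coord t\<close>, the factor required by \<open>inv_weight_increment\<close>. The
  constant is 24 = 2 * 4 + 4 * 4. At level 0 all weights vanish.\<close>

lemma wfun_increment_moment:
  assumes adj: "grid_adjacent k s t"
  shows "(\<integral>z. (wfun s z - wfun t z)\<^sup>2 \<partial>P) \<le> 24 * (1 / 2 ^ k) powr (1 - 2 * \<omega>)"
proof (cases "k = 0")
  case True
  have "min_coord s \<in> {0, 1}" "min_coord t \<in> {0, 1}"
    using grid_adjacent_0[of s t] grid_adjacent_0[of t s] adj grid_adjacent_sym[OF adj] True by auto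
  then have "wfun s z = 0" "wfun t z = 0" for z by (auto simp: wfun_def)
  then show ?thesis by simp
next
  case False
  let ?h = "1 / 2 ^ k :: real" and ?r = "\<lambda>t. inv_weight \<omega> (min_coord t)"
  have k: "1 \<le> k" using False by simp
  have h: "0 < ?h" "?h \<le> 1/2"
    using power_increasing[OF k, of "2::real"] by (auto simp: field_simps)
  note ms = grid_adjacent_min_coord[OF adj k]
  note mt = grid_adjacent_min_coord[OF grid_adjacent_sym[OF adj] k]
  have t01: "t \<in> unit_square" using adj by (cases rule: grid_adjacent_cases) auto
  have i2: "(\<integral>z. (centered_ind s z - centered_ind t z)\<^sup>2 \<partial>P) \<le> ?h"
  proof -
    have "(\<integral>z. (centered_ind s z - centered_ind t z)\<^sup>2 \<partial>P)
        = (\<integral>z. centered_ind s z * centered_ind s z - 2 * (centered_ind s z * centered_ind t z) + centered_ind t z * centered_ind t z \<partial>P)"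
      by (intro Bochner_Integration.integral_cong) (auto simp: power2_eq_square algebra_simps)
    also have "\<dots> = (cdf2 s - cdf2 s * cdf2 s) - 2 * (min (cdf2 s) (cdf2 t) - cdf2 s * cdf2 t) + (cdf2 t - cdf2 t * cdf2 t)"
      using integrable_centered_ind by (simp add: integral_centered_ind cdf2_adjacent[OF adj]) (simp add: meet_def)
    also have "\<dots> = \<bar>cdf2 s - cdf2 t\<bar> - (cdf2 s - cdf2 t)\<^sup>2"
      by (simp add: min_def abs_if power2_eq_square algebra_simps)
    also have "\<dots> \<le> ?h" using cdf2_adjacent(1)[OF adj] by (smt (verit) zero_le_power2)
    finally show ?thesis .
  qed
  have r2: "(?r s)\<^sup>2 * ?h \<le> 4 * ?h powr (1 - 2 * \<omega>)"
  proof (cases "min_coord s = 0 \<or> min_coord s = 1")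
    case True then show ?thesis by auto
  next
    case False
    then have "?r s \<le> 2 * ?h powr (-\<omega>)" using ms h by (intro inv_weight_upper \<omega>) auto
    then have "(?r s)\<^sup>2 * ?h \<le> (2 * ?h powr (-\<omega>))\<^sup>2 * ?h"
      using h by (intro mult_right_mono power_mono) auto
    also have "\<dots> = 4 * (?h * (?h powr (-\<omega>))\<^sup>2)" by (simp add: power_mult_distrib)
    also have "\<dots> = 4 * ?h powr (1 - 2 * \<omega>)" using mult_powr_square[of ?h "-\<omega>"] h by simp
    finally show ?thesis .
  qed
  have c2: "(\<integral>z. (centered_ind t z)\<^sup>2 \<partial>P) \<le> 2 * (min_coord t * (1 - min_coord t))"
  proof -
    have "(\<integral>z. (centered_ind t z)\<^sup>2 \<partial>P) = cdf2 t * (1 - cdf2 t)"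
      using integral_centered_ind(2)[of t t] by (simp add: power2_eq_square meet_def algebra_simps)
    also have "\<dots> \<le> min_coord t * (2 * (1 - min_coord t))"
      using cdf2_bounds[OF t01] by (intro mult_mono) auto
    finally show ?thesis by (simp add: algebra_simps)
  qed
  have w: "min_coord t * (1 - min_coord t) * (?r s - ?r t)\<^sup>2 \<le> 4 * ?h powr (1 - 2 * \<omega>)"
    using ms(2) by (intro inv_weight_increment \<omega> h ms(1) mt(1))
  have i1: "integrable P (\<lambda>z. (centered_ind s z - centered_ind t z)\<^sup>2)"
      "integrable P (\<lambda>z. (centered_ind t z)\<^sup>2)" "integrable P (\<lambda>z. (wfun s z - wfun t z)\<^sup>2)"
  proof -
    have "(\<lambda>z. (centered_ind s z - centered_ind t z)\<^sup>2) = (\<lambda>z. centered_ind s z * centered_ind s z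
        - 2 * (centered_ind s z * centered_ind t z) + centered_ind t z * centered_ind t z)"
      "(\<lambda>z. (wfun s z - wfun t z)\<^sup>2) = (\<lambda>z. wfun s z * wfun s z
        - 2 * (wfun s z * wfun t z) + wfun t z * wfun t z)"
      by (auto simp: power2_eq_square algebra_simps)
    then show "integrable P (\<lambda>z. (centered_ind s z - centered_ind t z)\<^sup>2)"
      "integrable P (\<lambda>z. (centered_ind t z)\<^sup>2)" "integrable P (\<lambda>z. (wfun s z - wfun t z)\<^sup>2)"
      using integrable_centered_ind integrable_wfun by (auto simp: power2_eq_square)
  qed
  have "(\<integral>z. (wfun s z - wfun t z)\<^sup>2 \<partial>P) \<le> (\<integral>z. 2 * (?r s)\<^sup>2 * (centered_ind s z - centered_ind t z)\<^sup>2
      + 2 * (?r s - ?r t)\<^sup>2 * (centered_ind t z)\<^sup>2 \<partial>P)"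
  proof (intro integral_mono i1 Bochner_Integration.integrable_add integrable_mult_right)
    fix z
    let ?a = "?r s * (centered_ind s z - centered_ind t z)" and ?b = "(?r s - ?r t) * centered_ind t z"
    have "(wfun s z - wfun t z)\<^sup>2 = (?a + ?b)\<^sup>2" by (simp add: wfun_def algebra_simps)
    also have "\<dots> \<le> 2 * ?a\<^sup>2 + 2 * ?b\<^sup>2" using sum_squares_bound[of ?a ?b] by (simp add: power2_sum)
    finally show "(wfun s z - wfun t z)\<^sup>2 \<le> 2 * (?r s)\<^sup>2 * (centered_ind s z - centered_ind t z)\<^sup>2
      + 2 * (?r s - ?r t)\<^sup>2 * (centered_ind t z)\<^sup>2" by (simp add: power_mult_distrib)
  qed
  also have "\<dots> = 2 * ((?r s)\<^sup>2 * (\<integral>z. (centered_ind s z - centered_ind t z)\<^sup>2 \<partial>P))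
      + 2 * (?r s - ?r t)\<^sup>2 * (\<integral>z. (centered_ind t z)\<^sup>2 \<partial>P)"
    using i1 by simp
  also have "\<dots> \<le> 2 * ((?r s)\<^sup>2 * ?h) + 2 * (?r s - ?r t)\<^sup>2 * (2 * (min_coord t * (1 - min_coord t)))"
    by (intro add_mono mult_left_mono i2 c2) auto
  also have "\<dots> \<le> 24 * ?h powr (1 - 2 * \<omega>)" using r2 w by (simp add: algebra_simps)
  finally show ?thesis .
qed

lemma wfun_increment_bound:
  assumes adj: "grid_adjacent k s t"
  shows "\<bar>wfun s z - wfun t z\<bar> \<le> 4 * (1 / 2 ^ k) powr (-\<omega>)"
proof -
  have w: "\<bar>wfun s z\<bar> \<le> 2 * (1 / 2 ^ k) powr (-\<omega>)" if adj: "grid_adjacent k s t" for s t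
  proof (cases "min_coord s = 0 \<or> min_coord s = 1")
    case True
    then have "wfun s z = 0" by (auto simp: wfun_def)
    then show ?thesis by simp
  next
    case False
    have k: "1 \<le> k"
    proof (rule ccontr)
      assume "\<not> 1 \<le> k"
      then have "k = 0" by simp
      then have "min_coord s \<in> {0, 1}" using grid_adjacent_0[of s t] adj by simp
      then show False using False by auto
    qed
    have "(1 / 2 ^ k :: real) \<le> 1/2"
      using power_increasing[OF k, of "2::real"] by (auto simp: field_simps)
    then have "inv_weight \<omega> (min_coord s) \<le> 2 * (1 / 2 ^ k) powr (-\<omega>)"
      using False grid_adjacent_min_coord(1)[OF adj k] by (intro inv_weight_upper \<omega>) auto
    then show ?thesis using wfun_bound[of s z] by linarith
  qed
  show ?thesis using w[OF adj] w[OF grid_adjacent_sym[OF adj]] by linarith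
qed

text \<open>The right side involves \<open>wcov\<close> alone; through it the Gaussian limit
  inherits the bound of \<open>wfun_increment_moment\<close>.\<close>

lemma wfun_increment_wcov:
  "(\<integral>z. (wfun s z - wfun t z)\<^sup>2 \<partial>P) = wcov s s - 2 * wcov s t + wcov t t"
proof -
  have "(\<integral>z. (wfun s z - wfun t z)\<^sup>2 \<partial>P) = (\<integral>z. wfun s z * wfun s z - 2 * (wfun s z * wfun t z) + wfun t z * wfun t z \<partial>P)"
    by (intro Bochner_Integration.integral_cong) (auto simp: power2_eq_square algebra_simps)
  also have "\<dots> = wcov s s - 2 * wcov s t + wcov t t"
    using integrable_wfun by (simp add: integral_wfun)
  finally show ?thesis .
qed

end

section \<open>The weighted empirical process\<close>


text \<open>For x = -y with y \<ge> 0 this combines e^(-y) (1 + y) \<le> 1 with (1 - y + y^2) (1 +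
  y) = 1 + y^3.\<close>

lemma exp_le_quadratic:
  fixes x :: real
  assumes "\<bar>x\<bar> \<le> 1"
  shows "exp x \<le> 1 + x + x\<^sup>2"
proof (cases "0 \<le> x")
  case True
  then show ?thesis using assms exp_bound[of x] by simp
next
  case False
  define y where "y = - x"
  have y: "0 \<le> y" using False by (simp add: y_def)
  have "exp x * (1 + y) \<le> exp x * exp y"
    using exp_ge_add_one_self[of y] by (intro mult_left_mono) auto
  also have "\<dots> = 1" by (simp add: y_def flip: exp_add)
  also have "\<dots> \<le> 1 + y ^ 3" using y by simp
  also have "\<dots> = (1 + x + x\<^sup>2) * (1 + y)" by (simp add: y_def power2_eq_square power3_eq_cube algebra_simps)
  finally show ?thesis using y by simp
qed

text \<open>A Bernstein argument: a centered variable \<open>Y\<close> bounded by 1 has E e^Y \<le>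
  1 + E Y^2 \<le> e^s, and independence multiplies these bounds.\<close>

lemma (in prob_space) exp_moment_sum:
  fixes Y :: "nat \<Rightarrow> 'a \<Rightarrow> real"
  assumes indep: "indep_vars (\<lambda>_. borel) Y {..<n}"
    and b: "\<And>i x. \<bar>Y i x\<bar> \<le> 1"
    and mean: "\<And>i. i < n \<Longrightarrow> expectation (Y i) = 0"
    and s: "\<And>i. i < n \<Longrightarrow> expectation (\<lambda>x. (Y i x)\<^sup>2) \<le> s"
  shows "(\<integral>\<^sup>+x. ennreal (exp (\<Sum>i<n. Y i x)) \<partial>M) \<le> ennreal (exp (real n * s))"
proof -
  have m: "Y i \<in> borel_measurable M" if "i < n" for i
    using indep that by (auto simp: indep_vars_def2)
  have one: "(\<integral>\<^sup>+x. ennreal (exp (Y i x)) \<partial>M) \<le> ennreal (exp s)" if i: "i < n" for i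
  proof -
    note [measurable] = m[OF i]
    have i1: "integrable M (Y i)" by (rule integrable_const_bound[where B=1]) (auto simp: b)
    have i2: "integrable M (\<lambda>x. (Y i x)\<^sup>2)"
      by (rule integrable_const_bound[where B=1]) (auto simp: b abs_square_le_1)
    have "(\<integral>\<^sup>+x. ennreal (exp (Y i x)) \<partial>M) \<le> (\<integral>\<^sup>+x. ennreal (1 + Y i x + (Y i x)\<^sup>2) \<partial>M)"
      by (intro nn_integral_mono ennreal_leI exp_le_quadratic b)
    also have "\<dots> = ennreal (\<integral>x. 1 + Y i x + (Y i x)\<^sup>2 \<partial>M)"
    proof (rule nn_integral_eq_integral)
      show "AE x in M. 0 \<le> 1 + Y i x + (Y i x)\<^sup>2"
      proof (rule AE_I2)
        fix x
        have "-1 \<le> Y i x" using b[of i x] by (simp add: abs_le_iff)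
        then show "0 \<le> 1 + Y i x + (Y i x)\<^sup>2" using zero_le_power2[of "Y i x"] by linarith
      qed
    qed (use i1 i2 in auto)
    also have "(\<integral>x. 1 + Y i x + (Y i x)\<^sup>2 \<partial>M) = 1 + expectation (\<lambda>x. (Y i x)\<^sup>2)"
      using i1 i2 mean[OF i] by (simp add: prob_space)
    also have "\<dots> \<le> 1 + s" using s[OF i] by simp
    also have "\<dots> \<le> exp s" by (rule exp_ge_add_one_self)
    finally show ?thesis by (simp add: ennreal_leI)
  qed
  have "(\<integral>\<^sup>+x. ennreal (exp (\<Sum>i<n. Y i x)) \<partial>M) = (\<integral>\<^sup>+x. (\<Prod>i<n. ennreal (exp (Y i x))) \<partial>M)"
    by (simp add: exp_sum prod_ennreal)
  also have "\<dots> = (\<Prod>i<n. \<integral>\<^sup>+x. ennreal (exp (Y i x)) \<partial>M)"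
    by (intro indep_vars_nn_integral indep_vars_compose2[OF indep]) auto
  also have "\<dots> \<le> (\<Prod>i<n. ennreal (exp s))" using one by (intro prod_mono_ennreal) auto
  also have "\<dots> = ennreal (exp (real n * s))"
    by (simp add: ennreal_power exp_of_nat_mult)
  finally show ?thesis .
qed

section \<open>An integrable envelope for the outermost cells, and the chaining ratio\<close>

context copula_law
begin

lemma nn_integral_margin:
  assumes [measurable]: "g \<in> borel_measurable borel"
  shows "(\<integral>\<^sup>+z. g (fst z) \<partial>P) = (\<integral>\<^sup>+u. g u * indicator {0..1} u \<partial>lborel)"
    "(\<integral>\<^sup>+z. g (snd z) \<partial>P) = (\<integral>\<^sup>+u. g u * indicator {0..1} u \<partial>lborel)"
proof -
  have "(\<integral>\<^sup>+z. g (fst z) \<partial>P) = (\<integral>\<^sup>+u. g u \<partial>uniform_measure lborel {0..1})"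
    unfolding margin1[symmetric] by (subst nn_integral_distr) auto
  then show "(\<integral>\<^sup>+z. g (fst z) \<partial>P) = (\<integral>\<^sup>+u. g u * indicator {0..1} u \<partial>lborel)"
    by (simp add: nn_integral_uniform_measure divide_ennreal_def)
  have "(\<integral>\<^sup>+z. g (snd z) \<partial>P) = (\<integral>\<^sup>+u. g u \<partial>uniform_measure lborel {0..1})"
    unfolding margin2[symmetric] by (subst nn_integral_distr) auto
  then show "(\<integral>\<^sup>+z. g (snd z) \<partial>P) = (\<integral>\<^sup>+u. g u * indicator {0..1} u \<partial>lborel)"
    by (simp add: nn_integral_uniform_measure divide_ennreal_def)
qed

text \<open>As \<open>0 powr (-\<omega>) = 0\<close>, the value at 0 is 0 rather than infinite, so
  estimates from below by \<open>edge_fun\<close> concern interior points only.\<close>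

definition edge_fun :: "real \<Rightarrow> real \<Rightarrow> real" where
  "edge_fun h u = indicator {0..h} u * u powr (-\<omega>)"

text \<open>One term for each edge of the square to which a sample point may be close.\<close>

definition edge_sum :: "real \<Rightarrow> real \<times> real \<Rightarrow> real" where
  "edge_sum h z = (edge_fun h (fst z) + edge_fun h (snd z)) + (edge_fun h (1 - fst z) + edge_fun h (1 - snd z))"

lemma edge_fun_nonneg: "0 \<le> edge_fun h u" by (simp add: edge_fun_def)

lemma edge_sum_nonneg: "0 \<le> edge_sum h u" by (simp add: edge_sum_def edge_fun_nonneg)

lemma edge_fun_measurable [measurable]: "edge_fun h \<in> borel_measurable borel"
  unfolding edge_fun_def by measurable

text \<open>The singularity at 0 is integrable, and 1 / (1 - \<omega>) is at most 2.\<close>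

lemma nn_integral_edge_fun:
  assumes h: "0 \<le> h"
  shows "(\<integral>\<^sup>+u. ennreal (edge_fun h u) \<partial>lborel) \<le> ennreal (2 * h powr (1 - \<omega>))"
proof -
  have "((\<lambda>u. u powr (-\<omega>)) has_integral (h powr (-\<omega> + 1) / (-\<omega> + 1))) {0..h}"
    using \<omega> h by (intro has_integral_powr_from_0) auto
  moreover have "edge_fun h = (\<lambda>u. if u \<in> {0..h} then u powr (-\<omega>) else 0)"
    by (auto simp: edge_fun_def)
  ultimately have "(edge_fun h has_integral (h powr (-\<omega> + 1) / (-\<omega> + 1))) UNIV"
    by (simp only: has_integral_restrict_UNIV)
  then have "(\<integral>\<^sup>+u. ennreal (edge_fun h u) \<partial>lborel) = ennreal (h powr (-\<omega> + 1) / (-\<omega> + 1))"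
    by (intro nn_integral_has_integral_lborel edge_fun_nonneg) auto
  moreover have "h powr (-\<omega> + 1) / (-\<omega> + 1) \<le> 2 * h powr (1 - \<omega>)"
  proof -
    have "h powr (1 - \<omega>) / (1 - \<omega>) \<le> h powr (1 - \<omega>) / (1/2)" using \<omega> by (intro divide_left_mono) auto
    then show ?thesis by (simp add: add.commute)
  qed
  ultimately show ?thesis by (simp add: ennreal_leI)
qed

lemma nn_integral_edge_sum:
  assumes h: "0 \<le> h"
  shows "(\<integral>\<^sup>+z. ennreal (edge_sum h z) \<partial>P) \<le> ennreal (8 * h powr (1 - \<omega>))"
proof -
  let ?b = "2 * h powr (1 - \<omega>)"
  have a: "(\<integral>\<^sup>+u. ennreal (edge_fun h u) * indicator {0..1} u \<partial>lborel) \<le> ennreal ?b"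
    by (rule order_trans[OF nn_integral_mono nn_integral_edge_fun[OF h]]) (auto simp: indicator_def)
  have "(\<integral>\<^sup>+u. ennreal (edge_fun h (1 - u)) * indicator {0..1} u \<partial>lborel)
      \<le> (\<integral>\<^sup>+u. ennreal (edge_fun h (1 + (-1) * u)) \<partial>lborel)"
    by (rule nn_integral_mono) (auto simp: indicator_def)
  also have "\<dots> = (\<integral>\<^sup>+u. ennreal (edge_fun h u) \<partial>lborel)"
    by (subst nn_integral_real_affine[where c="-1" and t=1]) auto
  also have "\<dots> \<le> ennreal ?b" by (rule nn_integral_edge_fun[OF h])
  finally have b: "(\<integral>\<^sup>+u. ennreal (edge_fun h (1 - u)) * indicator {0..1} u \<partial>lborel) \<le> ennreal ?b" .
  have "(\<integral>\<^sup>+z. ennreal (edge_sum h z) \<partial>P) =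
      ((\<integral>\<^sup>+z. ennreal (edge_fun h (fst z)) \<partial>P) + (\<integral>\<^sup>+z. ennreal (edge_fun h (snd z)) \<partial>P)) +
      ((\<integral>\<^sup>+z. ennreal (edge_fun h (1 - fst z)) \<partial>P) + (\<integral>\<^sup>+z. ennreal (edge_fun h (1 - snd z)) \<partial>P))"
    unfolding edge_sum_def by (simp add: edge_fun_nonneg nn_integral_add)
  also have "\<dots> \<le> (ennreal ?b + ennreal ?b) + (ennreal ?b + ennreal ?b)"
    using nn_integral_margin[of "\<lambda>u. ennreal (edge_fun h u)"]
      nn_integral_margin[of "\<lambda>u. ennreal (edge_fun h (1 - u))"] a b
    by (intro add_mono) auto
  also have "\<dots> = ennreal (8 * h powr (1 - \<omega>))" by (simp flip: ennreal_plus)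
  finally show ?thesis .
qed

lemma AE_interior: "AE z in P. fst z \<in> {0<..<1} \<and> snd z \<in> {0<..<1}"
proof -
  have i: "{0..1} \<inter> {0<..<1} = {0<..<1::real}" by auto
  have "prob {z \<in> space P. fst z \<in> {0<..<1}} = 1" "prob {z \<in> space P. snd z \<in> {0<..<1}} = 1"
    using prob_fst[of "{0<..<1}"] prob_snd[of "{0<..<1}"] by (simp_all add: space_P i)
  then have "AE z in P. fst z \<in> {0<..<1}" "AE z in P. snd z \<in> {0<..<1}"
    using AE_prob_1 by fastforce+
  then show ?thesis by eventually_elim auto
qed

text \<open>The square root of 2^(-(1/2-\<omega>)): half of the exponent goes into the allowed
  oscillation, the other half is left for the tail.\<close>

definition chain_ratio :: real where
  "chain_ratio = 2 powr (- (1/2 - \<omega>) / 2)"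

lemma chain_ratio: "0 < chain_ratio" "chain_ratio < 1"
  using \<omega> by (auto simp: chain_ratio_def powr_less_one)

lemma chain_ratio_power: "chain_ratio ^ (2 * k) = (1 / 2 ^ k) powr (1/2 - \<omega>)"
proof -
  have "(1 / 2 ^ k :: real) = 2 powr (- real k)" by (simp add: powr_minus powr_realpow field_simps)
  then have "(1 / 2 ^ k) powr (1/2 - \<omega>) = 2 powr (- real k * (1/2 - \<omega>))" by (simp add: powr_powr)
  also have "- real k * (1/2 - \<omega>) = - (1/2 - \<omega>) / 2 * real (2 * k)" by (simp add: algebra_simps)
  also have "2 powr \<dots> = chain_ratio powr real (2 * k)" by (simp only: chain_ratio_def powr_powr)
  also have "\<dots> = chain_ratio ^ (2 * k)" by (rule powr_realpow[OF chain_ratio(1)])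
  finally show ?thesis ..
qed

end

locale copula_sample = copula_law P \<omega> + M: prob_space M
  for P :: "(real \<times> real) measure" and \<omega> :: real and M :: "'a measure" +
  fixes Z :: "nat \<Rightarrow> 'a \<Rightarrow> real \<times> real"
  assumes indep: "M.indep_vars (\<lambda>_. borel) Z UNIV"
    and law: "\<And>i. distr M borel (Z i) = P"
begin

definition wemp :: "nat \<Rightarrow> 'a \<Rightarrow> real \<times> real \<Rightarrow> real" where
  "wemp n x t = (1 / sqrt (real n)) * (\<Sum>i<n. wfun t (Z i x))"

lemma Z_measurable [measurable]: "Z i \<in> borel_measurable M"
  using indep by (auto simp: M.indep_vars_def2)

lemma wemp_measurable [measurable]: "(\<lambda>x. wemp n x t) \<in> borel_measurable M"
  unfolding wemp_def by measurable

lemma integral_Z: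
  fixes g :: "real \<times> real \<Rightarrow> real"
  assumes "g \<in> borel_measurable borel"
  shows "(\<integral>x. g (Z i x) \<partial>M) = (\<integral>z. g z \<partial>P)"
  unfolding law[of i, symmetric] by (rule integral_distr[symmetric]) (auto simp: assms)

text \<open>With \<theta> = h^(\<omega>-1/2) / 4, each summand is at most \<theta> / sqrt n times 4
  h^(-\<omega>), that is 1 / sqrt (n h), and its second moment is at most \<theta>^2 / n times 24
  h^(1-2\<omega>), which is (3/2) / n. Both bounds are what \<open>exp_moment_sum\<close> takes as
  input.\<close>

lemma wemp_exp_moment:
  assumes adj: "grid_adjacent k s t" and k: "2 ^ k \<le> n"
  shows "(\<integral>\<^sup>+x. ennreal (exp ((1/4) / chain_ratio ^ (2 * k) * (wemp n x s - wemp n x t))) \<partial>M) \<le> ennreal (exp (3/2))"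
proof -
  let ?h = "1 / 2 ^ k :: real"
  define \<theta> where "\<theta> = (1/4) * ?h powr (\<omega> - 1/2)"
  have th: "(1/4) / chain_ratio ^ (2 * k) = \<theta>"
    using powr_minus_divide[of ?h "1/2 - \<omega>"] by (simp add: chain_ratio_power \<theta>_def)
  have n: "0 < real n" "1 \<le> real n * ?h"
    using k of_nat_mono[OF k, where ?'a = real] by (auto simp: field_simps intro: Nat.gr0I)
  define g where "g z = \<theta> / sqrt n * (wfun s z - wfun t z)" for z
  have g [measurable]: "g \<in> borel_measurable borel" unfolding g_def by measurable
  have "\<bar>g z\<bar> \<le> 1" for z
  proof -
    have "\<bar>g z\<bar> = \<theta> / sqrt n * \<bar>wfun s z - wfun t z\<bar>" by (simp add: g_def abs_mult \<theta>_def)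
    also have "\<dots> \<le> \<theta> / sqrt n * (4 * ?h powr (-\<omega>))"
      by (intro mult_left_mono wfun_increment_bound[OF adj]) (auto simp: \<theta>_def)
    also have "\<dots> = ?h powr (\<omega> - 1/2) * ?h powr (-\<omega>) / sqrt n" by (simp add: \<theta>_def)
    also have "?h powr (\<omega> - 1/2) * ?h powr (-\<omega>) = ?h powr (- (1/2))" by (simp flip: powr_add)
    also have "\<dots> = 1 / sqrt ?h" using powr_minus_divide[of ?h "1/2"] by (simp add: powr_half_sqrt)
    also have "1 / sqrt ?h / sqrt n = 1 / sqrt (real n * ?h)" by (simp add: real_sqrt_mult real_sqrt_divide)
    \<comment> \<open>Here n h \<ge> 1 enters; this is what ends the chaining at mesh about
      1/n.\<close>
    also have "\<dots> \<le> 1" using n by (simp del: times_divide_eq_right)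
    finally show ?thesis .
  qed
  moreover have "(\<integral>x. g (Z i x) \<partial>M) = 0" for i
  proof -
    have "(\<integral>x. g (Z i x) \<partial>M) = (\<integral>z. g z \<partial>P)" by (rule integral_Z[OF g])
    also have "\<dots> = 0" unfolding g_def using integrable_wfun(1) by (simp add: integral_wfun)
    finally show ?thesis .
  qed
  moreover have "(\<integral>x. (g (Z i x))\<^sup>2 \<partial>M) \<le> 3/2 / n" for i
  proof -
    have "(\<integral>x. (g (Z i x))\<^sup>2 \<partial>M) = (\<integral>z. (g z)\<^sup>2 \<partial>P)" by (intro integral_Z) measurable
    also have "\<dots> = (\<theta> / sqrt n)\<^sup>2 * (\<integral>z. (wfun s z - wfun t z)\<^sup>2 \<partial>P)"
      unfolding g_def power_mult_distrib by (rule integral_mult_right_zero)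
    also have "\<dots> \<le> (\<theta> / sqrt n)\<^sup>2 * (24 * ?h powr (1 - 2 * \<omega>))"
      by (intro mult_left_mono wfun_increment_moment[OF adj]) auto
    also have "\<dots> = 3/2 / n * ((?h powr (\<omega> - 1/2))\<^sup>2 * ?h powr (1 - 2 * \<omega>))"
      using n by (simp add: \<theta>_def power_mult_distrib power_divide)
    also have "(?h powr (\<omega> - 1/2))\<^sup>2 * ?h powr (1 - 2 * \<omega>) = 1"
      by (simp add: power2_eq_square flip: powr_add)
    finally show ?thesis by simp
  qed
  ultimately have "(\<integral>\<^sup>+x. ennreal (exp (\<Sum>i<n. g (Z i x))) \<partial>M) \<le> ennreal (exp (real n * (3/2 / n)))"
    by (intro M.exp_moment_sum M.indep_vars_compose2[OF M.indep_vars_subset[OF indep]]) auto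
  moreover have "(\<Sum>i<n. g (Z i x)) = \<theta> * (wemp n x s - wemp n x t)" for x
    by (simp add: g_def wemp_def sum_distrib_left sum_subtractf right_diff_distrib)
  ultimately show ?thesis unfolding th using n by simp
qed

definition empirical_cdf :: "nat \<Rightarrow> 'a \<Rightarrow> real \<times> real \<Rightarrow> real" where
  "empirical_cdf n x t = (\<Sum>i<n. indicator (quadrant t) (Z i x)) / real n"

lemma wemp_empirical_cdf:
  assumes "0 < n"
  shows "wemp n x t = sqrt n * (empirical_cdf n x t - cdf2 t) * inv_weight \<omega> (min_coord t)"
proof -
  have "(\<Sum>i<n. wfun t (Z i x)) = inv_weight \<omega> (min_coord t) * (real n * (empirical_cdf n x t - cdf2 t))"
    using assms by (simp add: wfun_def centered_ind_def empirical_cdf_def sum_subtractf algebra_simps flip: sum_distrib_left)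
  then have "wemp n x t = (1 / sqrt n * real n) * (inv_weight \<omega> (min_coord t) * (empirical_cdf n x t - cdf2 t))"
    unfolding wemp_def by simp
  also have "1 / sqrt n * real n = sqrt n" using assms by (simp add: real_div_sqrt)
  finally show ?thesis by (simp add: mult_ac)
qed

text \<open>The factor 2 is the constant in \<open>inv_weight_le_left\<close> and
  \<open>inv_weight_le_right\<close>.\<close>

definition edge_stat :: "nat \<Rightarrow> real \<Rightarrow> 'a \<Rightarrow> real" where
  "edge_stat n h x = 2 / sqrt n * (\<Sum>i<n. edge_sum h (Z i x))"

lemma edge_stat_measurable [measurable]: "edge_stat n h \<in> borel_measurable M"
  unfolding edge_stat_def edge_sum_def by measurable

lemma edge_stat_nonneg: "0 \<le> edge_stat n h x"
  unfolding edge_stat_def by (intro mult_nonneg_nonneg sum_nonneg edge_sum_nonneg) auto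

text \<open>Markov's inequality: the mean is at most 2 / sqrt n times n times 8
  h^(1-\<omega>).\<close>

lemma edge_stat_prob:
  assumes n: "0 < n" and h: "0 \<le> h" and e: "0 < e"
  shows "M.prob {x\<in>space M. e < edge_stat n h x} \<le> 16 * (sqrt n * h powr (1 - \<omega>)) / e"
proof -
  have es [measurable]: "edge_sum h \<in> borel_measurable borel" unfolding edge_sum_def by measurable
  have "(\<integral>\<^sup>+x. ennreal (edge_stat n h x) \<partial>M) = ennreal (2 / sqrt n) * (\<Sum>i<n. \<integral>\<^sup>+x. ennreal (edge_sum h (Z i x)) \<partial>M)"
  proof -
    have "ennreal (edge_stat n h x) = ennreal (2 / sqrt n) * (\<Sum>i<n. ennreal (edge_sum h (Z i x)))" for x
      unfolding edge_stat_def by (subst ennreal_mult) (auto simp: sum_nonneg edge_sum_nonneg sum_ennreal)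
    then show ?thesis by (simp add: nn_integral_cmult nn_integral_sum)
  qed
  also have "(\<Sum>i<n. \<integral>\<^sup>+x. ennreal (edge_sum h (Z i x)) \<partial>M) = (\<Sum>i<n. \<integral>\<^sup>+z. ennreal (edge_sum h z) \<partial>P)"
  proof (intro sum.cong refl)
    fix i
    show "(\<integral>\<^sup>+x. ennreal (edge_sum h (Z i x)) \<partial>M) = (\<integral>\<^sup>+z. ennreal (edge_sum h z) \<partial>P)"
      unfolding law[of i, symmetric] by (subst nn_integral_distr) auto
  qed
  also have "\<dots> \<le> (\<Sum>i<n. ennreal (8 * h powr (1 - \<omega>)))" by (intro sum_mono nn_integral_edge_sum[OF h])
  also have "\<dots> = ennreal (real n * (8 * h powr (1 - \<omega>)))"
    by (simp add: ennreal_mult ennreal_of_nat_eq_real_of_nat)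
  also have "ennreal (2 / sqrt n) * \<dots> = ennreal (2 / sqrt n * (real n * (8 * h powr (1 - \<omega>))))"
    by (simp flip: ennreal_mult)
  also have "2 / sqrt n * (real n * (8 * h powr (1 - \<omega>))) = real n / sqrt n * (16 * h powr (1 - \<omega>))"
    by simp
  also have "real n / sqrt n = sqrt n" by (simp add: real_div_sqrt)
  finally have "(\<integral>\<^sup>+x. ennreal (edge_stat n h x) \<partial>M) \<le> ennreal (sqrt n * (16 * h powr (1 - \<omega>)))"
    by (simp add: mult_left_mono)
  then have I: "(\<integral>\<^sup>+x. ennreal (edge_stat n h x) \<partial>M) \<le> ennreal (16 * (sqrt n * h powr (1 - \<omega>)))"
    by (simp add: mult_ac)
  have "emeasure M {x\<in>space M. e < edge_stat n h x} \<le> emeasure M {x\<in>space M. 1 \<le> ennreal (1 / e) * ennreal (edge_stat n h x)}"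
    using e by (intro emeasure_mono) (auto simp: ennreal_mult[symmetric] edge_stat_nonneg simp flip: ennreal_1)
  also have "\<dots> \<le> ennreal (1 / e) * (\<integral>\<^sup>+x. ennreal (edge_stat n h x) * indicator (space M) x \<partial>M)"
    by (rule nn_integral_Markov_inequality) auto
  also have "\<dots> = ennreal (1 / e) * (\<integral>\<^sup>+x. ennreal (edge_stat n h x) \<partial>M)"
    by (intro arg_cong2[where f="(*)"] nn_integral_cong) auto
  also have "\<dots> \<le> ennreal (1 / e) * ennreal (16 * (sqrt n * h powr (1 - \<omega>)))"
    by (intro mult_left_mono I) auto
  also have "\<dots> = ennreal (16 * (sqrt n * h powr (1 - \<omega>)) / e)"
    using e by (simp flip: ennreal_mult)
  finally show ?thesis using e by (simp add: M.emeasure_eq_measure)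
qed

end


context copula_sample
begin

text \<open>A sample point on the edge of the square may make the weighted process unbounded, and
  \<open>edge_fun\<close> would not see it. All indices are covered at once, so one null set serves
  every \<open>n\<close>.\<close>

definition sample_interior :: "'a \<Rightarrow> bool" where
  "sample_interior x \<longleftrightarrow> (\<forall>i. fst (Z i x) \<in> {0<..<1} \<and> snd (Z i x) \<in> {0<..<1})"

lemma AE_sample_interior: "AE x in M. sample_interior x"
  unfolding sample_interior_def AE_all_countable
proof
  fix i
  have "AE z in distr M borel (Z i). fst z \<in> {0<..<1} \<and> snd z \<in> {0<..<1}"
    unfolding law by (rule AE_interior)
  then show "AE x in M. fst (Z i x) \<in> {0<..<1} \<and> snd (Z i x) \<in> {0<..<1}"
    by (rule AE_distrD[rotated]) simp
qed

lemma edge_fun_lower: "0 < v \<Longrightarrow> v \<le> a \<Longrightarrow> a \<le> h \<Longrightarrow> a powr (-\<omega>) \<le> edge_fun h v"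
  using \<omega> by (auto simp: edge_fun_def intro!: powr_mono2')

text \<open>A sample point in the quadrant of \<open>t\<close> has a coordinate of size at most a =
  \<open>min_coord t\<close>, and u^(-\<omega>) is decreasing, so its own term in
  \<open>edge_sum\<close> pays for the weight a^(-\<omega>).\<close>

lemma edge_bound_low:
  assumes x: "sample_interior x" and n: "0 < n" and h: "h \<le> 1/2"
    and t: "0 < min_coord t" "min_coord t < h"
  shows "sqrt n * empirical_cdf n x t * inv_weight \<omega> (min_coord t) \<le> edge_stat n h x"
proof -
  let ?a = "min_coord t"
  have e: "indicator (quadrant t) (Z i x) * ?a powr (-\<omega>) \<le> edge_sum h (Z i x)" for i
  proof (cases "Z i x \<in> quadrant t")
    case False then show ?thesis by (simp add: edge_sum_nonneg)
  next
    case True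
    have "?a powr (-\<omega>) \<le> edge_fun h (fst (Z i x)) \<or> ?a powr (-\<omega>) \<le> edge_fun h (snd (Z i x))"
      using True x t edge_fun_lower[of _ ?a h]
      by (cases "fst t \<le> snd t") (auto simp: sample_interior_def quadrant_def min_coord_def min_def mem_Times_iff)
    then show ?thesis using True edge_fun_nonneg unfolding edge_sum_def
      by (auto intro: order_trans add_nonneg_nonneg add_increasing add_increasing2)
  qed
  have "sqrt n * empirical_cdf n x t * inv_weight \<omega> ?a \<le> sqrt n * empirical_cdf n x t * (2 * ?a powr (-\<omega>))"
    using t h by (intro mult_left_mono inv_weight_le_left \<omega>) (auto simp: empirical_cdf_def sum_nonneg)
  also have "\<dots> = 2 * (sqrt n / n) * (\<Sum>i<n. indicator (quadrant t) (Z i x) * ?a powr (-\<omega>))"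
    by (simp add: empirical_cdf_def sum_distrib_right)
  also have "\<dots> \<le> 2 * (sqrt n / n) * (\<Sum>i<n. edge_sum h (Z i x))"
    by (intro mult_left_mono sum_mono e) auto
  also have "sqrt n / n = 1 / sqrt n" using n by (simp add: field_simps)
  finally show ?thesis by (simp add: edge_stat_def)
qed

text \<open>A sample point outside the quadrant exceeds \<open>t\<close> in some coordinate, hence
  is within \<open>1 - min_coord t\<close> of the right or the upper edge.\<close>

lemma edge_bound_high:
  assumes x: "sample_interior x" and n: "0 < n" and h: "h \<le> 1/2"
    and t: "min_coord t < 1" "1 - h < min_coord t"
  shows "sqrt n * (1 - empirical_cdf n x t) * inv_weight \<omega> (min_coord t) \<le> edge_stat n h x"
proof -
  let ?a = "min_coord t"
  have e: "indicator (- quadrant t) (Z i x) * (1 - ?a) powr (-\<omega>) \<le> edge_sum h (Z i x)" for i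
  proof (cases "Z i x \<in> quadrant t")
    case True then show ?thesis by (simp add: edge_sum_nonneg)
  next
    case False
    have "1 - fst (Z i x) < 1 - ?a \<or> 1 - snd (Z i x) < 1 - ?a"
      using False by (auto simp: quadrant_def min_coord_def mem_Times_iff)
    then have "(1 - ?a) powr (-\<omega>) \<le> edge_fun h (1 - fst (Z i x)) \<or> (1 - ?a) powr (-\<omega>) \<le> edge_fun h (1 - snd (Z i x))"
      using x t edge_fun_lower[of _ "1 - ?a" h] by (auto simp: sample_interior_def)
    then show ?thesis using False edge_fun_nonneg unfolding edge_sum_def
      by (auto intro: order_trans add_nonneg_nonneg add_increasing add_increasing2)
  qed
  have c: "1 - empirical_cdf n x t = (\<Sum>i<n. indicator (- quadrant t) (Z i x)) / n"
    using n by (simp add: empirical_cdf_def indicator_compl sum_subtractf diff_divide_distrib)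
  have "sqrt n * (1 - empirical_cdf n x t) * inv_weight \<omega> ?a \<le> sqrt n * (1 - empirical_cdf n x t) * (2 * (1 - ?a) powr (-\<omega>))"
    using t h by (intro mult_left_mono inv_weight_le_right \<omega>) (auto simp: c sum_nonneg)
  also have "\<dots> = 2 * (sqrt n / n) * (\<Sum>i<n. indicator (- quadrant t) (Z i x) * (1 - ?a) powr (-\<omega>))"
    by (simp add: c sum_distrib_right)
  also have "\<dots> \<le> 2 * (sqrt n / n) * (\<Sum>i<n. edge_sum h (Z i x))"
    by (intro mult_left_mono sum_mono e) auto
  also have "sqrt n / n = 1 / sqrt n" using n by (simp add: field_simps)
  finally show ?thesis by (simp add: edge_stat_def)
qed

lemma empirical_cdf_bounds: "0 \<le> empirical_cdf n x t" "empirical_cdf n x t \<le> 1"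
proof -
  have "(\<Sum>i<n. indicator (quadrant t) (Z i x)) \<le> (\<Sum>i<n. 1::real)" by (intro sum_mono) (auto simp: indicator_def)
  then show "empirical_cdf n x t \<le> 1" by (cases "n = 0") (auto simp: empirical_cdf_def divide_le_eq_1)
  show "0 \<le> empirical_cdf n x t" by (simp add: empirical_cdf_def sum_nonneg)
qed

text \<open>With strips of width 1/2 the two edge bounds cover all points except those where
  \<open>min_coord t\<close> is 0, 1 or exactly 1/2.\<close>

lemma wemp_bounded:
  assumes x: "sample_interior x"
  shows "bounded (wemp n x ` unit_square)"
proof (cases "n = 0")
  case True
  then have "wemp n x = (\<lambda>_. 0)" by (auto simp: wemp_def)
  then show ?thesis by (simp add: image_constant_conv)
next
  case False
  let ?h = "1/2 :: real" and ?s = "sqrt n"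
  define R where "R = edge_stat n ?h x + ?s * 4 + ?s * inv_weight \<omega> (1/2)"
  have n: "0 < n" using False by simp
  have "\<bar>wemp n x t\<bar> \<le> R" if t: "t \<in> unit_square" for t
  proof -
    let ?a = "min_coord t" and ?E = "empirical_cdf n x t" and ?r = "inv_weight \<omega> (min_coord t)"
    have R0: "0 \<le> edge_stat n ?h x" "0 \<le> ?s * 4" "0 \<le> ?s * inv_weight \<omega> (1/2)"
      using edge_stat_nonneg by auto
    have pw: "v * v powr (-\<omega>) \<le> 1" if "0 < v" "v \<le> 1" for v :: real
      using that powr_mult_base[of v "-\<omega>"] \<omega> by (simp add: powr_le1)
    consider "?a = 0 \<or> ?a = 1" | "0 < ?a" "?a < ?h" | "?a < 1" "1 - ?h < ?a" | "?a = ?h"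
      using min_coord_mem[OF t] by fastforce
    then show ?thesis
    proof cases
      case 1
      then have "wemp n x t = 0" using n by (auto simp: wemp_empirical_cdf)
      then show ?thesis using R0 by (simp add: R_def)
    next
      case 2
      have "cdf2 t * ?r \<le> ?a * (2 * ?a powr (-\<omega>))"
        using 2 cdf2_bounds[OF t] by (intro mult_mono inv_weight_le_left \<omega>) auto
      also have "\<dots> \<le> 4" using pw[of ?a] 2 by simp
      finally have c: "?s * (cdf2 t * ?r) \<le> ?s * 4" by (intro mult_left_mono) auto
      have nn: "0 \<le> ?s * (cdf2 t * ?r)" "0 \<le> ?s * ?E * ?r"
        using cdf2_bounds[OF t] empirical_cdf_bounds by auto
      have "wemp n x t = ?s * ?E * ?r - ?s * (cdf2 t * ?r)"
        using n by (simp add: wemp_empirical_cdf algebra_simps)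
      moreover have "?s * ?E * ?r \<le> edge_stat n ?h x" by (rule edge_bound_low[OF x n _ 2]) simp
      ultimately show ?thesis using c R0 nn unfolding R_def by linarith
    next
      case 3
      have "(1 - cdf2 t) * ?r \<le> (2 * (1 - ?a)) * (2 * (1 - ?a) powr (-\<omega>))"
        using 3 cdf2_bounds[OF t] by (intro mult_mono inv_weight_le_right \<omega>) auto
      also have "\<dots> = 4 * ((1 - ?a) * (1 - ?a) powr (-\<omega>))" by simp
      also have "\<dots> \<le> 4" using pw[of "1 - ?a"] 3 by simp
      finally have c: "?s * ((1 - cdf2 t) * ?r) \<le> ?s * 4" by (intro mult_left_mono) auto
      have nn: "0 \<le> ?s * ((1 - cdf2 t) * ?r)" "0 \<le> ?s * (1 - ?E) * ?r"
        using cdf2_bounds[OF t] empirical_cdf_bounds[of n x t] by auto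
      have "wemp n x t = ?s * ((1 - cdf2 t) * ?r) - ?s * (1 - ?E) * ?r"
        using n by (simp add: wemp_empirical_cdf algebra_simps)
      moreover have "?s * (1 - ?E) * ?r \<le> edge_stat n ?h x" by (rule edge_bound_high[OF x n _ 3]) simp
      ultimately show ?thesis using c R0 nn unfolding R_def by linarith
    next
      case 4
      have "\<bar>?E - cdf2 t\<bar> \<le> 1" using cdf2_bounds[OF t] empirical_cdf_bounds[of n x t] by (simp add: abs_le_iff)
      then have "\<bar>wemp n x t\<bar> \<le> ?s * 1 * inv_weight \<omega> (1/2)"
        unfolding wemp_empirical_cdf[OF n] abs_mult 4 by (intro mult_mono) auto
      then show ?thesis using R0 unfolding R_def by linarith
    qed
  qed
  then show ?thesis unfolding bounded_iff by auto
qed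

lemma wemp_square_floor:
  fixes A c :: real
  assumes x: "sample_interior x" and n: "0 < n" and K: "1 \<le> K" and A: "0 \<le> A" and t: "t \<in> unit_square" and m: "m < K"
    and osc: "\<And>k. k \<le> K \<Longrightarrow> level_osc (wemp n x) (A * chain_ratio ^ k) k"
  defines "h \<equiv> 1 / 2 ^ K" and "c \<equiv> 2 ^ Suc m" and "B \<equiv> 2 * A / (1 - chain_ratio)"
  shows "\<bar>wemp n x t - wemp n x (square_floor m t)\<bar> \<le>
    12 * (B * chain_ratio ^ m) + edge_stat n h x + 4 * (sqrt n * h powr (1 - \<omega>)) +
    ((2 * (A * chain_ratio ^ K) + B * (2 * h * c) + 2 * (sqrt n * h)) * (2 * c) + B * (4 * (h * c ^ 3)))"
proof -
  have X: "(\<lambda>t. sqrt n * (empirical_cdf n x t - cdf2 t) * inv_weight \<omega> (min_coord t)) = wemp n x"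
    using n by (auto simp: wemp_empirical_cdf)
  have h: "h \<le> 1/2"
    using power_increasing[OF K, of "2::real"] by (simp add: h_def field_simps)
  interpret weighted_difference cdf2 "empirical_cdf n x" "sqrt n" \<omega> A chain_ratio "edge_stat n h x" h K "wemp n x"
  proof (unfold_locales, goal_cases)
    case (8 s t) then show ?case using cdf2_mono cdf2_lipschitz by blast
  next
    case (9 s t)
    then show ?case using quadrant_mono[of s t] n
      by (auto simp: empirical_cdf_def intro!: divide_right_mono sum_mono indicator_leI)
  next
    case (10 t) then show ?case using cdf2_bounds by blast
  next
    case (11 t) then show ?case using cdf2_bounds by blast
  next
    case (13)
    have "Z i x \<in> quadrant (1, 1)" for i
      using x by (auto simp: sample_interior_def quadrant_def mem_Times_iff less_imp_le)
    then show ?case using n by (simp add: empirical_cdf_def)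
  next
    case (15 t) then show ?case using edge_bound_low[OF x n h] by (simp add: h_def)
  next
    case (16 t) then show ?case using edge_bound_high[OF x n h] by (simp add: h_def)
  next
    case (17 k) then show ?case unfolding X by (rule osc)
  next
    case 18
    show "wemp n x \<equiv> (\<lambda>t. sqrt n * (empirical_cdf n x t - cdf2 t) * inv_weight \<omega> (min_coord t))" by (rule eq_reflection[OF X[symmetric]])
  next
    case 19
    show "h \<equiv> 1 / 2 ^ K" by (rule h_def)
  qed (use \<omega> K A chain_ratio edge_stat_nonneg empirical_cdf_bounds in \<open>auto\<close>)
  show ?thesis
    using square_floor_approx[OF t m] unfolding B_def c_def .
qed

end


section \<open>Asymptotic equicontinuity of the weighted process\<close>

lemma exists_small_power:
  fixes D \<eta> :: real
  assumes "0 < D" "0 < \<eta>" "1 \<le> r"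
  obtains x :: real where "0 < x" "D * x ^ r \<le> \<eta>"
proof -
  define x where "x = min 1 (\<eta> / D)"
  have x: "0 < x" "x \<le> 1" using assms by (auto simp: x_def)
  have "x ^ r \<le> x ^ 1" using x assms by (intro power_decreasing) auto
  then have "D * x ^ r \<le> D * (\<eta> / D)" using assms by (intro mult_left_mono) (auto simp: x_def)
  then show thesis using that[of x] x assms by simp
qed

context copula_law
begin

definition chain_power :: nat where
  "chain_power = (SOME r. 1 \<le> r \<and> chain_ratio ^ r \<le> 1/8)"

lemma chain_power: "1 \<le> chain_power" "chain_ratio ^ chain_power \<le> 1/8"
proof -
  have "(\<lambda>r. chain_ratio ^ r) \<longlonglongrightarrow> 0" using chain_ratio by (intro LIMSEQ_power_zero) auto
  then have "\<forall>\<^sub>F r in sequentially. chain_ratio ^ r < 1/8" by (rule order_tendstoD) simp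
  then have "\<forall>\<^sub>F r in sequentially. 1 \<le> r \<and> chain_ratio ^ r \<le> 1/8"
    using eventually_ge_at_top[of 1] by eventually_elim simp
  then have "\<exists>r. 1 \<le> r \<and> chain_ratio ^ r \<le> 1/8" by (auto simp: eventually_sequentially)
  from someI_ex[OF this] show "1 \<le> chain_power" "chain_ratio ^ chain_power \<le> 1/8"
    by (auto simp: chain_power_def)
qed

text \<open>The factor 1/4 is the one in the exponential moment bounds; the empirical process and
  its limit share it.\<close>

lemma chain_constant:
  assumes "0 < D" "0 < \<eta>"
  obtains A :: real where "0 < A" "16 * D * (real chain_power / ((1/4) * A)) ^ chain_power \<le> \<eta>"
proof -
  obtain x where x: "0 < x" "16 * D * x ^ chain_power \<le> \<eta>"
    using exists_small_power[of "16 * D" \<eta>] assms chain_power by auto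
  have r: "0 < real chain_power" using chain_power by simp
  have "real chain_power / ((1/4) * (4 * real chain_power / x)) = x" using r x by simp
  then show thesis using that[of "4 * real chain_power / x"] x r by simp
qed

end

context copula_sample
begin

text \<open>The order of choices is \<open>A\<close> from \<eta>, then \<open>m\<close> from
  \<open>A\<close> and \<epsilon>, then \<open>n\<close> from \<open>m\<close>. The exceptional
  event joins a failure of the chaining bound with a large \<open>edge_stat\<close>, each of
  probability at most \<eta> / 2.\<close>

theorem wemp_equicontinuous:
  assumes e: "0 < \<epsilon>" "0 < \<eta>"
  shows "\<exists>m0. \<forall>m\<ge>m0. \<exists>n0. \<forall>n\<ge>n0. \<exists>D\<in>sets M. M.prob D \<le> \<eta> \<and>
     (\<forall>x\<in>space M - D. sample_interior x \<longrightarrow>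
       (\<forall>t\<in>unit_square. \<bar>wemp n x t - wemp n x (square_floor m t)\<bar> \<le> \<epsilon>))"
proof -
  let ?D = "exp (3/2) :: real" and ?\<rho> = chain_ratio
  obtain A where A: "0 < A" "16 * ?D * (real chain_power / ((1/4) * A)) ^ chain_power \<le> \<eta> / 2"
    using chain_constant[of ?D "\<eta> / 2"] e by auto
  define B where "B = 2 * A / (1 - ?\<rho>)"
  have "(\<lambda>m. 12 * (B * ?\<rho> ^ m)) \<longlonglongrightarrow> 12 * (B * 0)"
    using chain_ratio by (intro tendsto_intros LIMSEQ_power_zero) auto
  then have "\<forall>\<^sub>F m in sequentially. 12 * (B * ?\<rho> ^ m) < \<epsilon> / 3"
    by (rule order_tendstoD) (use e in simp)
  then obtain m0 where m0: "\<And>m. m \<ge> m0 \<Longrightarrow> 12 * (B * ?\<rho> ^ m) < \<epsilon> / 3"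
    by (auto simp: eventually_sequentially)
  \<comment> \<open>\<open>K n\<close> is the binary logarithm of \<open>n\<close> rounded down:
    2^(K n) \<le> n keeps the exponential moments available on all levels used, and h \<le> 2/n
    makes the part below the mesh negligible.\<close>
  have "\<forall>n::nat. \<exists>k. 1 \<le> n \<longrightarrow> 2 ^ k \<le> n \<and> n < 2 ^ (k + 1)"
    using ex_power_ivl1[of 2] by blast
  then obtain K :: "nat \<Rightarrow> nat" where K: "\<And>n::nat. 1 \<le> n \<Longrightarrow> 2 ^ K n \<le> n \<and> n < 2 ^ (K n + 1)"
    by metis
  define h where "h n = (1 / 2 ^ K n :: real)" for n
  have h0: "0 < h n" for n by (simp add: h_def)
  have hn: "h n \<le> 2 / n" if "1 \<le> n" for n
  proof -
    have "real n < real (2 ^ (K n + 1))" using K[OF that] by (intro of_nat_less_iff[THEN iffD2]) auto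
    then show ?thesis using that by (simp add: h_def field_simps)
  qed
  have hlim: "h \<longlonglongrightarrow> 0"
  proof (rule tendsto_sandwich[of "\<lambda>_. 0" _ _ "\<lambda>n. 2 / real n"])
    show "\<forall>\<^sub>F n in sequentially. h n \<le> 2 / real n"
      using eventually_ge_at_top[of 1] by eventually_elim (rule hn)
    show "(\<lambda>n. 2 / real n) \<longlonglongrightarrow> 0" by (rule lim_const_over_n)
  qed (auto simp: h0 less_imp_le)
  \<comment> \<open>The upper bound is a multiple of n^(w-1/2), which is where an exponent below 1/2
    is essential; w = 0 gives the limit of sqrt n h.\<close>
  have shlim: "(\<lambda>n. sqrt n * h n powr (1 - w)) \<longlonglongrightarrow> 0" if w: "0 \<le> w" "w < 1/2" for w
  proof (rule tendsto_sandwich[of "\<lambda>_. 0" _ _ "\<lambda>n. 2 powr (1 - w) * real n powr (w - 1/2)"])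
    show "\<forall>\<^sub>F n in sequentially. sqrt n * h n powr (1 - w) \<le> 2 powr (1 - w) * real n powr (w - 1/2)"
      using eventually_ge_at_top[of 1]
    proof eventually_elim
      case (elim n)
      have "sqrt n * h n powr (1 - w) \<le> sqrt n * (2 / n) powr (1 - w)"
        using h0[of n] hn[OF elim] w by (intro mult_left_mono powr_mono2) auto
      also have "\<dots> = 2 powr (1 - w) * (real n powr (1/2) * real n powr (w - 1))"
        using elim powr_minus_divide[of "real n" "1 - w"] by (simp add: powr_divide powr_half_sqrt)
      also have "real n powr (1/2) * real n powr (w - 1) = real n powr (w - 1/2)"
        by (simp flip: powr_add)
      finally show ?case .
    qed
    have "(\<lambda>n. real n powr (w - 1/2)) \<longlonglongrightarrow> 0"
      using w by (intro tendsto_neg_powr filterlim_real_sequentially) auto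
    then show "(\<lambda>n. 2 powr (1 - w) * real n powr (w - 1/2)) \<longlonglongrightarrow> 0"
      using tendsto_mult_right_zero by blast
  qed (auto simp: h0 less_imp_le)
  have sh: "(\<lambda>n. sqrt n * h n) \<longlonglongrightarrow> 0" using shlim[of 0] h0 by (simp add: less_imp_le)
  have rlim: "(\<lambda>n. ?\<rho> ^ K n) \<longlonglongrightarrow> 0"
  proof -
    have "?\<rho> ^ K n = sqrt (h n powr (1/2 - \<omega>))" for n
    proof (rule real_sqrt_unique[symmetric])
      show "(?\<rho> ^ K n)\<^sup>2 = h n powr (1/2 - \<omega>)"
        using chain_ratio_power[of "K n"] by (simp add: h_def mult.commute flip: power_mult)
    qed (use chain_ratio in simp)
    moreover have "(\<lambda>n. sqrt (h n powr (1/2 - \<omega>))) \<longlonglongrightarrow> sqrt 0"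
      using \<omega> h0 by (intro tendsto_real_sqrt tendsto_zero_powrI[OF hlim tendsto_const]) (auto simp: less_imp_le)
    ultimately show ?thesis by simp
  qed
  show ?thesis
  proof (rule exI[of _ m0], intro allI impI)
    fix m assume m: "m \<ge> m0"
    define c :: real where "c = 2 ^ Suc m"
    define E where "E n = 4 * (sqrt n * h n powr (1 - \<omega>)) +
      ((2 * (A * ?\<rho> ^ K n) + B * (2 * h n * c) + 2 * (sqrt n * h n)) * (2 * c) + B * (4 * (h n * c ^ 3)))" for n
    have "E \<longlonglongrightarrow> 4 * 0 + ((2 * (A * 0) + B * (2 * 0 * c) + 2 * 0) * (2 * c) + B * (4 * (0 * c ^ 3)))"
      unfolding E_def by (intro tendsto_intros shlim \<omega> rlim sh hlim)
    then have E: "\<forall>\<^sub>F n in sequentially. E n < \<epsilon> / 3"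
      by (rule order_tendstoD) (use e in simp)
    have "(\<lambda>n. 16 * (sqrt n * h n powr (1 - \<omega>)) / (\<epsilon> / 3)) \<longlonglongrightarrow> 16 * 0 / (\<epsilon> / 3)"
      using e by (intro tendsto_intros shlim \<omega>) auto
    then have S: "\<forall>\<^sub>F n in sequentially. 16 * (sqrt n * h n powr (1 - \<omega>)) / (\<epsilon> / 3) < \<eta> / 2"
      by (rule order_tendstoD) (use e in simp)
    have "\<forall>\<^sub>F n in sequentially. \<exists>D\<in>sets M. M.prob D \<le> \<eta> \<and>
     (\<forall>x\<in>space M - D. sample_interior x \<longrightarrow>
       (\<forall>t\<in>unit_square. \<bar>wemp n x t - wemp n x (square_floor m t)\<bar> \<le> \<epsilon>))"
      using E S eventually_ge_at_top[of "2 ^ (m + 2)"]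
    proof eventually_elim
      case (elim n)
      have n: "1 \<le> n" using elim(3) one_le_power[of "2::nat" "m + 2"] by linarith
      have "2 ^ (m + 2) < (2::nat) ^ (K n + 1)" using K[OF n] elim(3) by linarith
      then have mK: "m < K n" by (subst (asm) power_strict_increasing_iff) auto
      define D1 where "D1 = {x\<in>space M. \<exists>k\<le>K n. \<not> level_osc (wemp n x) (A * ?\<rho> ^ k) k}"
      define D2 where "D2 = {x\<in>space M. \<epsilon> / 3 < edge_stat n (h n) x}"
      have D1: "D1 \<in> sets M"
      proof -
        have "D1 = (\<Union>k\<in>{..K n}. {x\<in>space M. \<not> level_osc (wemp n x) (A * ?\<rho> ^ k) k})" by (auto simp: D1_def)
        then show ?thesis by (auto intro!: M.level_osc_measurable)
      qed
      have D2: "D2 \<in> sets M" unfolding D2_def by measurable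
      have "M.prob D1 \<le> 16 * ?D * (real chain_power / ((1/4) * A)) ^ chain_power"
        unfolding D1_def
      proof (rule M.chaining_prob[where x = "wemp n" and K = "K n" and c = "1/4" and D = ?D])
        fix k s t assume k: "k \<le> K n" and adj: "grid_adjacent k s t"
        have "(2::nat) ^ k \<le> n" using k K[OF n] power_increasing[OF k, of "2::nat"] by linarith
        then show "(\<integral>\<^sup>+y. ennreal (exp ((1/4) / ?\<rho> ^ (2 * k) * (wemp n y s - wemp n y t))) \<partial>M) \<le> ennreal ?D"
          by (rule wemp_exp_moment[OF adj])
      qed (use A chain_ratio chain_power in auto)
      moreover have "M.prob D2 \<le> 16 * (sqrt n * h n powr (1 - \<omega>)) / (\<epsilon> / 3)"
        unfolding D2_def using n e h0[of n] by (intro edge_stat_prob) auto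
      ultimately have "M.prob (D1 \<union> D2) \<le> \<eta>"
        using measure_Un_le[OF D1 D2] A(2) elim(2) by linarith
      moreover have "\<bar>wemp n x t - wemp n x (square_floor m t)\<bar> \<le> \<epsilon>"
        if x: "x \<in> space M - (D1 \<union> D2)" "sample_interior x" and t: "t \<in> unit_square" for x t
      proof -
        have "\<bar>wemp n x t - wemp n x (square_floor m t)\<bar> \<le> 12 * (B * ?\<rho> ^ m) + edge_stat n (h n) x + E n"
          using wemp_square_floor[OF x(2) _ _ _ t mK, of n A] x(1) n mK A
          by (auto simp: D1_def E_def B_def h_def c_def)
        then show ?thesis using m0[OF m] x elim(1) by (auto simp: D2_def)
      qed
      ultimately show ?case using D1 D2 by (intro bexI[of _ "D1 \<union> D2"]) auto
    qed
    then show "\<exists>n0. \<forall>n\<ge>n0. \<exists>D\<in>sets M. M.prob D \<le> \<eta> \<and>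
     (\<forall>x\<in>space M - D. sample_interior x \<longrightarrow>
       (\<forall>t\<in>unit_square. \<bar>wemp n x t - wemp n x (square_floor m t)\<bar> \<le> \<epsilon>))"
      by (simp add: eventually_sequentially)
  qed
qed

end

section \<open>Finite-dimensional convergence\<close>


definition linear_functional :: "(('i \<Rightarrow> real) \<Rightarrow> real) \<Rightarrow> bool" where
  "linear_functional l \<longleftrightarrow> (\<exists>I a. finite I \<and> l = (\<lambda>w. \<Sum>i\<in>I. a i * w i))"

lemma linear_functional_0: "linear_functional (\<lambda>w. 0)"
  unfolding linear_functional_def by (intro exI[of _ "{}"]) auto

lemma linear_functional_add_coord:
  assumes "linear_functional l"
  shows "linear_functional (\<lambda>w. l w + c * w j)"
proof -
  obtain I a where I: "finite I" "l = (\<lambda>w. \<Sum>i\<in>I. a i * w i)"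
    using assms by (auto simp: linear_functional_def)
  let ?a = "\<lambda>i. (if i \<in> I then a i else 0) + (if i = j then c else 0)"
  have "(\<Sum>i\<in>insert j I. ?a i * w i) = l w + c * w j" for w
  proof -
    have "(\<Sum>i\<in>insert j I. ?a i * w i) = (\<Sum>i\<in>insert j I. if i \<in> I then a i * w i else 0)
        + (\<Sum>i\<in>insert j I. if i = j then c * w i else 0)"
      unfolding sum.distrib[symmetric] by (intro sum.cong) (auto simp: algebra_simps)
    also have "(\<Sum>i\<in>insert j I. if i \<in> I then a i * w i else 0) = l w"
      unfolding I(2) using I(1) by (intro sum.mono_neutral_cong_right) auto
    also have "(\<Sum>i\<in>insert j I. if i = j then c * w i else 0) = c * w j"
      using I(1) by (simp add: sum.delta)
    finally show ?thesis .
  qed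
  then show ?thesis unfolding linear_functional_def using I(1)
    by (intro exI[of _ "insert j I"] exI[of _ ?a]) auto
qed

lemma linear_functional_continuous:
  assumes "linear_functional l"
  shows "continuous_on UNIV l"
  using assms unfolding linear_functional_def
  by (auto intro!: continuous_intros continuous_on_product_coordinates)

lemma measurable_continuous_sequence:
  fixes h :: "('i::countable \<Rightarrow> real) \<Rightarrow> real"
  assumes x: "\<And>i. (\<lambda>\<omega>. x \<omega> i) \<in> borel_measurable M" and h: "continuous_on UNIV h"
  shows "(\<lambda>\<omega>. h (x \<omega>)) \<in> borel_measurable M"
  by (rule borel_measurable_continuous_on[OF h measurable_coordinatewise_then_product[OF x]])

text \<open>Convergence of the characteristic functions passes to polynomials in \<open>sin (c * w i)\<close>; by
  Stone--Weierstrass these approximate, uniformly on the whole space, the periodization of a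
  continuous function.\<close>
locale cf_convergence =
  M: prob_space M + N: prob_space N
  for M :: "'a measure" and N :: "'b measure" +
  fixes x :: "nat \<Rightarrow> 'a \<Rightarrow> 'i::countable \<Rightarrow> real" and y :: "'b \<Rightarrow> 'i \<Rightarrow> real"
  assumes x: "\<And>n i. (\<lambda>\<omega>. x n \<omega> i) \<in> borel_measurable M"
    and y: "\<And>i. (\<lambda>\<omega>. y \<omega> i) \<in> borel_measurable N"
    and cf: "\<And>l. linear_functional l \<Longrightarrow>
        (\<lambda>n. \<integral>\<omega>. iexp (l (x n \<omega>)) \<partial>M) \<longlonglongrightarrow> (\<integral>\<omega>. iexp (l (y \<omega>)) \<partial>N)"
begin

definition mean_converges :: "(('i \<Rightarrow> real) \<Rightarrow> real) \<Rightarrow> bool" where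
  "mean_converges f \<longleftrightarrow> (\<lambda>n. \<integral>\<omega>. f (x n \<omega>) \<partial>M) \<longlonglongrightarrow> (\<integral>\<omega>. f (y \<omega>) \<partial>N)"

text \<open>Testing against every cosine is built in so that the property survives multiplication by
  a sine; the free phase \<open>b\<close> lets cosines alone stand for sines too.\<close>

definition admissible :: "(('i \<Rightarrow> real) \<Rightarrow> real) \<Rightarrow> bool" where
  "admissible f \<longleftrightarrow> continuous_on UNIV f \<and> (\<exists>B. \<forall>w. \<bar>f w\<bar> \<le> B) \<and>
     (\<forall>l b. linear_functional l \<longrightarrow> mean_converges (\<lambda>w. f w * cos (l w + b)))"

text \<open>A product of two admissible functions is not obviously admissible, but multipliers
  compose, which yields the ring that Stone-Weierstrass asks for.\<close>

definition multiplier :: "(('i \<Rightarrow> real) \<Rightarrow> real) \<Rightarrow> bool" where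
  "multiplier g \<longleftrightarrow> (\<forall>f. admissible f \<longrightarrow> admissible (\<lambda>w. g w * f w))"

lemma integrable_bounded_cont:
  fixes f :: "('i \<Rightarrow> real) \<Rightarrow> real"
  assumes "continuous_on UNIV f" "\<And>w. \<bar>f w\<bar> \<le> B"
  shows "integrable M (\<lambda>\<omega>. f (x n \<omega>))" "integrable N (\<lambda>\<omega>. f (y \<omega>))"
  using assms(2)
  by (intro M.integrable_const_bound[where B=B] AE_I2 measurable_continuous_sequence[OF x assms(1)]; simp)
     (use assms(2) in \<open>intro N.integrable_const_bound[where B=B] AE_I2 measurable_continuous_sequence[OF y assms(1)]; simp\<close>)

lemma mean_converges_add:
  assumes "continuous_on UNIV f" "\<And>w. \<bar>f w\<bar> \<le> B" "continuous_on UNIV g" "\<And>w. \<bar>g w\<bar> \<le> C"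
    and "mean_converges f" "mean_converges g"
  shows "mean_converges (\<lambda>w. f w + g w)"
  using assms(5,6) integrable_bounded_cont[OF assms(1,2)] integrable_bounded_cont[OF assms(3,4)]
  unfolding mean_converges_def by (simp add: tendsto_add)

lemma mean_converges_cmult: "mean_converges f \<Longrightarrow> mean_converges (\<lambda>w. c * f w)"
  unfolding mean_converges_def by (auto intro: tendsto_mult_left)

lemma cos_bound:
  assumes "\<And>w. \<bar>f w\<bar> \<le> (B::real)" shows "\<bar>f w * cos u\<bar> \<le> B"
proof -
  have "\<bar>f w * cos u\<bar> \<le> \<bar>f w\<bar> * 1" unfolding abs_mult by (intro mult_left_mono) auto
  then show ?thesis using assms[of w] by linarith
qed

lemma cos_continuous:
  fixes f l :: "('i \<Rightarrow> real) \<Rightarrow> real"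
  assumes "continuous_on UNIV f" "linear_functional l"
  shows "continuous_on UNIV (\<lambda>w. f w * cos (l w + b))"
  by (intro continuous_on_mult continuous_on_cos continuous_on_add continuous_on_const assms(1)
      linear_functional_continuous[OF assms(2)])

text \<open>A cosine with a phase is the real part of a rotated complex exponential, so this is the
  hypothesis on characteristic functions.\<close>

lemma admissible_1: "admissible (\<lambda>w. 1)"
proof -
  have "mean_converges (\<lambda>w. 1 * cos (l w + b))" if l: "linear_functional l" for l b
  proof -
    have e: "cos (u + b) = Re (iexp b * iexp u)" for u
      by (simp add: cos_add exp_Euler cos_of_real sin_of_real)
    have m: "(\<lambda>\<omega>. l (x n \<omega>)) \<in> borel_measurable M" "(\<lambda>\<omega>. l (y \<omega>)) \<in> borel_measurable N" for n
      by (rule measurable_continuous_sequence[OF x linear_functional_continuous[OF l]]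
          measurable_continuous_sequence[OF y linear_functional_continuous[OF l]])+
    have i: "integrable M (\<lambda>\<omega>. iexp b * iexp (l (x n \<omega>)))" "integrable N (\<lambda>\<omega>. iexp b * iexp (l (y \<omega>)))" for n
      using m by (auto intro!: integrable_mult_right M.integrable_const_bound[where B=1] N.integrable_const_bound[where B=1])
    have "(\<lambda>n. Re (iexp b * (\<integral>\<omega>. iexp (l (x n \<omega>)) \<partial>M))) \<longlonglongrightarrow> Re (iexp b * (\<integral>\<omega>. iexp (l (y \<omega>)) \<partial>N))"
      by (intro tendsto_intros cf l)
    moreover have "Re (iexp b * (\<integral>\<omega>. iexp (l (x n \<omega>)) \<partial>M)) = (\<integral>\<omega>. cos (l (x n \<omega>) + b) \<partial>M)" for n
      unfolding e using i(1)[of n] by (simp only: integral_mult_right_zero[symmetric] integral_Re)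
    moreover have "Re (iexp b * (\<integral>\<omega>. iexp (l (y \<omega>)) \<partial>N)) = (\<integral>\<omega>. cos (l (y \<omega>) + b) \<partial>N)"
      unfolding e using i(2) by (simp only: integral_mult_right_zero[symmetric] integral_Re)
    ultimately show ?thesis unfolding mean_converges_def by simp
  qed
  then show ?thesis unfolding admissible_def by (auto intro!: exI[of _ 1])
qed

lemma admissible_mean_converges:
  assumes "admissible f" shows "mean_converges f"
proof -
  have "mean_converges (\<lambda>w. f w * cos (0 + 0))"
    using assms linear_functional_0 unfolding admissible_def by blast
  then show ?thesis by simp
qed

lemma admissible_add:
  assumes f: "admissible f" and g: "admissible g"
  shows "admissible (\<lambda>w. f w + g w)"
proof -
  obtain B C where B: "\<And>w. \<bar>f w\<bar> \<le> B" and C: "\<And>w. \<bar>g w\<bar> \<le> C"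
    using f g unfolding admissible_def by blast
  have c: "continuous_on UNIV f" "continuous_on UNIV g" using f g by (auto simp: admissible_def)
  have "mean_converges (\<lambda>w. f w * cos (l w + b) + g w * cos (l w + b))" if l: "linear_functional l" for l b
    using f g l unfolding admissible_def
    by (intro mean_converges_add[where B=B and C=C] cos_continuous c cos_bound B C) auto
  moreover have "\<bar>f w + g w\<bar> \<le> B + C" for w using B[of w] C[of w] by linarith
  ultimately show ?thesis unfolding admissible_def using c
    by (auto intro!: continuous_on_add simp: distrib_right)
qed

lemma admissible_cmult:
  assumes f: "admissible f" shows "admissible (\<lambda>w. c * f w)"
proof -
  obtain B where B: "\<And>w. \<bar>f w\<bar> \<le> B" using f unfolding admissible_def by blast
  have "\<bar>c * f w\<bar> \<le> \<bar>c\<bar> * B" for w unfolding abs_mult using B by (intro mult_left_mono) auto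
  moreover have "mean_converges (\<lambda>w. c * (f w * cos (l w + b)))" if "linear_functional l" for l b
    using f that unfolding admissible_def by (intro mean_converges_cmult) auto
  ultimately show ?thesis using f unfolding admissible_def mult.assoc
    by (intro conjI continuous_on_mult_left) blast+
qed

text \<open>A sine times a cosine is half the sum of two cosines, with functionals
  \<open>l w + c * w j\<close> and \<open>l w - c * w j\<close> and with phases shifted by a quarter
  turn.\<close>

lemma admissible_sin:
  assumes f: "admissible f" shows "admissible (\<lambda>w. sin (c * w j) * f w)"
proof -
  obtain B where B: "\<And>w. \<bar>f w\<bar> \<le> B" using f unfolding admissible_def by blast
  have c: "continuous_on UNIV f" using f by (auto simp: admissible_def)
  have "mean_converges (\<lambda>w. (sin (c * w j) * f w) * cos (l w + b))" if l: "linear_functional l" for l b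
  proof -
    let ?l1 = "\<lambda>w. l w + c * w j" and ?l2 = "\<lambda>w. l w + (- c) * w j"
    note l12 = linear_functional_add_coord[OF l, of c j] linear_functional_add_coord[OF l, of "-c" j]
    have "sin u * cos (v + b) = (1/2) * cos ((v + u) + (b - pi/2)) + (1/2) * cos ((v + - u) + (b + pi/2))" for u v :: real
    proof -
      have "(v + u) + (b - pi/2) = (u + (v + b)) - pi/2" "(v + - u) + (b + pi/2) = ((v + b) - u) + pi/2"
        by simp_all
      then have "cos ((v + u) + (b - pi/2)) = sin (u + (v + b))" "cos ((v + - u) + (b + pi/2)) = - sin ((v + b) - u)"
        by (simp_all only: cos_diff cos_add sin_pi_half cos_pi_half)
      then show ?thesis by (simp only: sin_add[of u] sin_diff[of "v + b"]) (simp add: field_simps)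
    qed
    note tri = this
    have eq: "(\<lambda>w. (sin (c * w j) * f w) * cos (l w + b)) =
        (\<lambda>w. (1/2) * (f w * cos (?l1 w + (b - pi/2))) + (1/2) * (f w * cos (?l2 w + (b + pi/2))))"
    proof (rule ext)
      fix w :: "'i \<Rightarrow> real"
      have "(sin (c * w j) * f w) * cos (l w + b) = f w * (sin (c * w j) * cos (l w + b))"
        by (simp only: mult_ac)
      also have "\<dots> = f w * ((1/2) * cos (?l1 w + (b - pi/2)) + (1/2) * cos (?l2 w + (b + pi/2)))"
        by (simp only: tri[of "c * w j" "l w"] mult_minus_left)
      also have "\<dots> = (1/2) * (f w * cos (?l1 w + (b - pi/2))) + (1/2) * (f w * cos (?l2 w + (b + pi/2)))"
        by (simp only: distrib_left mult.left_commute)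
      finally show "(sin (c * w j) * f w) * cos (l w + b) =
          (1/2) * (f w * cos (?l1 w + (b - pi/2))) + (1/2) * (f w * cos (?l2 w + (b + pi/2)))" .
    qed
    have h: "\<bar>(1/2) * (f w * cos u)\<bar> \<le> B" for w u
      using cos_bound[of f B w u, OF B]
      by (simp only: abs_mult[of "1/2"] abs_divide abs_one abs_numeral)
    show ?thesis unfolding eq
      using f l12 unfolding admissible_def
      by (intro mean_converges_add[where B=B and C=B] mean_converges_cmult h
          continuous_on_mult_left cos_continuous c) auto
  qed
  moreover have "\<bar>sin (c * w j) * f w\<bar> \<le> B" for w
  proof -
    have "\<bar>sin (c * w j) * f w\<bar> \<le> 1 * \<bar>f w\<bar>" unfolding abs_mult by (intro mult_right_mono) auto
    then show ?thesis using B[of w] by linarith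
  qed
  moreover have "continuous_on UNIV (\<lambda>w. sin (c * w j) * f w)"
    by (intro continuous_on_mult continuous_on_sin continuous_on_const continuous_on_product_coordinates c)
  ultimately show ?thesis unfolding admissible_def by blast
qed

lemma admissible_multiplier:
  assumes "multiplier g"
  shows "admissible g"
proof -
  have "admissible (\<lambda>w. g w * 1)"
    using assms admissible_1 unfolding multiplier_def by blast
  then show ?thesis by simp
qed

text \<open>The cube of all families with values in [-1, 1] is compact by Tychonoff's theorem, its
  coordinates separate points, and substituting sines turns each coordinate into a
  multiplier.\<close>

lemma sin_polynomial_approx:
  fixes H :: "('i \<Rightarrow> real) \<Rightarrow> real"
  assumes H: "continuous_on {s. \<forall>i. s i \<in> {-1..1}} H" and e: "0 < e"
  obtains p where "admissible (\<lambda>w. p (\<lambda>i. sin (c * w i)))" "\<And>w. \<bar>H (\<lambda>i. sin (c * w i)) - p (\<lambda>i. sin (c * w i))\<bar> < e"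
proof -
  let ?Q = "{s :: 'i \<Rightarrow> real. \<forall>i. s i \<in> {-1..1}}"
  let ?R = "{p. continuous_on ?Q p \<and> multiplier (\<lambda>w. p (\<lambda>i. sin (c * w i)))}"
  have Q: "compact ?Q"
  proof -
    have "compactin (product_topology (\<lambda>_. euclidean) UNIV) (PiE UNIV (\<lambda>_::'i. {-1..1::real}))"
      by (subst compactin_PiE) auto
    moreover have "PiE UNIV (\<lambda>_::'i. {-1..1::real}) = ?Q" by (auto simp: PiE_def Pi_def)
    ultimately show ?thesis by (simp add: euclidean_product_topology)
  qed
  interpret function_ring_on ?R ?Q
  proof
    fix f g assume f: "f \<in> ?R" and g: "g \<in> ?R"
    show "(\<lambda>x. f x + g x) \<in> ?R"
      using f g admissible_add unfolding multiplier_def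
      by (auto intro!: continuous_on_add simp: distrib_right)
    show "(\<lambda>x. f x * g x) \<in> ?R"
      using f g unfolding multiplier_def by (auto intro!: continuous_on_mult simp: mult.assoc)
  next
    fix a show "(\<lambda>_. a) \<in> ?R" by (auto simp: multiplier_def admissible_cmult)
  next
    fix s t assume "s \<noteq> (t :: 'i \<Rightarrow> real)"
    then obtain i where "s i \<noteq> t i" by auto
    moreover have "(\<lambda>s. s i) \<in> ?R"
      using continuous_on_subset[OF continuous_on_product_coordinates]
      by (auto simp: multiplier_def admissible_sin)
    ultimately show "\<exists>f\<in>?R. f s \<noteq> f t" by (intro bexI[of _ "\<lambda>s. s i"])
  qed (use Q in auto)
  obtain F where F: "F \<in> UNIV \<rightarrow> ?R" "LIM n sequentially. F n :> uniformly_on ?Q H"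
    using Stone_Weierstrass[OF H] by blast
  then have "\<forall>\<^sub>F n in sequentially. \<forall>s\<in>?Q. dist (F n s) (H s) < e"
    using e unfolding uniform_limit_iff by blast
  then obtain n where n: "\<And>s. s \<in> ?Q \<Longrightarrow> dist (F n s) (H s) < e"
    by (auto simp: eventually_sequentially)
  have Fn: "F n \<in> ?R" using F(1) by auto
  show thesis
  proof (rule that[of "F n"])
    show "admissible (\<lambda>w. F n (\<lambda>i. sin (c * w i)))" using Fn by (auto intro: admissible_multiplier)
    fix w :: "'i \<Rightarrow> real"
    have "(\<lambda>i. sin (c * w i)) \<in> ?Q" by auto
    from n[OF this] show "\<bar>H (\<lambda>i. sin (c * w i)) - F n (\<lambda>i. sin (c * w i))\<bar> < e"
      by (simp add: dist_real_def abs_minus_commute)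
  qed
qed

end

section \<open>From trigonometric approximation to continuous functions of finitely many
  coordinates\<close>

lemma (in prob_space) second_moment_tail:
  fixes X :: "'a \<Rightarrow> real"
  assumes [measurable]: "X \<in> borel_measurable M" and i: "integrable M (\<lambda>\<omega>. (X \<omega>)\<^sup>2)"
    and V: "expectation (\<lambda>\<omega>. (X \<omega>)\<^sup>2) \<le> V" and R: "0 < R"
  shows "prob {\<omega>\<in>space M. R < \<bar>X \<omega>\<bar>} \<le> V / R\<^sup>2"
proof -
  have "prob {\<omega>\<in>space M. R < \<bar>X \<omega>\<bar>} \<le> prob {\<omega>\<in>space M. R\<^sup>2 \<le> (X \<omega>)\<^sup>2}"
    using R by (intro finite_measure_mono) (auto intro: power2_le_iff_abs_le[THEN iffD2] simp: abs_le_square_iff[symmetric])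
  also have "\<dots> \<le> expectation (\<lambda>\<omega>. (X \<omega>)\<^sup>2) / R\<^sup>2"
    by (rule integral_Markov_inequality_measure[OF i, of "{}"]) (use R in auto)
  also have "\<dots> \<le> V / R\<^sup>2" using V R by (intro divide_right_mono) auto
  finally show ?thesis .
qed

text \<open>The functions differ by at most \<open>e\<close> unless some coordinate exceeds
  \<open>R\<close>; on that event the uniform bounds are used, and its probability is controlled by
  Chebyshev's inequality.\<close>

lemma (in prob_space) expectation_truncation:
  fixes x :: "'a \<Rightarrow> 'i \<Rightarrow> real" and h g :: "'a \<Rightarrow> real"
  assumes I: "finite I" and x: "\<And>i. (\<lambda>\<omega>. x \<omega> i) \<in> borel_measurable M"
    and sq: "\<And>i. i \<in> I \<Longrightarrow> integrable M (\<lambda>\<omega>. (x \<omega> i)\<^sup>2)" "\<And>i. i \<in> I \<Longrightarrow> expectation (\<lambda>\<omega>. (x \<omega> i)\<^sup>2) \<le> V"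
    and R: "0 < R"
    and h: "h \<in> borel_measurable M" "\<And>\<omega>. \<bar>h \<omega>\<bar> \<le> B"
    and g: "g \<in> borel_measurable M" "\<And>\<omega>. \<bar>g \<omega>\<bar> \<le> B + e"
    and hg: "\<And>\<omega>. (\<And>i. i \<in> I \<Longrightarrow> \<bar>x \<omega> i\<bar> \<le> R) \<Longrightarrow> \<bar>h \<omega> - g \<omega>\<bar> \<le> e" and e: "0 \<le> e"
  shows "\<bar>expectation h - expectation g\<bar> \<le> e + (2 * B + e) * (real (card I) * (V / R\<^sup>2))"
proof -
  define D where "D = (\<Union>i\<in>I. {\<omega>\<in>space M. R < \<bar>x \<omega> i\<bar>})"
  have Di: "{\<omega>\<in>space M. R < \<bar>x \<omega> i\<bar>} \<in> sets M" for i using x by measurable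
  then have D: "D \<in> sets M" unfolding D_def using I by auto
  have B0: "0 \<le> B" using h(2)[of undefined] by linarith
  have "prob D \<le> (\<Sum>i\<in>I. prob {\<omega>\<in>space M. R < \<bar>x \<omega> i\<bar>})"
    unfolding D_def using I Di by (intro finite_measure_subadditive_finite) auto
  also have "\<dots> \<le> (\<Sum>i\<in>I. V / R\<^sup>2)" using sq R x by (intro sum_mono second_moment_tail) auto
  finally have pD: "prob D \<le> real (card I) * (V / R\<^sup>2)" by simp
  have i: "integrable M h" "integrable M g"
    using h g by (auto intro!: integrable_const_bound[where B=B] integrable_const_bound[where B="B + e" and f=g])
  have iD: "integrable M (indicator D :: 'a \<Rightarrow> real)" using D by (simp add: integrable_indicator_iff less_top[symmetric])
  have "\<bar>expectation h - expectation g\<bar> = \<bar>expectation (\<lambda>\<omega>. h \<omega> - g \<omega>)\<bar>" using i by simp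
  also have "\<dots> \<le> expectation (\<lambda>\<omega>. \<bar>h \<omega> - g \<omega>\<bar>)" by (rule integral_abs_bound)
  also have "\<dots> \<le> expectation (\<lambda>\<omega>. e + (2 * B + e) * indicator D \<omega>)"
  proof (rule integral_mono)
    fix \<omega> assume w: "\<omega> \<in> space M"
    show "\<bar>h \<omega> - g \<omega>\<bar> \<le> e + (2 * B + e) * indicator D \<omega>"
    proof (cases "\<omega> \<in> D")
      case True
      then show ?thesis using h(2)[of \<omega>] g(2)[of \<omega>] e by simp
    next
      case False
      then show ?thesis using hg[of \<omega>] w by (auto simp: D_def not_less)
    qed
  qed (use i iD in auto)
  also have "\<dots> = e + (2 * B + e) * prob D" using iD D by (simp add: prob_space)
  also have "\<dots> \<le> e + (2 * B + e) * (real (card I) * (V / R\<^sup>2))"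
    using pD B0 e by (intro add_left_mono mult_left_mono) auto
  finally show ?thesis .
qed

text \<open>Where all coordinates in \<open>I\<close> are at most \<open>R\<close> in modulus,
  \<open>h\<close> coincides with a continuous function \<open>H\<close> of the sines of
  \<open>c * w i\<close>; elsewhere \<open>H\<close> keeps the bound of \<open>h\<close>, so common
  second moments control the difference in both measures.\<close>

theorem (in cf_convergence) cramer_wold:
  fixes h :: "('i \<Rightarrow> real) \<Rightarrow> real"
  assumes h: "continuous_on UNIV h" "\<And>w. \<bar>h w\<bar> \<le> B"
    and I: "finite I" "\<And>w w'. (\<And>i. i \<in> I \<Longrightarrow> w i = w' i) \<Longrightarrow> h w = h w'"
    and xV: "\<And>n i. i \<in> I \<Longrightarrow> integrable M (\<lambda>\<omega>. (x n \<omega> i)\<^sup>2)" "\<And>n i. i \<in> I \<Longrightarrow> M.expectation (\<lambda>\<omega>. (x n \<omega> i)\<^sup>2) \<le> V"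
    and yV: "\<And>i. i \<in> I \<Longrightarrow> integrable N (\<lambda>\<omega>. (y \<omega> i)\<^sup>2)" "\<And>i. i \<in> I \<Longrightarrow> N.expectation (\<lambda>\<omega>. (y \<omega> i)\<^sup>2) \<le> V"
  shows "(\<lambda>n. \<integral>\<omega>. h (x n \<omega>) \<partial>M) \<longlonglongrightarrow> (\<integral>\<omega>. h (y \<omega>) \<partial>N)"
proof (rule LIMSEQ_I)
  fix r :: real assume r: "0 < r"
  define e where "e = min 1 (r / 8)"
  have e: "0 < e" "e \<le> 1" "e \<le> r / 8" using r by (auto simp: e_def)
  have B0: "0 \<le> B" using h(2)[of undefined] by linarith
  have V0: "0 \<le> V \<or> I = {}"
  proof (cases "I = {}")
    case False
    then obtain i where i: "i \<in> I" by auto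
    have "0 \<le> M.expectation (\<lambda>\<omega>. (x 0 \<omega> i)\<^sup>2)" by (rule integral_nonneg_AE) simp
    then show ?thesis using xV(2)[OF i, of 0] by linarith
  qed simp
  obtain R where R: "0 < R" "(2 * B + e) * (real (card I) * (V / R\<^sup>2)) \<le> r / 8"
  proof -
    define W where "W = (2 * B + e) * (real (card I) * V)"
    have W0: "0 \<le> W" using V0 B0 e by (auto simp: W_def)
    let ?R = "sqrt (8 * (W + 1) / r)"
    have "0 < ?R" using r W0 by simp
    moreover have "W / ?R\<^sup>2 \<le> r / 8" using r W0 by (simp add: field_simps)
    ultimately show thesis using that[of ?R] by (simp add: W_def)
  qed
  \<comment> \<open>This maps the interval from \<open>- R\<close> to \<open>R\<close> onto the
    branch of the sine that \<open>arcsin\<close> inverts.\<close>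
  define c where "c = pi / (2 * R)"
  define H where "H s = h (\<lambda>i. arcsin (s i) / c)" for s :: "'i \<Rightarrow> real"
  have c: "0 < c" using R by (simp add: c_def)
  have "continuous_on {s. \<forall>i. s i \<in> {-1..1}} H"
    unfolding H_def
  proof (rule continuous_on_compose2[OF h(1)])
    show "continuous_on {s. \<forall>i. s i \<in> {-1..1}} (\<lambda>s (i::'i). arcsin (s i) / c)"
      by (intro continuous_on_coordinatewise_then_product continuous_intros
          continuous_on_subset[OF continuous_on_product_coordinates]) (use c in auto)
  qed auto
  then obtain p where p: "admissible (\<lambda>w. p (\<lambda>i. sin (c * w i)))"
      "\<And>w. \<bar>H (\<lambda>i. sin (c * w i)) - p (\<lambda>i. sin (c * w i))\<bar> < e"
    using sin_polynomial_approx e(1) by blast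
  define g where "g w = p (\<lambda>i. sin (c * w i))" for w :: "'i \<Rightarrow> real"
  have gc: "continuous_on UNIV g" using p(1) by (simp add: admissible_def g_def[abs_def])
  have gB: "\<bar>g w\<bar> \<le> B + e" for w
    using p(2)[of w] h(2)[of "\<lambda>i. arcsin (sin (c * w i)) / c"] unfolding g_def H_def by linarith
  have hg: "\<bar>h w - g w\<bar> \<le> e" if w: "\<And>i. i \<in> I \<Longrightarrow> \<bar>w i\<bar> \<le> R" for w
  proof -
    have "arcsin (sin (c * w i)) / c = w i" if "i \<in> I" for i
    proof -
      have "\<bar>c * w i\<bar> \<le> c * R" using w[OF that] c by (simp add: abs_mult)
      also have "c * R = pi / 2" using R by (simp add: c_def)
      finally show ?thesis using c by (subst arcsin_sin) (auto simp: abs_le_iff)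
    qed
    then have "H (\<lambda>i. sin (c * w i)) = h w" unfolding H_def by (intro I(2)) auto
    then show ?thesis using p(2)[of w] by (simp add: g_def)
  qed
  have mx: "(\<lambda>\<omega>. f (x n \<omega>)) \<in> borel_measurable M" if "continuous_on UNIV f" for f :: "('i \<Rightarrow> real) \<Rightarrow> real" and n
    by (rule measurable_continuous_sequence[OF x that])
  have my: "(\<lambda>\<omega>. f (y \<omega>)) \<in> borel_measurable N" if "continuous_on UNIV f" for f :: "('i \<Rightarrow> real) \<Rightarrow> real"
    by (rule measurable_continuous_sequence[OF y that])
  have X: "\<bar>(\<integral>\<omega>. h (x n \<omega>) \<partial>M) - (\<integral>\<omega>. g (x n \<omega>) \<partial>M)\<bar> \<le> r / 4" for n
  proof -
    have "\<bar>(\<integral>\<omega>. h (x n \<omega>) \<partial>M) - (\<integral>\<omega>. g (x n \<omega>) \<partial>M)\<bar> \<le> e + (2 * B + e) * (real (card I) * (V / R\<^sup>2))"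
    proof (rule M.expectation_truncation[where x = "x n"])
      show "\<bar>h (x n \<omega>)\<bar> \<le> B" "\<bar>g (x n \<omega>)\<bar> \<le> B + e" for \<omega> by (rule h(2) gB)+
      show "\<bar>h (x n \<omega>) - g (x n \<omega>)\<bar> \<le> e" if "\<And>i. i \<in> I \<Longrightarrow> \<bar>x n \<omega> i\<bar> \<le> R" for \<omega>
        by (rule hg[OF that])
    qed (use I(1) x y xV yV R(1) e mx[OF h(1)] my[OF h(1)] mx[OF gc] my[OF gc] in auto)
    then show ?thesis using e R(2) by linarith
  qed
  have Y: "\<bar>(\<integral>\<omega>. h (y \<omega>) \<partial>N) - (\<integral>\<omega>. g (y \<omega>) \<partial>N)\<bar> \<le> r / 4"
  proof -
    have "\<bar>(\<integral>\<omega>. h (y \<omega>) \<partial>N) - (\<integral>\<omega>. g (y \<omega>) \<partial>N)\<bar> \<le> e + (2 * B + e) * (real (card I) * (V / R\<^sup>2))"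
    proof (rule N.expectation_truncation[where x = "y"])
      show "\<bar>h (y \<omega>)\<bar> \<le> B" "\<bar>g (y \<omega>)\<bar> \<le> B + e" for \<omega> by (rule h(2) gB)+
      show "\<bar>h (y \<omega>) - g (y \<omega>)\<bar> \<le> e" if "\<And>i. i \<in> I \<Longrightarrow> \<bar>y \<omega> i\<bar> \<le> R" for \<omega>
        by (rule hg[OF that])
    qed (use I(1) x y xV yV R(1) e mx[OF h(1)] my[OF h(1)] mx[OF gc] my[OF gc] in auto)
    then show ?thesis using e R(2) by linarith
  qed
  have "mean_converges g" using admissible_mean_converges[OF p(1)] by (simp add: g_def[abs_def])
  then obtain n0 where n0: "\<And>n. n \<ge> n0 \<Longrightarrow> \<bar>(\<integral>\<omega>. g (x n \<omega>) \<partial>M) - (\<integral>\<omega>. g (y \<omega>) \<partial>N)\<bar> < r / 4"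
    using LIMSEQ_D[of _ _ "r / 4"] r unfolding mean_converges_def by fastforce
  have "\<bar>(\<integral>\<omega>. h (x n \<omega>) \<partial>M) - (\<integral>\<omega>. h (y \<omega>) \<partial>N)\<bar> < r" if "n \<ge> n0" for n
    using X[of n] Y n0[OF that] r by linarith
  then show "\<exists>n0. \<forall>n\<ge>n0. norm ((\<integral>\<omega>. h (x n \<omega>) \<partial>M) - (\<integral>\<omega>. h (y \<omega>) \<partial>N)) < r" by auto
qed


section \<open>Second moments and characteristic functions of the weighted process\<close>

lemma (in prob_space) indep_sum_second_moment:
  fixes Y :: "nat \<Rightarrow> 'a \<Rightarrow> real"
  assumes indep: "indep_vars (\<lambda>_. borel) Y UNIV"
    and b: "\<And>i x. \<bar>Y i x\<bar> \<le> b"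
    and mean: "\<And>i. expectation (Y i) = 0"
    and v: "\<And>i. expectation (\<lambda>x. (Y i x)\<^sup>2) = v"
  shows "integrable M (\<lambda>x. (\<Sum>i<n. Y i x)\<^sup>2)" "expectation (\<lambda>x. (\<Sum>i<n. Y i x)\<^sup>2) = real n * v"
proof -
  have m [measurable]: "Y i \<in> borel_measurable M" for i
    using indep by (auto simp: indep_vars_def2)
  have Sb: "\<bar>\<Sum>i<n. Y i x\<bar> \<le> real n * b" for n x
  proof -
    have "\<bar>\<Sum>i<n. Y i x\<bar> \<le> (\<Sum>i<n. \<bar>Y i x\<bar>)" by (rule sum_abs)
    also have "\<dots> \<le> (\<Sum>i<n. b)" by (intro sum_mono b)
    finally show ?thesis by simp
  qed
  have iS: "integrable M (\<lambda>x. \<Sum>i<n. Y i x)" for n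
    by (rule integrable_const_bound[where B="real n * b"]) (auto simp: Sb)
  have iS2: "integrable M (\<lambda>x. (\<Sum>i<n. Y i x)\<^sup>2)" for n
  proof (rule integrable_const_bound[where B="(real n * b)\<^sup>2"])
    show "AE x in M. norm ((\<Sum>i<n. Y i x)\<^sup>2) \<le> (real n * b)\<^sup>2"
      using Sb[of _ n] by (auto intro!: AE_I2 simp: abs_le_square_iff[symmetric] intro: order_trans[OF _ abs_ge_self])
  qed measurable
  have iY: "integrable M (Y i)" for i by (rule integrable_const_bound[where B=b]) (auto simp: b)
  have iY2: "integrable M (\<lambda>x. (Y i x)\<^sup>2)" for i
  proof (rule integrable_const_bound[where B="b\<^sup>2"])
    show "AE x in M. norm ((Y i x)\<^sup>2) \<le> b\<^sup>2"
      using b[of i] by (auto intro!: AE_I2 simp: abs_le_square_iff[symmetric] intro: order_trans[OF _ abs_ge_self])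
  qed measurable
  show "integrable M (\<lambda>x. (\<Sum>i<n. Y i x)\<^sup>2)" by (rule iS2)
  show "expectation (\<lambda>x. (\<Sum>i<n. Y i x)\<^sup>2) = real n * v"
  proof (induction n)
    case (Suc n)
    have ind: "indep_var borel (Y n) borel (\<lambda>x. \<Sum>i<n. Y i x)"
      by (rule indep_vars_sum) (auto intro: indep_vars_subset[OF indep])
    have ip: "integrable M (\<lambda>x. Y n x * (\<Sum>i<n. Y i x))" by (rule indep_var_integrable[OF ind iY iS])
    have "expectation (\<lambda>x. Y n x * (\<Sum>i<n. Y i x)) = 0"
      using indep_var_lebesgue_integral[OF ind iY iS] mean by simp
    moreover have "(\<Sum>i<Suc n. Y i x)\<^sup>2 = (\<Sum>i<n. Y i x)\<^sup>2 + 2 * (Y n x * (\<Sum>i<n. Y i x)) + (Y n x)\<^sup>2" for x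
      by (simp add: power2_sum)
    ultimately show ?case using ip iS2[of n] iY2[of n] Suc.IH v by (simp add: algebra_simps)
  qed simp
qed

context copula_sample
begin

text \<open>An inequality rather than an equality, because the process is 0 for n = 0.\<close>

lemma wemp_second_moment:
  "integrable M (\<lambda>x. (wemp n x t)\<^sup>2)" "(\<integral>x. (wemp n x t)\<^sup>2 \<partial>M) \<le> wcov t t"
proof -
  have ind: "M.indep_vars (\<lambda>_. borel) (\<lambda>i x. wfun t (Z i x)) UNIV"
    by (rule M.indep_vars_compose2[OF indep]) auto
  have v: "(\<integral>x. (wfun t (Z i x))\<^sup>2 \<partial>M) = wcov t t" for i
    using integral_Z[of "\<lambda>z. (wfun t z)\<^sup>2" i] integral_wfun(2)[of t t] by (simp add: power2_eq_square)
  have m: "(\<integral>x. wfun t (Z i x) \<partial>M) = 0" for i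
    using integral_Z[of "wfun t" i] integral_wfun(1) by simp
  note s = M.indep_sum_second_moment[OF ind wfun_bound m v]
  have e: "(wemp n x t)\<^sup>2 = (1 / real n) * (\<Sum>i<n. wfun t (Z i x))\<^sup>2" for x
    by (simp add: wemp_def power_mult_distrib power_divide)
  show "integrable M (\<lambda>x. (wemp n x t)\<^sup>2)" unfolding e using s(1) by simp
  have "0 \<le> wcov t t" unfolding integral_wfun(2)[symmetric] by (rule integral_nonneg_AE) auto
  then show "(\<integral>x. (wemp n x t)\<^sup>2 \<partial>M) \<le> wcov t t"
    unfolding e using s(2) by simp
qed

text \<open>A linear combination of values of the process is a normalised sum of independent copies
  of \<open>g\<close>, so the one-dimensional central limit theorem applies. That theorem requires
  positive variance; if v = 0, then \<open>g\<close> vanishes almost surely along the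
  sample.\<close>

lemma wemp_cf:
  fixes a :: "'i \<Rightarrow> real" and p :: "'i \<Rightarrow> real \<times> real"
  assumes S: "finite S"
  defines "v \<equiv> \<Sum>s\<in>S. \<Sum>t\<in>S. a s * a t * wcov (p s) (p t)"
  shows "(\<lambda>n. \<integral>x. iexp (\<Sum>t\<in>S. a t * wemp n x (p t)) \<partial>M) \<longlonglongrightarrow> complex_of_real (exp (- v / 2))"
proof -
  define g where "g z = (\<Sum>t\<in>S. a t * wfun (p t) z)" for z
  have g [measurable]: "g \<in> borel_measurable borel" unfolding g_def by measurable
  have gv: "integrable P (\<lambda>z. (g z)\<^sup>2)" "(\<integral>z. (g z)\<^sup>2 \<partial>P) = v"
    using wcov_sum[OF S] by (simp_all add: g_def v_def)
  have v0: "0 \<le> v" unfolding gv(2)[symmetric] by (rule integral_nonneg_AE) auto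
  have gm: "(\<integral>z. g z \<partial>P) = 0" unfolding g_def using integrable_wfun integral_wfun by simp
  have e: "(\<Sum>t\<in>S. a t * wemp n x (p t)) = (\<Sum>i<n. g (Z i x)) / sqrt n" for n x
    unfolding g_def wemp_def by (subst sum.swap) (simp add: sum_distrib_left sum_divide_distrib mult_ac)
  show ?thesis
  proof (cases "v = 0")
    case True
    have "AE z in P. (g z)\<^sup>2 = 0"
      using gv True by (subst integral_nonneg_eq_0_iff_AE[symmetric]) auto
    then have g0: "AE z in P. g z = 0" by simp
    have "AE x in M. g (Z i x) = 0" for i
      using g0[folded law[of i]] by (rule AE_distrD[rotated]) simp
    then have "AE x in M. \<forall>i. g (Z i x) = 0" by (simp add: AE_all_countable)
    then have "(\<integral>x. iexp (\<Sum>t\<in>S. a t * wemp n x (p t)) \<partial>M) = (\<integral>x. 1 \<partial>M)" for n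
      unfolding e by (intro integral_cong_AE) (auto elim!: eventually_mono)
    then show ?thesis using True by (simp add: M.prob_space)
  next
    case False
    define \<sigma> where "\<sigma> = sqrt v"
    have \<sigma>: "0 < \<sigma>" "\<sigma>\<^sup>2 = v" using False v0 by (auto simp: \<sigma>_def)
    have ind: "M.indep_vars (\<lambda>_. borel) (\<lambda>i x. g (Z i x)) UNIV"
      by (rule M.indep_vars_compose2[OF indep]) auto
    have mean: "(\<integral>x. g (Z i x) \<partial>M) = 0" for i using integral_Z[OF g, of i] gm by simp
    have g2: "(\<lambda>z. (g z)\<^sup>2) \<in> borel_measurable borel" by measurable
    have w: "weak_conv_m (\<lambda>n. distr M borel (\<lambda>x. (\<Sum>i<n. g (Z i x)) / sqrt (n * \<sigma>\<^sup>2))) std_normal_distribution"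
    proof (rule M.central_limit_theorem_zero_mean[OF ind mean \<sigma>(1)])
      show i: "integrable M (\<lambda>x. (g (Z n x))\<^sup>2)" for n
        using gv(1) g2 integrable_distr_eq[of "Z n" M borel "\<lambda>z. (g z)\<^sup>2"] by (simp add: law)
      show "M.variance (\<lambda>x. g (Z n x)) = \<sigma>\<^sup>2" for n
        using mean[of n] integral_Z[OF g2, of n] gv(2) \<sigma>(2) by simp
      show "distr M borel (\<lambda>x. g (Z n x)) = distr P borel g" for n
        unfolding law[of n, symmetric] by (subst distr_distr) (auto simp: comp_def)
    qed
    \<comment> \<open>Evaluating at \<sigma> undoes the division by \<sigma> in the normalised
      sum.\<close>
    have "(\<lambda>n. char (distr M borel (\<lambda>x. (\<Sum>i<n. g (Z i x)) / sqrt (n * \<sigma>\<^sup>2))) \<sigma>) \<longlonglongrightarrow> char std_normal_distribution \<sigma>"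
      by (rule levy_continuity1[OF _ real_dist_normal_dist w]) (auto intro!: M.real_distribution_distr)
    moreover have "char (distr M borel (\<lambda>x. (\<Sum>i<n. g (Z i x)) / sqrt (n * \<sigma>\<^sup>2))) \<sigma> = (\<integral>x. iexp (\<Sum>t\<in>S. a t * wemp n x (p t)) \<partial>M)" for n
    proof -
      have "\<sigma> * (s / sqrt (n * \<sigma>\<^sup>2)) = s / sqrt n" for s :: real
        using \<sigma>(1) by (simp add: real_sqrt_mult)
      then show ?thesis unfolding char_def e
        by (subst integral_distr) auto
    qed
    ultimately show ?thesis using \<sigma> by (simp add: char_std_normal_distribution)
  qed
qed

end

section \<open>Compact sets of bounded functions\<close>


lemma mspace_linf_square: "x \<in> mspace linf_square \<longleftrightarrow> x \<in> extensional unit_square \<and> bounded (x ` unit_square)"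
  by (auto simp: linf_square_def Met_TC.fspace_def mbounded_iff_bounded)

lemma mdist_linf_square_le:
  assumes "x \<in> mspace linf_square" "y \<in> mspace linf_square"
  shows "mdist linf_square x y \<le> a \<longleftrightarrow> (\<forall>t\<in>unit_square. \<bar>x t - y t\<bar> \<le> a)"
proof -
  have "unit_square \<noteq> {}" by (auto intro: exI[of _ "0::real"])
  then show ?thesis
    using funspace_mdist_le[of x unit_square euclidean_metric y a] assms
    unfolding linf_square_def by (simp add: dist_real_def)
qed

lemma mspace_linf_squareI:
  assumes "\<And>t. t \<in> unit_square \<Longrightarrow> \<bar>x t\<bar> \<le> B"
  shows "restrict x unit_square \<in> mspace linf_square"
  unfolding mspace_linf_square bounded_iff using assms by auto

text \<open>Arzela-Ascoli on the closed square. The bound and the moduli pass to pointwise limits;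
  the limit is restricted to the square because the elements of \<open>linf_square\<close> are
  extensional.\<close>

lemma compactin_equicontinuous:
  fixes e :: "nat \<Rightarrow> real"
  assumes e: "e \<longlonglongrightarrow> 0"
  shows "compactin (mtopology_of linf_square) {x \<in> mspace linf_square. (\<forall>t\<in>unit_square. \<bar>x t\<bar> \<le> B) \<and>
    (\<forall>m. \<forall>s\<in>unit_square. \<forall>t\<in>unit_square. \<bar>fst s - fst t\<bar> \<le> 1/2^m \<and> \<bar>snd s - snd t\<bar> \<le> 1/2^m \<longrightarrow> \<bar>x s - x t\<bar> \<le> e m)}"
    (is "compactin _ ?K")
proof -
  interpret L: Metric_space "mspace linf_square" "mdist linf_square" by auto
  show ?thesis
    unfolding mtopology_of_def L.compactin_sequentially
  proof (intro conjI allI impI)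
    fix \<sigma> :: "nat \<Rightarrow> real \<times> real \<Rightarrow> real" assume "range \<sigma> \<subseteq> ?K"
    then have \<sigma>: "\<sigma> n \<in> ?K" for n by blast
    have \<sigma>1: "\<bar>\<sigma> n t\<bar> \<le> B" if "t \<in> unit_square" for n t using \<sigma>[of n] that by blast
    have \<sigma>2: "\<bar>\<sigma> n s - \<sigma> n t\<bar> \<le> e m" if "s \<in> unit_square" "t \<in> unit_square"
      "\<bar>fst s - fst t\<bar> \<le> 1/2^m" "\<bar>snd s - snd t\<bar> \<le> 1/2^m" for n s t m using \<sigma>[of n] that by blast
    obtain g and k :: "nat \<Rightarrow> nat" where gk: "continuous_on unit_square g" "strict_mono k"
      "\<And>r. 0 < r \<Longrightarrow> \<exists>N. \<forall>n x. n \<ge> N \<and> x \<in> unit_square \<longrightarrow> norm (\<sigma> (k n) x - g x) < r"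
    proof (rule Arzela_Ascoli[of unit_square \<sigma> B])
      show "compact unit_square" by (intro compact_Times) auto
      show "norm (\<sigma> n x) \<le> B" if "x \<in> unit_square" for n x using \<sigma>1[OF that] by simp
      show "\<exists>d>0. \<forall>n y. y \<in> unit_square \<and> norm (x - y) < d \<longrightarrow> norm (\<sigma> n x - \<sigma> n y) < r"
        if x: "x \<in> unit_square" and r: "0 < r" for x r
      proof -
        have "\<forall>\<^sub>F m in sequentially. e m < r" using e r by (rule order_tendstoD)
        then obtain m where m: "e m < r" by (auto simp: eventually_sequentially)
        have "norm (\<sigma> n x - \<sigma> n y) < r" if y: "y \<in> unit_square" "norm (x - y) < 1 / 2 ^ m" for n y
        proof -
          have "\<bar>fst x - fst y\<bar> \<le> norm (x - y)" "\<bar>snd x - snd y\<bar> \<le> norm (x - y)"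
            using norm_fst_le[of "x - y"] norm_snd_le[of "x - y"] by (auto simp: norm_prod_def)
          then have "\<bar>\<sigma> n x - \<sigma> n y\<bar> \<le> e m" using x y by (intro \<sigma>2) auto
          then show ?thesis using m by simp
        qed
        then show ?thesis by (intro exI[of _ "1 / 2 ^ m"]) auto
      qed
    qed blast
    have lim: "(\<lambda>n. \<sigma> (k n) x) \<longlonglongrightarrow> g x" if "x \<in> unit_square" for x
      using gk(3) that by (intro LIMSEQ_I) blast
    define l where "l = restrict g unit_square"
    have gB: "\<bar>g t\<bar> \<le> B" if "t \<in> unit_square" for t
      by (rule Lim_bounded[OF tendsto_rabs[OF lim[OF that]], of 0]) (use \<sigma>1[OF that] in simp)
    have ge: "\<bar>g s - g t\<bar> \<le> e m" if st: "s \<in> unit_square" "t \<in> unit_square"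
      "\<bar>fst s - fst t\<bar> \<le> 1/2^m" "\<bar>snd s - snd t\<bar> \<le> 1/2^m" for s t m
      by (rule Lim_bounded[OF tendsto_rabs[OF tendsto_diff[OF lim[OF st(1)] lim[OF st(2)]]], of 0]) (use \<sigma>2[OF st] in simp)
    have lm: "l \<in> mspace linf_square" unfolding l_def using gB by (rule mspace_linf_squareI)
    have lK: "l \<in> ?K" using lm gB ge by (auto simp: l_def)
    have sm: "\<sigma> n \<in> mspace linf_square" for n using \<sigma>[of n] by simp
    have "limitin L.mtopology (\<sigma> \<circ> k) l sequentially"
      unfolding L.limit_metric_sequentially
    proof (intro conjI allI impI lm)
      fix r :: real assume r: "0 < r"
      obtain N where N: "\<And>n x. n \<ge> N \<Longrightarrow> x \<in> unit_square \<Longrightarrow> norm (\<sigma> (k n) x - g x) < r/2"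
        using gk(3)[OF half_gt_zero[OF r]] by blast
      have "mdist linf_square (\<sigma> (k n)) l < r" if "n \<ge> N" for n
      proof -
        have "mdist linf_square (\<sigma> (k n)) l \<le> r/2"
          unfolding mdist_linf_square_le[OF sm lm] using N[OF that] by (auto simp: l_def less_imp_le)
        then show ?thesis using r by linarith
      qed
      then show "\<exists>N. \<forall>n\<ge>N. (\<sigma> \<circ> k) n \<in> mspace linf_square \<and> mdist linf_square ((\<sigma> \<circ> k) n) l < r"
        using sm by auto
    qed
    then show "\<exists>l r. l \<in> ?K \<and> strict_mono r \<and> limitin L.mtopology (\<sigma> \<circ> r) l sequentially"
      using lK gk(2) by blast
  qed auto
qed

section \<open>Centered normal variables\<close>


lemma normal_law_eq_distr:
  assumes "0 \<le> \<sigma>"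
  shows "normal_law 0 \<sigma> = distr std_normal_distribution borel (\<lambda>x. \<sigma> * x)"
proof (cases "\<sigma> = 0")
  case True
  interpret real_distribution std_normal_distribution by (rule real_dist_normal_dist)
  show ?thesis using True by (simp add: normal_law_def distr_const)
next
  case False
  interpret real_distribution std_normal_distribution by (rule real_dist_normal_dist)
  have "distributed std_normal_distribution lborel (\<lambda>x. x) std_normal_density"
    unfolding distributed_def by (auto simp: distr_id2)
  then have "distributed std_normal_distribution lborel (\<lambda>x. 0 + \<sigma> * x) (normal_density (0 + \<sigma> * 0) (\<bar>\<sigma>\<bar> * 1))"
    using False by (intro normal_density_affine) auto
  then have "distr std_normal_distribution lborel (\<lambda>x. \<sigma> * x) = density lborel (normal_density 0 \<sigma>)"
    using assms unfolding distributed_def by simp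
  moreover have "distr std_normal_distribution lborel (\<lambda>x. \<sigma> * x) = distr std_normal_distribution borel (\<lambda>x. \<sigma> * x)"
    by (rule distr_cong) auto
  ultimately show ?thesis using False by (simp add: normal_law_def)
qed

lemma nn_integral_exp_std_normal:
  "(\<integral>\<^sup>+x. ennreal (exp (a * x)) \<partial>std_normal_distribution) = ennreal (exp (a\<^sup>2 / 2))"
proof -
  have "std_normal_density x * exp (a * x) = exp (a\<^sup>2 / 2) * normal_density a 1 x" for x
    by (simp add: normal_density_def field_simps power2_eq_square flip: exp_add)
  then have "(\<integral>\<^sup>+x. ennreal (exp (a * x)) \<partial>std_normal_distribution) =
      (\<integral>\<^sup>+x. ennreal (exp (a\<^sup>2 / 2)) * ennreal (normal_density a 1 x) \<partial>lborel)"
    by (subst nn_integral_density) (auto simp flip: ennreal_mult)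
  also have "\<dots> = ennreal (exp (a\<^sup>2 / 2)) * (\<integral>\<^sup>+x. ennreal (normal_density a 1 x) \<partial>lborel)"
    by (rule nn_integral_cmult) auto
  also have "(\<integral>\<^sup>+x. ennreal (normal_density a 1 x) \<partial>lborel) = 1"
    by (subst nn_integral_eq_integral) auto
  finally show ?thesis by simp
qed

text \<open>Prescribing the characteristic function includes the degenerate case and lets limits be
  taken without densities.\<close>

definition (in prob_space) centered_normal :: "('a \<Rightarrow> real) \<Rightarrow> real \<Rightarrow> bool" where
  "centered_normal X v \<longleftrightarrow> X \<in> borel_measurable M \<and> 0 \<le> v \<and>
     (\<forall>t. (\<integral>x. iexp (t * X x) \<partial>M) = complex_of_real (exp (- v * t\<^sup>2 / 2)))"

context prob_space
begin

lemma centered_normal_law: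
  assumes X: "centered_normal X v"
  shows "distr M borel X = normal_law 0 (sqrt v)"
proof -
  interpret S: real_distribution std_normal_distribution by (rule real_dist_normal_dist)
  have v: "0 \<le> v" and m [measurable]: "X \<in> borel_measurable M" using X by (auto simp: centered_normal_def)
  have d: "real_distribution (distr M borel X)"
    "real_distribution (distr std_normal_distribution borel (\<lambda>x. sqrt v * x))"
    by (rule real_distribution_distr[OF m] S.real_distribution_distr, simp)+
  have "char (distr M borel X) t = char (distr std_normal_distribution borel (\<lambda>x. sqrt v * x)) t" for t
  proof -
    have "char (distr M borel X) t = complex_of_real (exp (- v * t\<^sup>2 / 2))"
      using X unfolding centered_normal_def char_def by (subst integral_distr) auto
    moreover have "char (distr std_normal_distribution borel (\<lambda>x. sqrt v * x)) t = char std_normal_distribution (t * sqrt v)"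
      unfolding char_def by (subst integral_distr) (auto simp: mult.assoc)
    ultimately show ?thesis using v by (simp add: char_std_normal_distribution power_mult_distrib mult.commute)
  qed
  then show ?thesis
    using Levy_uniqueness[OF d] v by (simp add: normal_law_eq_distr fun_eq_iff)
qed

lemma centered_normal_exp_moment:
  assumes X: "centered_normal X v"
  shows "(\<integral>\<^sup>+x. ennreal (exp (a * X x)) \<partial>M) = ennreal (exp (a\<^sup>2 * v / 2))"
proof -
  have v: "0 \<le> v" and m [measurable]: "X \<in> borel_measurable M" using X by (auto simp: centered_normal_def)
  have "(\<integral>\<^sup>+x. ennreal (exp (a * X x)) \<partial>M) = (\<integral>\<^sup>+y. ennreal (exp (a * y)) \<partial>distr M borel X)"
    by (subst nn_integral_distr) auto
  also have "\<dots> = (\<integral>\<^sup>+y. ennreal (exp ((a * sqrt v) * y)) \<partial>std_normal_distribution)"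
    unfolding centered_normal_law[OF X] using v
    by (subst normal_law_eq_distr) (auto simp: nn_integral_distr mult.assoc)
  also have "\<dots> = ennreal (exp (a\<^sup>2 * v / 2))"
    unfolding nn_integral_exp_std_normal using v by (simp add: power_mult_distrib)
  finally show ?thesis .
qed

lemma centered_normal_moments:
  assumes X: "centered_normal X v"
  shows "integrable M X" "expectation X = 0" "integrable M (\<lambda>x. (X x)\<^sup>2)" "expectation (\<lambda>x. (X x)\<^sup>2) = v"
proof -
  have v: "0 \<le> v" and m [measurable]: "X \<in> borel_measurable M" using X by (auto simp: centered_normal_def)
  have law: "distr M borel X = distr std_normal_distribution borel (\<lambda>x. sqrt v * x)"
    unfolding centered_normal_law[OF X] using v by (simp add: normal_law_eq_distr)
  have g: "integrable M (\<lambda>x. g (X x)) = integrable std_normal_distribution (\<lambda>x. g (sqrt v * x))"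
    "(\<integral>x. g (X x) \<partial>M) = (\<integral>x. g (sqrt v * x) \<partial>std_normal_distribution)"
    if [measurable]: "g \<in> borel_measurable borel" for g :: "real \<Rightarrow> real"
  proof -
    have "integrable M (\<lambda>x. g (X x)) = integrable (distr M borel X) g"
      by (rule integrable_distr_eq[symmetric]) auto
    also have "\<dots> = integrable std_normal_distribution (\<lambda>x. g (sqrt v * x))"
      unfolding law by (rule integrable_distr_eq) auto
    finally show "integrable M (\<lambda>x. g (X x)) = integrable std_normal_distribution (\<lambda>x. g (sqrt v * x))" .
    have "(\<integral>x. g (X x) \<partial>M) = (\<integral>y. g y \<partial>distr M borel X)" by (rule integral_distr[symmetric]) auto
    also have "\<dots> = (\<integral>x. g (sqrt v * x) \<partial>std_normal_distribution)" unfolding law by (rule integral_distr) auto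
    finally show "(\<integral>x. g (X x) \<partial>M) = (\<integral>x. g (sqrt v * x) \<partial>std_normal_distribution)" .
  qed
  have i1: "integrable std_normal_distribution (\<lambda>x. x)" "(\<integral>x. x \<partial>std_normal_distribution) = 0"
    using integrable_std_normal_distribution_moment[of 1] integral_std_normal_distribution_moment_odd[of 1] by auto
  have i2: "integrable std_normal_distribution (\<lambda>x. x\<^sup>2)" "(\<integral>x. x\<^sup>2 \<partial>std_normal_distribution) = 1"
    using std_normal_distribution_even_moments[of 1] by auto
  have m1: "(\<lambda>x::real. x) \<in> borel_measurable borel" "(\<lambda>x::real. x\<^sup>2) \<in> borel_measurable borel" by measurable
  show "integrable M X" using g(1)[OF m1(1)] i1(1) by simp
  show "expectation X = 0" using g(2)[OF m1(1)] i1(2) by simp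
  show "integrable M (\<lambda>x. (X x)\<^sup>2)" using g(1)[OF m1(2)] i2(1) by (simp add: power_mult_distrib)
  show "expectation (\<lambda>x. (X x)\<^sup>2) = v" using g(2)[OF m1(2)] i2 v by (simp add: power_mult_distrib)
qed

end

section \<open>Gram--Schmidt coefficients\<close>

context prob_space
begin

text \<open>The residual of \<open>f i\<close> after projecting away the first \<open>n\<close>
  pivots. For a null pivot the quotient is 0 by the convention on division by zero, so that pivot is
  skipped.\<close>

primrec gs_residual :: "(nat \<Rightarrow> 'a \<Rightarrow> real) \<Rightarrow> nat \<Rightarrow> nat \<Rightarrow> 'a \<Rightarrow> real" where
  "gs_residual f 0 = f"
| "gs_residual f (Suc n) = (\<lambda>i x. gs_residual f n i x -
     expectation (\<lambda>x. gs_residual f n i x * gs_residual f n n x) /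
     expectation (\<lambda>x. gs_residual f n n x * gs_residual f n n x) * gs_residual f n n x)"

text \<open>Column \<open>n\<close> of the Cholesky factor of the Gram matrix of \<open>f\<close>; a
  null pivot contributes a zero column.\<close>

definition gs_coeff :: "(nat \<Rightarrow> 'a \<Rightarrow> real) \<Rightarrow> nat \<Rightarrow> nat \<Rightarrow> real" where
  "gs_coeff f i n = expectation (\<lambda>x. gs_residual f n i x * gs_residual f n n x) /
     sqrt (expectation (\<lambda>x. gs_residual f n n x * gs_residual f n n x))"

context
  fixes f :: "nat \<Rightarrow> 'a \<Rightarrow> real"
  assumes f: "\<And>i. f i \<in> borel_measurable M" and b: "\<And>i. \<exists>B. \<forall>x. \<bar>f i x\<bar> \<le> B"
begin

abbreviation "R \<equiv> gs_residual f"
abbreviation "ip g h \<equiv> expectation (\<lambda>x. g x * h x)"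

lemma gs_bounded: "R n i \<in> borel_measurable M \<and> (\<exists>B. \<forall>x. \<bar>R n i x\<bar> \<le> B)"
proof (induction n arbitrary: i)
  case (Suc n)
  obtain B C where B: "\<And>x. \<bar>R n i x\<bar> \<le> B" and C: "\<And>x. \<bar>R n n x\<bar> \<le> C" using Suc by blast
  note [measurable] = Suc[THEN conjunct1]
  let ?c = "ip (R n i) (R n n) / ip (R n n) (R n n)"
  have "\<bar>R (Suc n) i x\<bar> \<le> B + \<bar>?c\<bar> * C" for x
  proof -
    have "\<bar>?c * R n n x\<bar> \<le> \<bar>?c\<bar> * C" unfolding abs_mult by (intro mult_left_mono C) auto
    then show ?thesis using B[of x] unfolding gs_residual.simps by linarith
  qed
  moreover have "R (Suc n) i \<in> borel_measurable M" by simp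
  ultimately show ?case by blast
qed (use f b in auto)

lemma gs_integrable: "integrable M (\<lambda>x. R n i x * R m j x)"
proof -
  obtain B C where B: "\<And>x. \<bar>R n i x\<bar> \<le> B" and C: "\<And>x. \<bar>R m j x\<bar> \<le> C" using gs_bounded by metis
  have "\<bar>R n i x * R m j x\<bar> \<le> B * C" for x
    unfolding abs_mult using B[of x] C[of x] by (intro mult_mono) auto
  moreover note [measurable] = gs_bounded[THEN conjunct1]
  ultimately show ?thesis by (intro integrable_const_bound[where B="B * C"]) auto
qed

lemma gs_null: "ip (R n i) (R n i) = 0 \<Longrightarrow> AE x in M. R n i x = 0"
proof -
  assume "ip (R n i) (R n i) = 0"
  then have "AE x in M. R n i x * R n i x = 0"
    using integral_nonneg_eq_0_iff_AE[OF gs_integrable] by simp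
  then show ?thesis by simp
qed

lemma ip_null: "AE x in M. R n i x = 0 \<Longrightarrow> ip (R n i) (R n j) = 0"
  by (rule integral_eq_zero_AE) (auto elim: eventually_mono)

text \<open>Step \<open>n\<close> removes its own pivot: if the pivot has positive norm its
  projection coefficient is 1, and otherwise it is already null. Null residuals stay null.\<close>

lemma gs_vanish: "i < n \<Longrightarrow> AE x in M. R n i x = 0"
proof (induction n)
  case (Suc n)
  show ?case
  proof (cases "i < n")
    case True
    have z: "AE x in M. R n i x = 0" by (rule Suc.IH[OF True])
    have "ip (R n i) (R n n) = 0" by (rule ip_null[OF z])
    then show ?thesis using z by simp
  next
    case False
    then have i: "i = n" using Suc.prems by simp
    show ?thesis
    proof (cases "ip (R n n) (R n n) = 0")
      case True
      then show ?thesis using gs_null[OF True] by (simp add: i)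
    next
      case False
      then show ?thesis by (simp add: i)
    qed
  qed
qed simp

text \<open>One elimination step lowers the Gram matrix by a rank one term. For a null pivot that
  term is 0 and the residuals do not change.\<close>

lemma gs_step: "ip (R n i) (R n j) = gs_coeff f i n * gs_coeff f j n + ip (R (Suc n) i) (R (Suc n) j)"
proof -
  let ?q = "ip (R n n) (R n n)" and ?a = "ip (R n i) (R n n)" and ?b = "ip (R n j) (R n n)"
  have q0: "0 \<le> ?q" by (rule integral_nonneg_AE) auto
  have "R (Suc n) i x * R (Suc n) j x = R n i x * R n j x - ?b / ?q * (R n i x * R n n x)
      - ?a / ?q * (R n j x * R n n x) + ?a / ?q * (?b / ?q) * (R n n x * R n n x)" for x
    by (simp add: algebra_simps)
  then have "ip (R (Suc n) i) (R (Suc n) j) = ip (R n i) (R n j) - ?b / ?q * ?a - ?a / ?q * ?b + ?a / ?q * (?b / ?q) * ?q"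
    using gs_integrable by (simp del: gs_residual.simps)
  also have "\<dots> = ip (R n i) (R n j) - ?a * ?b / ?q"
    by (cases "?q = 0") (auto simp: field_simps)
  also have "?a * ?b / ?q = gs_coeff f i n * gs_coeff f j n"
    using q0 by (simp add: gs_coeff_def)
  finally show ?thesis by simp
qed

lemma gs_coeff_upper: "i < n \<Longrightarrow> gs_coeff f i n = 0"
  unfolding gs_coeff_def using ip_null[OF gs_vanish] by simp

text \<open>Summing \<open>gs_step\<close> leaves the inner product of the residuals after
  \<open>n\<close> steps, and the residual of \<open>f i\<close> is then null.\<close>

theorem gram_schmidt:
  assumes "i < n"
  shows "expectation (\<lambda>x. f i x * f j x) = (\<Sum>k<n. gs_coeff f i k * gs_coeff f j k)"
proof -
  have "ip (R 0 i) (R 0 j) = (\<Sum>k<n. gs_coeff f i k * gs_coeff f j k) + ip (R n i) (R n j)" for n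
  proof (induction n)
    case (Suc n)
    then show ?case using gs_step[of n i j] by simp
  qed simp
  from this[of n] show ?thesis using ip_null[OF gs_vanish[OF assms]] by simp
qed

end

end

section \<open>Gaussian noise\<close>

text \<open>Indexing by the plane gives the sample space the type of functions on the plane, as the
  theorem prescribes for \<open>N\<close>; a sequence of independent normals is read off at the
  points (k, 0).\<close>

definition noise :: "(real \<times> real \<Rightarrow> real) measure" where
  "noise = PiM UNIV (\<lambda>_. std_normal_distribution)"

definition noise_coord :: "nat \<Rightarrow> (real \<times> real \<Rightarrow> real) \<Rightarrow> real" where
  "noise_coord k y = y (real k, 0)"

lemma prob_space_noise: "prob_space noise"
  unfolding noise_def by (intro prob_space_PiM real_distribution.axioms(1)[OF real_dist_normal_dist])

interpretation noise: prob_space noise by (rule prob_space_noise)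

lemma noise_coord_measurable [measurable]: "noise_coord k \<in> borel_measurable noise"
proof -
  have "(\<lambda>y. y (real k, 0)) \<in> measurable noise std_normal_distribution"
    unfolding noise_def by (rule measurable_component_singleton) simp
  then show ?thesis unfolding noise_coord_def[abs_def] by simp
qed

lemma distr_noise_coord: "distr noise borel (noise_coord k) = std_normal_distribution"
proof -
  have "distr noise std_normal_distribution (\<lambda>y. y (real k, 0)) = std_normal_distribution"
    unfolding noise_def by (rule distr_PiM_component) (auto intro: real_distribution.axioms(1)[OF real_dist_normal_dist])
  then show ?thesis unfolding noise_coord_def[abs_def] by (simp cong: distr_cong)
qed

lemma indep_noise_coord: "noise.indep_vars (\<lambda>_. borel) noise_coord UNIV"
proof (subst noise.indep_vars_iff_distr_eq_PiM)
  have s: "sets (\<Pi>\<^sub>M k\<in>(UNIV::nat set). (borel :: real measure)) = sets (\<Pi>\<^sub>M k\<in>(UNIV::nat set). std_normal_distribution)"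
    by (rule sets_PiM_cong) auto
  have "distr noise (\<Pi>\<^sub>M k\<in>(UNIV::nat set). std_normal_distribution) (\<lambda>y. \<lambda>k\<in>UNIV. y (real k, 0))
      = (\<Pi>\<^sub>M k\<in>(UNIV::nat set). std_normal_distribution)"
    unfolding noise_def
    by (rule distr_PiM_reindex[where f="\<lambda>k. (real k, 0)"])
       (auto intro: real_distribution.axioms(1)[OF real_dist_normal_dist] simp: inj_on_def)
  moreover have "distr noise (\<Pi>\<^sub>M k\<in>(UNIV::nat set). borel) (\<lambda>y. \<lambda>k\<in>UNIV. noise_coord k y)
      = distr noise (\<Pi>\<^sub>M k\<in>(UNIV::nat set). std_normal_distribution) (\<lambda>y. \<lambda>k\<in>UNIV. y (real k, 0))"
    by (rule distr_cong) (auto simp: s noise_coord_def)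
  ultimately show "distr noise (\<Pi>\<^sub>M k\<in>UNIV. borel) (\<lambda>y. \<lambda>k\<in>UNIV. noise_coord k y)
      = (\<Pi>\<^sub>M k\<in>UNIV. distr noise borel (noise_coord k))"
    by (simp add: distr_noise_coord)
qed auto

lemma centered_normal_noise: "noise.centered_normal (\<lambda>y. \<Sum>k<n. c k * noise_coord k y) (\<Sum>k<n. (c k)\<^sup>2)"
  unfolding noise.centered_normal_def
proof (intro conjI allI)
  fix t :: real
  have ind: "noise.indep_vars (\<lambda>_. borel) (\<lambda>k y. c k * noise_coord k y) {..<n}"
    by (rule noise.indep_vars_compose2[OF noise.indep_vars_subset[OF indep_noise_coord]]) auto
  have "(\<integral>y. iexp (t * (\<Sum>k<n. c k * noise_coord k y)) \<partial>noise) = char (distr noise borel (\<lambda>y. \<Sum>k<n. c k * noise_coord k y)) t"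
    unfolding char_def by (subst integral_distr) auto
  also have "\<dots> = (\<Prod>k<n. char (distr noise borel (\<lambda>y. c k * noise_coord k y)) t)"
    by (rule noise.char_distr_sum[OF ind])
  also have "\<dots> = (\<Prod>k<n. complex_of_real (exp (- (c k * t)\<^sup>2 / 2)))"
  proof (intro prod.cong refl)
    fix k
    have "char (distr noise borel (\<lambda>y. c k * noise_coord k y)) t = char (distr noise borel (noise_coord k)) (c k * t)"
      unfolding char_def by (simp add: integral_distr mult_ac)
    then show "char (distr noise borel (\<lambda>y. c k * noise_coord k y)) t = complex_of_real (exp (- (c k * t)\<^sup>2 / 2))"
      by (simp add: distr_noise_coord char_std_normal_distribution)
  qed
  also have "\<dots> = complex_of_real (exp (\<Sum>k<n. - (c k * t)\<^sup>2 / 2))"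
    by (simp add: exp_sum)
  also have "(\<Sum>k<n. - (c k * t)\<^sup>2 / 2) = - (\<Sum>k<n. (c k)\<^sup>2) * t\<^sup>2 / 2"
    by (simp add: power_mult_distrib sum_distrib_right sum_negf sum_divide_distrib)
  finally show "(\<integral>y. iexp (t * (\<Sum>k<n. c k * noise_coord k y)) \<partial>noise) = complex_of_real (exp (- (\<Sum>k<n. (c k)\<^sup>2) * t\<^sup>2 / 2))" .
qed (auto intro: sum_nonneg)

section \<open>The limit process\<close>


definition dyadic_points :: "(real \<times> real) set" where
  "dyadic_points = range (\<lambda>(k, i, j). (dyadic k i, dyadic k j))"

lemma countable_dyadic_points: "countable dyadic_points"
  unfolding dyadic_points_def by (intro countable_image) auto

lemma dyadic_mem_points: "(dyadic k i, dyadic k j) \<in> dyadic_points"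
  unfolding dyadic_points_def by (rule image_eqI[of _ _ "(k, i, j)"]) auto

lemma square_floor_points: "square_floor k t \<in> dyadic_points"
  by (cases t) (simp add: square_floor_def dyadic_floor_def dyadic_mem_points)

lemma grid_adjacent_points: "grid_adjacent k s t \<Longrightarrow> s \<in> dyadic_points"
  by (metis grid_adjacent_coords dyadic_mem_points)

definition dyadic_point :: "nat \<Rightarrow> real \<times> real" where
  "dyadic_point = from_nat_into dyadic_points"

definition point_index :: "real \<times> real \<Rightarrow> nat" where
  "point_index = to_nat_on dyadic_points"

lemma dyadic_point_index: "t \<in> dyadic_points \<Longrightarrow> dyadic_point (point_index t) = t"
  unfolding dyadic_point_def point_index_def
  by (rule from_nat_into_to_nat_on[OF countable_dyadic_points])

lemma tendsto_dyadic_floor: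
  assumes "0 \<le> u"
  shows "(\<lambda>m. dyadic_floor m u) \<longlonglongrightarrow> u"
proof (rule tendsto_sandwich)
  show "\<forall>\<^sub>F m in sequentially. u - (1/2) ^ m \<le> dyadic_floor m u" "\<forall>\<^sub>F m in sequentially. dyadic_floor m u \<le> u"
    using dyadic_floor_bounds[OF assms] by (auto simp: power_one_over less_imp_le intro!: always_eventually) (smt (verit))
  have "(\<lambda>m. u - (1/2) ^ m) \<longlonglongrightarrow> u - 0" by (intro tendsto_intros LIMSEQ_power_zero) auto
  then show "(\<lambda>m. u - (1/2) ^ m) \<longlonglongrightarrow> u" by simp
qed auto

context copula_law
begin

interpretation noise: prob_space noise by (rule prob_space_noise)

text \<open>\<open>wcov\<close> is the Gram matrix of \<open>wfun\<close> in L^2 of the copula, so a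
  triangular factor exists without a separate proof of positive semidefiniteness.\<close>

definition chol :: "nat \<Rightarrow> nat \<Rightarrow> real" where
  "chol = gs_coeff (\<lambda>n. wfun (dyadic_point n))"

definition gauss0 :: "(real \<times> real \<Rightarrow> real) \<Rightarrow> real \<times> real \<Rightarrow> real" where
  "gauss0 y t = (\<Sum>k\<le>point_index t. chol (point_index t) k * noise_coord k y)"

lemma wfun_dyadic_bounded: "\<exists>B. \<forall>z. \<bar>wfun (dyadic_point i) z\<bar> \<le> B"
  using wfun_bound by blast

text \<open>Coefficients beyond the diagonal are 0, so the sums for several points can be brought to
  one common length over the same noise.\<close>

lemma gauss0_eq:
  assumes "point_index t < n"
  shows "gauss0 y t = (\<Sum>k<n. chol (point_index t) k * noise_coord k y)"
  unfolding gauss0_def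
proof (rule sum.mono_neutral_left)
  show "\<forall>k\<in>{..<n} - {..point_index t}. chol (point_index t) k * noise_coord k y = 0"
    using gs_coeff_upper[OF wfun_measurable wfun_dyadic_bounded] by (auto simp: chol_def)
qed (use assms in auto)

lemma chol_wcov:
  assumes "s \<in> dyadic_points" "t \<in> dyadic_points" "point_index s < n"
  shows "(\<Sum>k<n. chol (point_index s) k * chol (point_index t) k) = wcov s t"
  using gram_schmidt[of "\<lambda>n. wfun (dyadic_point n)", OF wfun_measurable wfun_dyadic_bounded assms(3), where j = "point_index t"] assms
  by (simp add: chol_def dyadic_point_index integral_wfun)

lemma gauss0_normal:
  fixes a :: "'i \<Rightarrow> real" and p :: "'i \<Rightarrow> real \<times> real"
  assumes I: "finite I" and p: "\<And>i. i \<in> I \<Longrightarrow> p i \<in> dyadic_points"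
  shows "noise.centered_normal (\<lambda>y. \<Sum>i\<in>I. a i * gauss0 y (p i)) (\<Sum>i\<in>I. \<Sum>j\<in>I. a i * a j * wcov (p i) (p j))"
proof -
  define n where "n = Suc (\<Sum>i\<in>I. point_index (p i))"
  have n: "point_index (p i) < n" if "i \<in> I" for i
    unfolding n_def using I that member_le_sum[of i I "\<lambda>i. point_index (p i)"] by simp
  let ?c = "\<lambda>k. \<Sum>i\<in>I. a i * chol (point_index (p i)) k"
  have e: "(\<Sum>i\<in>I. a i * gauss0 y (p i)) = (\<Sum>k<n. ?c k * noise_coord k y)" for y
  proof -
    have "(\<Sum>i\<in>I. a i * gauss0 y (p i)) = (\<Sum>i\<in>I. \<Sum>k<n. a i * chol (point_index (p i)) k * noise_coord k y)"
      by (intro sum.cong refl) (simp add: gauss0_eq[OF n] sum_distrib_left mult.assoc)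
    also have "\<dots> = (\<Sum>k<n. ?c k * noise_coord k y)"
      by (subst sum.swap) (simp add: sum_distrib_right)
    finally show ?thesis .
  qed
  have "(\<Sum>k<n. (?c k)\<^sup>2) = (\<Sum>k<n. \<Sum>i\<in>I. \<Sum>j\<in>I. a i * a j * (chol (point_index (p i)) k * chol (point_index (p j)) k))"
    by (simp add: power2_eq_square sum_product mult_ac)
  also have "\<dots> = (\<Sum>i\<in>I. \<Sum>k<n. \<Sum>j\<in>I. a i * a j * (chol (point_index (p i)) k * chol (point_index (p j)) k))"
    by (rule sum.swap)
  also have "\<dots> = (\<Sum>i\<in>I. \<Sum>j\<in>I. \<Sum>k<n. a i * a j * (chol (point_index (p i)) k * chol (point_index (p j)) k))"
    by (intro sum.cong refl sum.swap)
  also have "\<dots> = (\<Sum>i\<in>I. \<Sum>j\<in>I. a i * a j * wcov (p i) (p j))"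
    by (intro sum.cong refl) (simp add: chol_wcov[OF p p n] flip: sum_distrib_left)
  finally have v: "(\<Sum>k<n. (?c k)\<^sup>2) = (\<Sum>i\<in>I. \<Sum>j\<in>I. a i * a j * wcov (p i) (p j))" .
  show ?thesis unfolding e using centered_normal_noise[of ?c n] unfolding v .
qed

lemma gauss0_measurable [measurable]: "(\<lambda>y. gauss0 y t) \<in> borel_measurable noise"
  unfolding gauss0_def by measurable

text \<open>Variance 0 forces all coefficients to be 0, so the value is 0 for every \<open>y\<close>
  and not just almost surely.\<close>

lemma gauss0_zero:
  assumes t: "t \<in> dyadic_points" and z: "min_coord t = 0 \<or> min_coord t = 1"
  shows "gauss0 y t = 0"
proof -
  let ?n = "Suc (point_index t)"
  have "(\<Sum>k<?n. (chol (point_index t) k)\<^sup>2) = wcov t t"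
    using chol_wcov[OF t t lessI] by (simp add: power2_eq_square)
  also have "\<dots> = 0" using z by (auto simp: wcov_def)
  finally have "\<forall>k\<in>{..<?n}. (chol (point_index t) k)\<^sup>2 = 0"
    by (subst (asm) sum_nonneg_eq_0_iff) auto
  then show ?thesis by (subst gauss0_eq[OF lessI]) auto
qed

text \<open>A normal variable of variance \<open>v\<close> has moment generating function exp (a^2 v
  / 2). With v \<le> 24 \<rho>^(4k) and a = 1 / (4 \<rho>^(2k)) the exponent is at most 3/4, so the
  constants of the empirical process serve again, now at every level.\<close>

lemma gauss0_exp_moment:
  assumes adj: "grid_adjacent k s t"
  shows "(\<integral>\<^sup>+y. ennreal (exp ((1/4) / chain_ratio ^ (2 * k) * (gauss0 y s - gauss0 y t))) \<partial>noise) \<le> ennreal (exp (3/2))"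
proof -
  let ?h = "1 / 2 ^ k :: real" and ?a = "\<lambda>b. if b then 1 else -1 :: real" and ?p = "\<lambda>b. if b then s else t"
  have pts: "s \<in> dyadic_points" "t \<in> dyadic_points"
    using grid_adjacent_points adj grid_adjacent_sym by blast+
  define v where "v = wcov s s - 2 * wcov s t + wcov t t"
  have "noise.centered_normal (\<lambda>y. \<Sum>b\<in>UNIV. ?a b * gauss0 y (?p b)) (\<Sum>b\<in>UNIV. \<Sum>c\<in>UNIV. ?a b * ?a c * wcov (?p b) (?p c))"
    by (rule gauss0_normal) (use pts in auto)
  then have N: "noise.centered_normal (\<lambda>y. gauss0 y s - gauss0 y t) v"
    by (simp add: UNIV_bool v_def wcov_sym[of t s] algebra_simps)
  have v: "v \<le> 24 * (chain_ratio ^ (2 * k))\<^sup>2"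
  proof -
    have "v \<le> 24 * ?h powr (1 - 2 * \<omega>)"
      unfolding v_def wfun_increment_wcov[symmetric] by (rule wfun_increment_moment[OF adj])
    also have "?h powr (1 - 2 * \<omega>) = (?h powr (1/2 - \<omega>))\<^sup>2"
      by (simp add: power2_eq_square flip: powr_add)
    finally show ?thesis by (simp add: chain_ratio_power)
  qed
  have c: "0 < chain_ratio ^ (2 * k)" using chain_ratio by simp
  have "((1/4) / chain_ratio ^ (2 * k))\<^sup>2 * v / 2 \<le> ((1/4) / chain_ratio ^ (2 * k))\<^sup>2 * (24 * (chain_ratio ^ (2 * k))\<^sup>2) / 2"
    using v by (intro divide_right_mono mult_left_mono) auto
  also have "\<dots> \<le> 3/2" using c by (simp add: power_divide)
  finally show ?thesis
    unfolding noise.centered_normal_exp_moment[OF N] by (simp add: ennreal_leI)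
qed

section \<open>Points of the noise space with a chaining bound at all levels\<close>

definition good :: "real \<Rightarrow> (real \<times> real \<Rightarrow> real) set" where
  "good A = {y\<in>space noise. \<forall>k. level_osc (gauss0 y) (A * chain_ratio ^ k) k}"

lemma good_sets [measurable]: "good A \<in> sets noise"
proof -
  have "good A = space noise - (\<Union>k. {y\<in>space noise. \<not> level_osc (gauss0 y) (A * chain_ratio ^ k) k})"
    by (auto simp: good_def)
  also have "\<dots> \<in> sets noise"
    using noise.level_osc_measurable[of gauss0, OF gauss0_measurable] by (intro sets.Diff sets.countable_nat_UN) auto
  finally show ?thesis .
qed

lemma good_mono: "A \<le> A' \<Longrightarrow> good A \<subseteq> good A'"
proof -
  assume A: "A \<le> A'"
  have "A * chain_ratio ^ k \<le> A' * chain_ratio ^ k" for k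
    using A chain_ratio by (intro mult_right_mono) auto
  then show ?thesis unfolding good_def level_osc_def by (blast intro: order_trans)
qed

text \<open>The chaining estimate is uniform in the last level, so that level can tend to infinity
  along the increasing events \<open>D K\<close>.\<close>

lemma good_prob:
  assumes "0 < \<eta>"
  obtains A where "0 < A" "1 - \<eta> \<le> noise.prob (good A)"
proof -
  obtain A where A: "0 < A" "16 * exp (3/2) * (real chain_power / ((1/4) * A)) ^ chain_power \<le> \<eta>"
    using chain_constant[of "exp (3/2)" \<eta>] assms by auto
  define D where "D K = {y\<in>space noise. \<exists>k\<le>K. \<not> level_osc (gauss0 y) (A * chain_ratio ^ k) k}" for K
  have Ds: "D K \<in> sets noise" for K
  proof -
    have "D K = (\<Union>k\<in>{..K}. {y\<in>space noise. \<not> level_osc (gauss0 y) (A * chain_ratio ^ k) k})" by (auto simp: D_def)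
    then show ?thesis using noise.level_osc_measurable[of gauss0, OF gauss0_measurable] by auto
  qed
  have "noise.prob (D K) \<le> \<eta>" for K
  proof -
    have "noise.prob (D K) \<le> 16 * exp (3/2) * (real chain_power / ((1/4) * A)) ^ chain_power"
      unfolding D_def
      by (rule noise.chaining_prob[where c="1/4" and D="exp (3/2)"])
         (use A chain_ratio chain_power gauss0_exp_moment in auto)
    then show ?thesis using A(2) by linarith
  qed
  moreover have "(\<lambda>K. noise.prob (D K)) \<longlonglongrightarrow> noise.prob (\<Union>K. D K)"
  proof (rule noise.finite_Lim_measure_incseq)
    show "incseq D" unfolding incseq_def D_def by safe (meson le_trans)
  qed (use Ds in auto)
  ultimately have "noise.prob (\<Union>K. D K) \<le> \<eta>" by (intro LIMSEQ_le_const2) auto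
  moreover have "good A = space noise - (\<Union>K. D K)" by (auto simp: good_def D_def)
  ultimately have "1 - \<eta> \<le> noise.prob (good A)" using Ds by (simp add: noise.prob_compl)
  then show thesis using that A by blast
qed

definition good_paths :: "(real \<times> real \<Rightarrow> real) set" where
  "good_paths = (\<Union>n. good (real (Suc n)))"

lemma good_paths_sets [measurable]: "good_paths \<in> sets noise"
  unfolding good_paths_def by measurable

lemma good_subset_paths: "good A \<subseteq> good_paths"
proof -
  obtain n :: nat where "A \<le> real n" using real_arch_simple by blast
  then have "A \<le> real (Suc n)" by simp
  then show ?thesis unfolding good_paths_def using good_mono by blast
qed

lemma good_pathsE:
  assumes "y \<in> good_paths" obtains A where "0 < A" "y \<in> good A"
proof -
  obtain n where "y \<in> good (real (Suc n))" using assms by (auto simp: good_paths_def)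
  then show thesis by (intro that[of "real (Suc n)"]) auto
qed

lemma AE_good_paths: "AE y in noise. y \<in> good_paths"
proof -
  have "1 \<le> noise.prob good_paths"
  proof (rule field_le_epsilon)
    fix e :: real assume "0 < e"
    then obtain A where "1 - e \<le> noise.prob (good A)" using good_prob by blast
    also have "\<dots> \<le> noise.prob good_paths" by (intro noise.finite_measure_mono good_subset_paths) auto
    finally show "1 \<le> noise.prob good_paths + e" by simp
  qed
  then have "noise.prob good_paths = 1" using noise.prob_le_1[of good_paths] by linarith
  then show ?thesis using noise.prob_eq_1 by simp
qed

text \<open>Paths without a chaining bound are replaced by 0, so continuity and the boundary values
  hold for every \<open>y\<close>.\<close>

definition gauss :: "(real \<times> real \<Rightarrow> real) \<Rightarrow> real \<times> real \<Rightarrow> real" where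
  "gauss y = (\<lambda>t\<in>unit_square. if y \<in> good_paths then lim (\<lambda>m. gauss0 y (square_floor m t)) else 0)"

definition gauss_step :: "nat \<Rightarrow> (real \<times> real \<Rightarrow> real) \<Rightarrow> real \<times> real \<Rightarrow> real" where
  "gauss_step m y = (\<lambda>t\<in>unit_square. gauss0 y (square_floor m t))"

definition path_const :: "real \<Rightarrow> real" where
  "path_const A = 2 * A / (1 - chain_ratio)"

lemma gauss0_chain:
  assumes "0 < A" "y \<in> good A" "t \<in> unit_square" "m \<le> k"
  shows "\<bar>gauss0 y (square_floor k t) - gauss0 y (square_floor m t)\<bar> \<le> path_const A * chain_ratio ^ m"
  unfolding path_const_def
  by (rule square_floor_chain_bound[where K=k]) (use assms chain_ratio in \<open>auto simp: good_def\<close>)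

lemma chain_ratio_lim: "(\<lambda>m. c * chain_ratio ^ m) \<longlonglongrightarrow> 0"
proof -
  have "(\<lambda>m. c * chain_ratio ^ m) \<longlonglongrightarrow> c * 0"
    using chain_ratio by (intro tendsto_intros LIMSEQ_power_zero) auto
  then show ?thesis by simp
qed

lemma gauss_limit:
  assumes y: "y \<in> good_paths" and t: "t \<in> unit_square"
  shows "(\<lambda>m. gauss0 y (square_floor m t)) \<longlonglongrightarrow> gauss y t"
proof -
  obtain A where A: "0 < A" "y \<in> good A" using good_pathsE[OF y] .
  have "Cauchy (\<lambda>m. gauss0 y (square_floor m t))"
  proof (rule CauchyI')
    fix e :: real assume "0 < e"
    then have "\<forall>\<^sub>F m in sequentially. path_const A * chain_ratio ^ m < e"
      by (rule order_tendstoD[OF chain_ratio_lim])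
    then obtain m0 where m0: "\<And>m. m \<ge> m0 \<Longrightarrow> path_const A * chain_ratio ^ m < e"
      by (auto simp: eventually_sequentially)
    have "dist (gauss0 y (square_floor m t)) (gauss0 y (square_floor n t)) < e" if "m0 \<le> m" "m < n" for m n
      using gauss0_chain[OF A t, of m n] m0[of m] that by (simp add: dist_real_def abs_minus_commute)
    then show "\<exists>m0. \<forall>m\<ge>m0. \<forall>n>m. dist (gauss0 y (square_floor m t)) (gauss0 y (square_floor n t)) < e"
      by blast
  qed
  then have "convergent (\<lambda>m. gauss0 y (square_floor m t))" by (rule Cauchy_convergent)
  then show ?thesis using y t by (simp add: gauss_def convergent_LIMSEQ_iff)
qed

lemma gauss_approx:
  assumes A: "0 < A" "y \<in> good A" and t: "t \<in> unit_square"
  shows "\<bar>gauss y t - gauss0 y (square_floor m t)\<bar> \<le> path_const A * chain_ratio ^ m"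
proof (rule Lim_bounded)
  have y: "y \<in> good_paths" using A good_subset_paths by blast
  show "(\<lambda>k. \<bar>gauss0 y (square_floor k t) - gauss0 y (square_floor m t)\<bar>) \<longlonglongrightarrow> \<bar>gauss y t - gauss0 y (square_floor m t)\<bar>"
    by (intro tendsto_intros gauss_limit y t)
  show "\<forall>k\<ge>m. \<bar>gauss0 y (square_floor k t) - gauss0 y (square_floor m t)\<bar> \<le> path_const A * chain_ratio ^ m"
    using gauss0_chain[OF A t] by blast
qed

lemma gauss_bound:
  assumes A: "0 < A" "y \<in> good A" and t: "t \<in> unit_square"
  shows "\<bar>gauss y t\<bar> \<le> path_const A"
proof -
  have "dyadic_index 0 (min_coord t) \<le> 1"
    using dyadic_index_le[of "min_coord t" 0] min_coord_mem[OF t] by simp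
  then have "min_coord (square_floor 0 t) = 0 \<or> min_coord (square_floor 0 t) = 1"
    unfolding min_coord_square_floor dyadic_floor_def
    by (cases "dyadic_index 0 (min_coord t)") (auto simp: dyadic_def)
  then have "gauss0 y (square_floor 0 t) = 0" by (intro gauss0_zero square_floor_points)
  then show ?thesis using gauss_approx[OF A t, of 0] by simp
qed

text \<open>Both points are rounded to level \<open>m\<close>, and their corners are at most one
  cell apart in each coordinate.\<close>

lemma gauss_modulus:
  assumes A: "0 < A" "y \<in> good A" and st: "s \<in> unit_square" "t \<in> unit_square"
    "\<bar>fst s - fst t\<bar> \<le> 1/2^m" "\<bar>snd s - snd t\<bar> \<le> 1/2^m"
  shows "\<bar>gauss y s - gauss y t\<bar> \<le> (2 * path_const A + 2 * A) * chain_ratio ^ m"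
proof -
  have "\<bar>gauss0 y (square_floor m s) - gauss0 y (square_floor m t)\<bar> \<le> 2 * (A * chain_ratio ^ m)"
    by (rule level_osc_square_floor[OF _ _ st]) (use A chain_ratio in \<open>auto simp: good_def\<close>)
  then show ?thesis
    using gauss_approx[OF A st(1), of m] gauss_approx[OF A st(2), of m] by (simp add: algebra_simps)
qed

lemma gauss_bad: "y \<notin> good_paths \<Longrightarrow> gauss y = (\<lambda>t\<in>unit_square. 0)"
  by (simp add: gauss_def)

lemma gauss_mspace: "gauss y \<in> mspace linf_square"
proof (cases "y \<in> good_paths")
  case True
  then obtain A where A: "0 < A" "y \<in> good A" by (rule good_pathsE)
  have "restrict (gauss y) unit_square \<in> mspace linf_square"
    using gauss_bound[OF A] by (rule mspace_linf_squareI)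
  then show ?thesis by (simp add: gauss_def)
next
  case False
  then show ?thesis unfolding gauss_bad[OF False] by (intro mspace_linf_squareI[of _ 0]) simp
qed

lemma gauss_continuous: "continuous_on unit_square (gauss y)"
proof (cases "y \<in> good_paths")
  case True
  then obtain A where A: "0 < A" "y \<in> good A" by (rule good_pathsE)
  show ?thesis unfolding continuous_on_iff
  proof (intro ballI allI impI)
    fix s and e :: real assume s: "s \<in> unit_square" and e: "0 < e"
    obtain m where m: "(2 * path_const A + 2 * A) * chain_ratio ^ m < e"
      using order_tendstoD(2)[OF chain_ratio_lim e] by (auto simp: eventually_sequentially)
    have "dist (gauss y t) (gauss y s) < e" if t: "t \<in> unit_square" "dist t s < 1/2^m" for t
    proof -
      have "\<bar>fst t - fst s\<bar> \<le> 1/2^m" "\<bar>snd t - snd s\<bar> \<le> 1/2^m"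
        using dist_fst_le[of t s] dist_snd_le[of t s] t(2) by (auto simp: dist_real_def)
      then show ?thesis using gauss_modulus[OF A t(1) s] m by (fastforce simp: dist_real_def)
    qed
    then show "\<exists>d>0. \<forall>t\<in>unit_square. dist t s < d \<longrightarrow> dist (gauss y t) (gauss y s) < e"
      by (intro exI[of _ "1/2^m"]) auto
  qed
next
  case False
  have "continuous_on unit_square (\<lambda>t. 0 :: real)" by simp
  then show ?thesis unfolding gauss_bad[OF False] by (simp cong: continuous_on_cong)
qed

lemma gauss_boundary:
  assumes t: "t \<in> unit_square" and z: "min_coord t = 0 \<or> min_coord t = 1"
  shows "gauss y t = 0"
proof (cases "y \<in> good_paths")
  case True
  have "gauss0 y (square_floor m t) = 0" for m
    using z by (intro gauss0_zero square_floor_points) (auto simp: min_coord_square_floor)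
  then show ?thesis using gauss_limit[OF True t] by (simp add: LIMSEQ_const_iff)
qed (use t in \<open>simp add: gauss_bad\<close>)

lemma gauss_measurable [measurable]: "(\<lambda>y. gauss y t) \<in> borel_measurable noise"
proof (cases "t \<in> unit_square")
  case True
  have "(\<lambda>y. if y \<in> good_paths then lim (\<lambda>m. gauss0 y (square_floor m t)) else 0) \<in> borel_measurable noise"
    by measurable
  then show ?thesis using True by (simp add: gauss_def)
qed (simp add: gauss_def)

text \<open>\<open>cdf2\<close> is continuous by its Lipschitz bound. \<open>inv_weight\<close> may
  jump at 0 and 1, but there rounding keeps the smaller coordinate exactly at 0 or 1; elsewhere it
  is continuous.\<close>

lemma wcov_limit:
  assumes s: "s \<in> unit_square" and t: "t \<in> unit_square"
  shows "(\<lambda>m. wcov (square_floor m s) (square_floor m t)) \<longlonglongrightarrow> wcov s t"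
proof -
  have cl: "(\<lambda>m. cdf2 (square_floor m t)) \<longlonglongrightarrow> cdf2 t" if t: "t \<in> unit_square" for t
  proof -
    obtain u v where uv: "t = (u, v)" "0 \<le> u" "u \<le> 1" "0 \<le> v" "v \<le> 1" using t by (cases t) auto
    have sf: "square_floor m t = (dyadic_floor m u, dyadic_floor m v)" for m by (simp add: uv square_floor_def)
    have le: "fst (square_floor m t) \<le> fst t" "snd (square_floor m t) \<le> snd t" for m
      unfolding sf using dyadic_floor_bounds uv by auto
    show ?thesis
    proof (rule tendsto_sandwich[of "\<lambda>m. cdf2 t - (u - dyadic_floor m u) - (v - dyadic_floor m v)" _ _ "\<lambda>_. cdf2 t"])
      have "(\<lambda>m. cdf2 t - (u - dyadic_floor m u) - (v - dyadic_floor m v)) \<longlonglongrightarrow> cdf2 t - (u - u) - (v - v)"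
        using uv by (intro tendsto_intros tendsto_dyadic_floor) auto
      then show "(\<lambda>m. cdf2 t - (u - dyadic_floor m u) - (v - dyadic_floor m v)) \<longlonglongrightarrow> cdf2 t" by simp
      show "\<forall>\<^sub>F m in sequentially. cdf2 t - (u - dyadic_floor m u) - (v - dyadic_floor m v) \<le> cdf2 (square_floor m t)"
      proof (rule always_eventually, rule allI)
        fix m
        show "cdf2 t - (u - dyadic_floor m u) - (v - dyadic_floor m v) \<le> cdf2 (square_floor m t)"
          using cdf2_lipschitz[OF square_floor_mem[OF t] t le, of m] by (simp add: uv sf[unfolded uv])
      qed
      show "\<forall>\<^sub>F m in sequentially. cdf2 (square_floor m t) \<le> cdf2 t"
        by (intro always_eventually allI cdf2_mono le)
    qed auto
  qed
  have rl: "(\<lambda>m. inv_weight \<omega> (min_coord (square_floor m t))) \<longlonglongrightarrow> inv_weight \<omega> (min_coord t)"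
    if t: "t \<in> unit_square" for t
  proof (cases "min_coord t = 0 \<or> min_coord t = 1")
    case True
    then show ?thesis by (auto simp: min_coord_square_floor)
  next
    case False
    let ?a = "min_coord t"
    have a: "0 < ?a" "?a < 1" using min_coord_mem[OF t] False by auto
    have fl: "(\<lambda>m. dyadic_floor m ?a) \<longlonglongrightarrow> ?a" using a by (intro tendsto_dyadic_floor) auto
    have "(\<lambda>m. (dyadic_floor m ?a * (1 - dyadic_floor m ?a)) powr (-\<omega>)) \<longlonglongrightarrow> (?a * (1 - ?a)) powr (-\<omega>)"
      by (intro tendsto_intros fl) (use a in auto)
    moreover have "\<forall>\<^sub>F m in sequentially. (dyadic_floor m ?a * (1 - dyadic_floor m ?a)) powr (-\<omega>) = inv_weight \<omega> (min_coord (square_floor m t))"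
      using order_tendstoD(1)[OF fl a(1)] order_tendstoD(2)[OF fl a(2)]
      by eventually_elim (simp add: min_coord_square_floor inv_weight_eq)
    ultimately show ?thesis using a by (simp add: inv_weight_eq tendsto_cong)
  qed
  have m: "meet (square_floor m s) (square_floor m t) = square_floor m (meet s t)" for m
    by (cases s; cases t) (simp add: meet_def square_floor_def dyadic_floor_min)
  show ?thesis unfolding wcov_def m
    by (intro tendsto_intros cl rl s t meet_mem)
qed

text \<open>Almost sure convergence of the rounded sums and dominated convergence of their
  characteristic functions extend normality from the dyadic points to the whole square.\<close>

lemma gauss_normal:
  fixes a :: "'i \<Rightarrow> real" and p :: "'i \<Rightarrow> real \<times> real"
  assumes I: "finite I" and p: "\<And>i. i \<in> I \<Longrightarrow> p i \<in> unit_square"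
  shows "noise.centered_normal (\<lambda>y. \<Sum>i\<in>I. a i * gauss y (p i)) (\<Sum>i\<in>I. \<Sum>j\<in>I. a i * a j * wcov (p i) (p j))"
    (is "noise.centered_normal ?X ?v")
proof -
  let ?Xm = "\<lambda>m y. \<Sum>i\<in>I. a i * gauss0 y (square_floor m (p i))"
  let ?vm = "\<lambda>m. \<Sum>i\<in>I. \<Sum>j\<in>I. a i * a j * wcov (square_floor m (p i)) (square_floor m (p j))"
  have N: "noise.centered_normal (?Xm m) (?vm m)" for m
    by (rule gauss0_normal[OF I square_floor_points])
  have vl: "?vm \<longlonglongrightarrow> ?v" by (intro tendsto_intros wcov_limit p)
  have Xl: "AE y in noise. (\<lambda>m. ?Xm m y) \<longlonglongrightarrow> ?X y"
    using AE_good_paths by eventually_elim (intro tendsto_intros gauss_limit p)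
  show ?thesis unfolding noise.centered_normal_def
  proof (intro conjI allI)
    show "?X \<in> borel_measurable noise" by measurable
    show "0 \<le> ?v" using vl by (rule LIMSEQ_le_const) (use N in \<open>auto simp: noise.centered_normal_def\<close>)
    fix t :: real
    have l1: "(\<lambda>m. \<integral>y. iexp (t * ?Xm m y) \<partial>noise) \<longlonglongrightarrow> (\<integral>y. iexp (t * ?X y) \<partial>noise)"
    proof (rule integral_dominated_convergence[where w="\<lambda>_. 1"])
      show "AE y in noise. (\<lambda>m. iexp (t * ?Xm m y)) \<longlonglongrightarrow> iexp (t * ?X y)"
        using Xl by eventually_elim (intro tendsto_exp tendsto_mult tendsto_of_real tendsto_const)
    qed auto
    have e: "(\<lambda>m. \<integral>y. iexp (t * ?Xm m y) \<partial>noise) = (\<lambda>m. complex_of_real (exp (- ?vm m * t\<^sup>2 / 2)))"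
      using N unfolding noise.centered_normal_def by blast
    have l2: "(\<lambda>m. complex_of_real (exp (- ?vm m * t\<^sup>2 / 2))) \<longlonglongrightarrow> complex_of_real (exp (- ?v * t\<^sup>2 / 2))"
      by (intro tendsto_of_real tendsto_exp tendsto_divide tendsto_mult tendsto_minus vl tendsto_const) auto
    show "(\<integral>y. iexp (t * ?X y) \<partial>noise) = complex_of_real (exp (- ?v * t\<^sup>2 / 2))"
      by (rule LIMSEQ_unique[OF l1[unfolded e] l2])
  qed
qed

end

section \<open>Weak convergence of the weighted empirical process\<close>


text \<open>Built from an arbitrary array, so that a functional of a step function becomes a
  function of finitely many coordinates, the setting of \<open>cramer_wold\<close>.\<close>

definition step_fun :: "nat \<Rightarrow> (nat \<times> nat \<Rightarrow> real) \<Rightarrow> real \<times> real \<Rightarrow> real" where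
  "step_fun m w = (\<lambda>t\<in>unit_square. w (dyadic_index m (fst t), dyadic_index m (snd t)))"

definition grid_values :: "nat \<Rightarrow> (real \<times> real \<Rightarrow> real) \<Rightarrow> nat \<times> nat \<Rightarrow> real" where
  "grid_values m x = (\<lambda>(i, j). x (dyadic m i, dyadic m j))"

abbreviation grid_indices :: "nat \<Rightarrow> (nat \<times> nat) set" where
  "grid_indices m \<equiv> {..2^m} \<times> {..2^m}"

lemma step_fun_grid_values: "step_fun m (grid_values m x) = (\<lambda>t\<in>unit_square. x (square_floor m t))"
  by (auto simp: step_fun_def grid_values_def square_floor_def dyadic_floor_def split: prod.splits)

lemma grid_index_mem: "t \<in> unit_square \<Longrightarrow> (dyadic_index m (fst t), dyadic_index m (snd t)) \<in> grid_indices m"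
  by (cases t) (auto intro: dyadic_index_le)

lemma step_fun_mspace: "step_fun m w \<in> mspace linf_square"
  unfolding step_fun_def
proof (rule mspace_linf_squareI)
  fix t :: "real \<times> real" assume "t \<in> unit_square"
  then show "\<bar>w (dyadic_index m (fst t), dyadic_index m (snd t))\<bar> \<le> (\<Sum>i\<in>grid_indices m. \<bar>w i\<bar>)"
    by (intro member_le_sum[of _ _ "\<lambda>i. \<bar>w i\<bar>"] grid_index_mem) auto
qed

lemma step_fun_dist: "mdist linf_square (step_fun m w) (step_fun m w') \<le> (\<Sum>i\<in>grid_indices m. \<bar>w i - w' i\<bar>)"
  unfolding mdist_linf_square_le[OF step_fun_mspace step_fun_mspace]
proof
  fix t :: "real \<times> real" assume t: "t \<in> unit_square"
  have "\<bar>w (dyadic_index m (fst t), dyadic_index m (snd t)) - w' (dyadic_index m (fst t), dyadic_index m (snd t))\<bar>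
      \<le> (\<Sum>i\<in>grid_indices m. \<bar>w i - w' i\<bar>)"
    by (intro member_le_sum[of _ _ "\<lambda>i. \<bar>w i - w' i\<bar>"] grid_index_mem t) auto
  then show "\<bar>step_fun m w t - step_fun m w' t\<bar> \<le> (\<Sum>i\<in>grid_indices m. \<bar>w i - w' i\<bar>)"
    using t by (simp add: step_fun_def)
qed

lemma step_fun_cong: "(\<And>i. i \<in> grid_indices m \<Longrightarrow> w i = w' i) \<Longrightarrow> step_fun m w = step_fun m w'"
  unfolding step_fun_def by (rule restrict_ext) (use grid_index_mem in blast)

text \<open>The change of the functional is at most a constant times a finite sum of coordinate
  differences, which is continuous in the product topology.\<close>

lemma step_functional_continuous:
  assumes F: "lipschitz_functional linf_square F"
  shows "continuous_on UNIV (\<lambda>w. F (step_fun m w))"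
proof -
  obtain c where c: "c > 0" "\<And>x y. x \<in> mspace linf_square \<Longrightarrow> y \<in> mspace linf_square \<Longrightarrow>
      \<bar>F x - F y\<bar> \<le> c * mdist linf_square x y"
    using lipschitz_functionalD[OF F] by blast
  have "((\<lambda>w. F (step_fun m w)) \<longlongrightarrow> F (step_fun m v)) (at v)" for v
  proof -
    have b: "\<bar>F (step_fun m w) - F (step_fun m v)\<bar> \<le> c * (\<Sum>i\<in>grid_indices m. \<bar>w i - v i\<bar>)" for w
      using c(2)[OF step_fun_mspace step_fun_mspace, of m w m v] mult_left_mono[OF step_fun_dist[of m w v], of c] c(1)
      by linarith
    have coord: "isCont (\<lambda>w::nat \<times> nat \<Rightarrow> real. w i) v" for i
    proof -
      have "continuous_on UNIV (\<lambda>w::nat \<times> nat \<Rightarrow> real. w i)" by (rule continuous_on_product_coordinates)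
      then show ?thesis using continuous_on_eq_continuous_at[OF open_UNIV] by blast
    qed
    have "isCont (\<lambda>w. c * (\<Sum>i\<in>grid_indices m. \<bar>w i - v i\<bar>)) v"
      by (intro continuous_intros coord)
    then have "((\<lambda>w. c * (\<Sum>i\<in>grid_indices m. \<bar>w i - v i\<bar>)) \<longlongrightarrow> 0) (at v)"
      by (simp add: isCont_def)
    then have "((\<lambda>w. F (step_fun m w) - F (step_fun m v)) \<longlongrightarrow> 0) (at v)"
      by (rule Lim_null_comparison[rotated]) (simp add: b)
    then show ?thesis by (rule LIM_zero_cancel)
  qed
  then show ?thesis by (simp add: continuous_on_eq_continuous_at isCont_def)
qed

section \<open>Measurability, tightness and law of the limit process\<close>

context copula_law
begin

interpretation noise: prob_space noise by (rule prob_space_noise)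

lemma gauss_step_eq: "gauss_step m y = step_fun m (grid_values m (gauss0 y))"
  unfolding step_fun_grid_values gauss_step_def ..

lemma grid_values_gauss0_measurable: "(\<lambda>y. grid_values m (gauss0 y) i) \<in> borel_measurable noise"
  by (cases i) (simp add: grid_values_def)

lemma gauss_step_functional_measurable:
  assumes "lipschitz_functional linf_square F"
  shows "(\<lambda>y. F (gauss_step m y)) \<in> borel_measurable noise"
  unfolding gauss_step_eq
  by (rule measurable_continuous_sequence[OF grid_values_gauss0_measurable step_functional_continuous[OF assms]])

lemma gauss_step_dist:
  assumes A: "0 < A" "y \<in> good A"
  shows "mdist linf_square (gauss_step m y) (gauss y) \<le> path_const A * chain_ratio ^ m"
  unfolding gauss_step_eq mdist_linf_square_le[OF step_fun_mspace gauss_mspace]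
  unfolding step_fun_grid_values using gauss_approx[OF A] by (auto simp: abs_minus_commute)

lemma gauss_step_limit:
  assumes "y \<in> good_paths"
  shows "(\<lambda>m. mdist linf_square (gauss_step m y) (gauss y)) \<longlonglongrightarrow> 0"
proof -
  obtain A where A: "0 < A" "y \<in> good A" using good_pathsE[OF assms] .
  show ?thesis
    by (rule tendsto_sandwich[OF _ _ tendsto_const chain_ratio_lim])
       (use gauss_step_dist[OF A] in \<open>auto intro!: always_eventually\<close>)
qed

text \<open>The space of bounded functions is not separable, so measurability of the coordinates
  does not by itself give Borel measurability. A Lipschitz functional of \<open>gauss\<close> is
  however a limit of functionals of step functions, each depending on finitely many
  coordinates.\<close>

lemma gauss_borel: "gauss \<in> measurable noise (borel_of (mtopology_of linf_square))"
proof (rule measurable_borel_of_metricI[OF gauss_mspace])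
  fix F :: "(real \<times> real \<Rightarrow> real) \<Rightarrow> real"
  assume F: "lipschitz_functional linf_square F"
  obtain c where c: "c > 0" "\<And>x y. x \<in> mspace linf_square \<Longrightarrow> y \<in> mspace linf_square \<Longrightarrow>
      \<bar>F x - F y\<bar> \<le> c * mdist linf_square x y"
    using lipschitz_functionalD[OF F] by blast
  let ?z = "\<lambda>t\<in>unit_square. 0 :: real"
  show "(\<lambda>y. F (gauss y)) \<in> borel_measurable noise"
  proof (rule borel_measurable_LIMSEQ_real)
    note [measurable] = gauss_step_functional_measurable[OF F]
    show "(\<lambda>y. if y \<in> good_paths then F (gauss_step m y) else F ?z) \<in> borel_measurable noise" for m
      by measurable
    fix y
    show "(\<lambda>m. if y \<in> good_paths then F (gauss_step m y) else F ?z) \<longlonglongrightarrow> F (gauss y)"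
    proof (cases "y \<in> good_paths")
      case True
      have "(\<lambda>m. c * mdist linf_square (gauss_step m y) (gauss y)) \<longlonglongrightarrow> c * 0"
        by (intro tendsto_intros gauss_step_limit True)
      then have l: "(\<lambda>m. c * mdist linf_square (gauss_step m y) (gauss y)) \<longlonglongrightarrow> 0" by simp
      have "(\<lambda>m. F (gauss_step m y) - F (gauss y)) \<longlonglongrightarrow> 0"
        by (rule Lim_null_comparison[OF _ l])
           (use c(2)[OF _ gauss_mspace] step_fun_mspace in \<open>auto simp: gauss_step_eq\<close>)
      then show ?thesis using True LIM_zero_cancel by auto
    qed (simp add: gauss_bad)
  qed
qed

text \<open>On \<open>good A\<close> the bound and the modulus of continuity depend on
  \<open>A\<close> alone, so all these paths lie in one compact set of Arzela-Ascoli type.\<close>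

lemma gauss_tight: "tight_borel_element noise linf_square gauss"
  unfolding tight_borel_element_def
proof (intro conjI allI impI)
  show "prob_space noise" "gauss \<in> measurable noise (borel_of (mtopology_of linf_square))"
    by (rule prob_space_noise gauss_borel)+
  fix \<epsilon> :: real assume "0 < \<epsilon>"
  then obtain A where A: "0 < A" "1 - \<epsilon> \<le> noise.prob (good A)" by (rule good_prob)
  define K where "K = {x \<in> mspace linf_square. (\<forall>t\<in>unit_square. \<bar>x t\<bar> \<le> path_const A) \<and>
    (\<forall>m. \<forall>s\<in>unit_square. \<forall>t\<in>unit_square. \<bar>fst s - fst t\<bar> \<le> 1/2^m \<and> \<bar>snd s - snd t\<bar> \<le> 1/2^m \<longrightarrow>
      \<bar>x s - x t\<bar> \<le> (2 * path_const A + 2 * A) * chain_ratio ^ m)}"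
  have K: "compactin (mtopology_of linf_square) K"
    unfolding K_def by (rule compactin_equicontinuous[OF chain_ratio_lim])
  interpret L: Metric_space "mspace linf_square" "mdist linf_square" by auto
  \<comment> \<open>Closedness makes the event that the path lies in \<open>K\<close>
    measurable.\<close>
  have "closedin (mtopology_of linf_square) K"
    using K compactin_imp_closedin[OF L.Hausdorff_space_mtopology] by (simp add: mtopology_of_def)
  then have "openin (mtopology_of linf_square) (mspace linf_square - K)"
    by (simp add: closedin_def)
  then have "mspace linf_square - K \<in> sets (borel_of (mtopology_of linf_square))"
    unfolding borel_of_def using openin_subset[of "mtopology_of linf_square"] by (subst sets_measure_of) auto
  then have "gauss -` (mspace linf_square - K) \<inter> space noise \<in> sets noise"
    by (rule measurable_sets[OF gauss_borel])
  then have "space noise - (gauss -` (mspace linf_square - K) \<inter> space noise) \<in> sets noise" by blast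
  also have "space noise - (gauss -` (mspace linf_square - K) \<inter> space noise) = {y\<in>space noise. gauss y \<in> K}"
    using gauss_mspace by auto
  finally have Ks: "{y\<in>space noise. gauss y \<in> K} \<in> sets noise" .
  have "gauss y \<in> K" if "y \<in> good A" for y
    unfolding K_def using gauss_mspace gauss_bound[OF A(1) that] gauss_modulus[OF A(1) that] by blast
  then have "noise.prob (good A) \<le> noise.prob {y\<in>space noise. gauss y \<in> K}"
    by (intro noise.finite_measure_mono Ks) (auto simp: good_def)
  then have "1 - \<epsilon> \<le> noise.prob {y\<in>space noise. gauss y \<in> K}" using A(2) by linarith
  then show "\<exists>K. compactin (mtopology_of linf_square) K \<and> 1 - \<epsilon> \<le> noise.prob {y\<in>space noise. gauss y \<in> K}"
    using K by blast
qed

lemma gauss_gaussian: "gaussian_process noise unit_square gauss"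
  unfolding gaussian_process_def
proof (intro conjI ballI allI impI prob_space_noise gauss_measurable)
  fix S :: "(real \<times> real) set" and a :: "real \<times> real \<Rightarrow> real"
  assume S: "finite S \<and> S \<subseteq> unit_square"
  let ?v = "\<Sum>s\<in>S. \<Sum>t\<in>S. a s * a t * wcov s t"
  have N: "noise.centered_normal (\<lambda>y. \<Sum>t\<in>S. a t * gauss y t) ?v"
    using S by (intro gauss_normal[where p="\<lambda>t. t"]) auto
  then have "0 \<le> ?v" by (simp add: noise.centered_normal_def)
  then show "\<exists>\<mu> \<sigma>. 0 \<le> \<sigma> \<and> distr noise borel (\<lambda>y. \<Sum>t\<in>S. a t * gauss y t) = normal_law \<mu> \<sigma>"
    using noise.centered_normal_law[OF N] by (intro exI[of _ 0] exI[of _ "sqrt ?v"]) auto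
qed

lemma gauss_centered_normal:
  assumes "t \<in> unit_square" shows "noise.centered_normal (\<lambda>y. gauss y t) (wcov t t)"
  using gauss_normal[of "{()}" "\<lambda>_. t" "\<lambda>_. 1"] assms by simp

lemma gauss_centered: "centered_process noise unit_square gauss"
  unfolding centered_process_def
  using noise.centered_normal_moments(1,2)[OF gauss_centered_normal] by blast

text \<open>Polarization: \<open>centered_normal\<close> records only variances, so the covariance
  is read off from those of the two values and of their sum.\<close>

lemma gauss_covariance:
  assumes s: "s \<in> unit_square" and t: "t \<in> unit_square"
  shows "covariance noise (\<lambda>y. gauss y s) (\<lambda>y. gauss y t) = wcov s t"
proof -
  note ms = noise.centered_normal_moments[OF gauss_centered_normal[OF s]]
  note mt = noise.centered_normal_moments[OF gauss_centered_normal[OF t]]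
  have "noise.centered_normal (\<lambda>y. \<Sum>b\<in>UNIV. 1 * gauss y (if b then s else t))
      (\<Sum>b\<in>UNIV. \<Sum>c\<in>UNIV. 1 * 1 * wcov (if b then s else t) (if c then s else t))"
    by (rule gauss_normal) (use s t in auto)
  then have N: "noise.centered_normal (\<lambda>y. gauss y s + gauss y t) (wcov s s + 2 * wcov s t + wcov t t)"
    by (simp add: UNIV_bool wcov_sym[of t s] algebra_simps)
  note mst = noise.centered_normal_moments[OF N]
  have e: "(\<lambda>y. gauss y s * gauss y t) = (\<lambda>y. (1/2) * ((gauss y s + gauss y t)\<^sup>2 - (gauss y s)\<^sup>2 - (gauss y t)\<^sup>2))"
    by (simp add: power2_sum)
  have "(\<integral>y. gauss y s * gauss y t \<partial>noise) = (\<integral>y. (1/2) * ((gauss y s + gauss y t)\<^sup>2 - (gauss y s)\<^sup>2 - (gauss y t)\<^sup>2) \<partial>noise)"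
    unfolding e ..
  also have "\<dots> = (1/2) * ((wcov s s + 2 * wcov s t + wcov t t) - wcov s s - wcov t t)"
    using ms mt mst by (simp del: power2_sum)
  finally show ?thesis unfolding covariance_def ms(2) mt(2) by simp
qed

end

context copula_sample
begin

interpretation noise: prob_space noise by (rule prob_space_noise)

lemma wemp_fdd: "cf_convergence M noise (\<lambda>n x. grid_values m (wemp n x)) (\<lambda>y. grid_values m (gauss0 y))"
proof
  show "(\<lambda>x. grid_values m (wemp n x) i) \<in> borel_measurable M" for n i
    by (cases i) (simp add: grid_values_def)
  show "(\<lambda>y. grid_values m (gauss0 y) i) \<in> borel_measurable noise" for i
    by (rule grid_values_gauss0_measurable)
  fix l :: "(nat \<times> nat \<Rightarrow> real) \<Rightarrow> real" assume "linear_functional l"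
  then obtain I a where I: "finite I" "l = (\<lambda>w. \<Sum>i\<in>I. a i * w i)"
    by (auto simp: linear_functional_def)
  let ?p = "\<lambda>(i, j). (dyadic m i, dyadic m j)"
  let ?v = "\<Sum>i\<in>I. \<Sum>j\<in>I. a i * a j * wcov (?p i) (?p j)"
  have e: "l (grid_values m x) = (\<Sum>i\<in>I. a i * x (?p i))" for x
    by (simp add: I(2) grid_values_def split_def)
  have "noise.centered_normal (\<lambda>y. \<Sum>i\<in>I. a i * gauss0 y (?p i)) ?v"
    by (rule gauss0_normal[OF I(1)]) (auto simp: dyadic_mem_points)
  then have "(\<integral>y. iexp (1 * (\<Sum>i\<in>I. a i * gauss0 y (?p i))) \<partial>noise) = complex_of_real (exp (- ?v * 1\<^sup>2 / 2))"
    unfolding noise.centered_normal_def by blast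
  then show "(\<lambda>n. \<integral>x. iexp (l (grid_values m (wemp n x))) \<partial>M) \<longlonglongrightarrow> (\<integral>y. iexp (l (grid_values m (gauss0 y))) \<partial>noise)"
    unfolding e using wemp_cf[OF I(1), of a ?p] by simp
qed

lemma wemp_step_converges:
  assumes F: "lipschitz_functional linf_square F" "bounded (F ` mspace linf_square)"
  shows "(\<lambda>n. \<integral>x. F (step_fun m (grid_values m (wemp n x))) \<partial>M) \<longlonglongrightarrow> (\<integral>y. F (gauss_step m y) \<partial>noise)"
proof -
  interpret cf_convergence M noise "\<lambda>n x. grid_values m (wemp n x)" "\<lambda>y. grid_values m (gauss0 y)"
    by (rule wemp_fdd)
  obtain B where B: "\<And>x. x \<in> mspace linf_square \<Longrightarrow> \<bar>F x\<bar> \<le> B"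
    using F(2) unfolding bounded_iff by auto
  let ?pt = "\<lambda>(i, j). (dyadic m i, dyadic m j)"
  \<comment> \<open>A common bound for the second moments at all grid points, as
    \<open>cramer_wold\<close> requires.\<close>
  define V where "V = (\<Sum>i\<in>grid_indices m. wcov (?pt i) (?pt i))"
  have nn: "0 \<le> wcov t t" for t unfolding integral_wfun(2)[symmetric] by (rule integral_nonneg_AE) auto
  have V: "wcov (?pt i) (?pt i) \<le> V" if "i \<in> grid_indices m" for i
    unfolding V_def by (rule member_le_sum[of i _ "\<lambda>i. wcov (?pt i) (?pt i)"]) (use that nn in auto)
  have gv: "grid_values m x i = x (?pt i)" for x i by (cases i) (simp add: grid_values_def)
  have g0: "noise.centered_normal (\<lambda>y. gauss0 y (?pt i)) (wcov (?pt i) (?pt i))" for i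
    using gauss0_normal[of "{()}" "\<lambda>_. ?pt i" "\<lambda>_. 1"] by (cases i) (simp add: dyadic_mem_points)
  show ?thesis unfolding gauss_step_eq
  proof (rule cramer_wold[where I = "grid_indices m" and B = B and V = V])
    show "continuous_on UNIV (\<lambda>w. F (step_fun m w))" by (rule step_functional_continuous[OF F(1)])
    show "\<bar>F (step_fun m w)\<bar> \<le> B" for w by (rule B[OF step_fun_mspace])
    show "F (step_fun m w) = F (step_fun m w')" if "\<And>i. i \<in> grid_indices m \<Longrightarrow> w i = w' i" for w w'
      using step_fun_cong[of m w w', OF that] by simp
    show "integrable M (\<lambda>x. (grid_values m (wemp n x) i)\<^sup>2)" for n i
      unfolding gv by (rule wemp_second_moment)
    show "(\<integral>x. (grid_values m (wemp n x) i)\<^sup>2 \<partial>M) \<le> V" if "i \<in> grid_indices m" for n i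
      unfolding gv by (rule order_trans[OF wemp_second_moment(2) V[OF that]])
    show "integrable noise (\<lambda>y. (grid_values m (gauss0 y) i)\<^sup>2)" for i
      unfolding gv by (rule noise.centered_normal_moments(3)[OF g0])
    show "(\<integral>y. (grid_values m (gauss0 y) i)\<^sup>2 \<partial>noise) \<le> V" if "i \<in> grid_indices m" for i
      unfolding gv noise.centered_normal_moments(4)[OF g0] by (rule V[OF that])
  qed auto
qed

theorem wemp_weakly_converges:
  "weakly_converges_HJ M linf_square (\<lambda>n x. restrict (wemp n x) unit_square) noise gauss"
proof (rule weakly_converges_HJ_approx[where XA = "\<lambda>m n x. step_fun m (grid_values m (wemp n x))" and YA = gauss_step])
  show "prob_space M" by (rule M.prob_space_axioms)
  show "tight_borel_element noise linf_square gauss" by (rule gauss_tight)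
  have ms: "restrict (wemp n x) unit_square \<in> mspace linf_square" if "sample_interior x" for n x
    using wemp_bounded[OF that, of n] by (simp add: mspace_linf_square)
  then show "AE x in M. restrict (wemp n x) unit_square \<in> mspace linf_square" for n
    using AE_sample_interior by (auto elim: eventually_mono)
  show "step_fun m (grid_values m (wemp n x)) \<in> mspace linf_square" for m n x by (rule step_fun_mspace)
  show "gauss_step m y \<in> mspace linf_square" for m y unfolding gauss_step_eq by (rule step_fun_mspace)
  fix F :: "(real \<times> real \<Rightarrow> real) \<Rightarrow> real" and m
  assume F: "lipschitz_functional linf_square F" "bounded (F ` mspace linf_square)"
  show "(\<lambda>x. F (step_fun m (grid_values m (wemp n x)))) \<in> borel_measurable M" for n
    by (rule measurable_continuous_sequence[OF _ step_functional_continuous[OF F(1)]])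
       (simp add: grid_values_def split_def)
  show "(\<lambda>y. F (gauss_step m y)) \<in> borel_measurable noise" by (rule gauss_step_functional_measurable[OF F(1)])
  show "(\<lambda>n. \<integral>x. F (step_fun m (grid_values m (wemp n x))) \<partial>M) \<longlonglongrightarrow> (\<integral>y. F (gauss_step m y) \<partial>noise)"
    by (rule wemp_step_converges[OF F])
next
  fix \<epsilon> \<eta> :: real assume e: "0 < \<epsilon>" "0 < \<eta>"
  have ms: "restrict (wemp n x) unit_square \<in> mspace linf_square" if "sample_interior x" for n x
    using wemp_bounded[OF that, of n] by (simp add: mspace_linf_square)
  have "AE x in M. x \<notin> D \<longrightarrow> mdist linf_square (restrict (wemp n x) unit_square) (step_fun m (grid_values m (wemp n x))) \<le> \<epsilon>"
    if "\<forall>x\<in>space M - D. sample_interior x \<longrightarrow>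
       (\<forall>t\<in>unit_square. \<bar>wemp n x t - wemp n x (square_floor m t)\<bar> \<le> \<epsilon>)" for D m n
    using AE_sample_interior AE_space
  proof eventually_elim
    case (elim x)
    show ?case
      unfolding mdist_linf_square_le[OF ms[OF elim(1)] step_fun_mspace]
      unfolding step_fun_grid_values using that elim by auto
  qed
  then show "\<exists>m0. \<forall>m\<ge>m0. \<exists>n0. \<forall>n\<ge>n0. \<exists>D\<in>sets M. measure M D \<le> \<eta> \<and>
      (AE x in M. x \<notin> D \<longrightarrow> mdist linf_square (restrict (wemp n x) unit_square) (step_fun m (grid_values m (wemp n x))) \<le> \<epsilon>)"
    using wemp_equicontinuous[OF e] by meson
next
  show "AE y in noise. (\<lambda>m. mdist linf_square (gauss_step m y) (gauss y)) \<longlonglongrightarrow> 0"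
    using AE_good_paths by eventually_elim (rule gauss_step_limit)
qed

end

theorem theoremG1:
  fixes C :: "real \<Rightarrow> real \<Rightarrow> real"
    and M :: "'a measure"
    and U V :: "nat \<Rightarrow> 'a \<Rightarrow> real"
    and \<omega> :: real
  assumes "copula C"
    and "random_sample M C U V"
    and "0 \<le> \<omega>" and "\<omega> < 1/2"
  shows "\<exists>(N :: (real \<times> real \<Rightarrow> real) measure) G.
    weakly_converges_HJ M linf_square (weighted_process C U V \<omega>) N G \<and>
    gaussian_process N unit_square G \<and>
    centered_process N unit_square G \<and>
    (\<forall>y\<in>space N. continuous_on unit_square (G y)) \<and>
    (\<forall>y\<in>space N. \<forall>u\<in>{0..1}. \<forall>v\<in>{0..1}.
       u = 0 \<or> v = 0 \<or> (u, v) = (1, 1) \<longrightarrow> G y (u, v) = 0) \<and>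
    (\<forall>u\<in>{0..1}. \<forall>v\<in>{0..1}. \<forall>u'\<in>{0..1}. \<forall>v'\<in>{0..1}.
       min u v \<in> {0<..<1} \<and> min u' v' \<in> {0<..<1} \<longrightarrow>
       covariance N (\<lambda>y. G y (u, v)) (\<lambda>y. G y (u', v')) =
         (C (min u u') (min v v') - C u v * C u' v') /
         (q_weight \<omega> (min u v) * q_weight \<omega> (min u' v')))"
proof -
  obtain P :: "(real \<times> real) measure" where P: "prob_space P" "sets P = sets borel"
    "distr P borel fst = uniform_measure lborel {0..1}" "distr P borel snd = uniform_measure lborel {0..1}"
    and C: "\<And>u v. u \<in> {0..1} \<Longrightarrow> v \<in> {0..1} \<Longrightarrow> C u v = measure P ({..u} \<times> {..v})"
    using \<open>copula C\<close> unfolding copula_def by blast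
  interpret copula_law P \<omega>
    by (intro copula_law.intro copula_law_axioms.intro P assms)
  have C2: "C u v = cdf2 (u, v)" if "u \<in> {0..1}" "v \<in> {0..1}" for u v
    using C[OF that] by (simp add: cdf2_def quadrant_def)
  have M: "prob_space M"
    and ind: "prob_space.indep_vars M (\<lambda>_. borel) (\<lambda>i x. (U i x, V i x)) UNIV"
    and S: "\<And>i u v. u \<in> {0..1} \<Longrightarrow> v \<in> {0..1} \<Longrightarrow> measure M {x \<in> space M. U i x \<le> u \<and> V i x \<le> v} = C u v"
    using \<open>random_sample M C U V\<close> unfolding random_sample_def by blast+
  interpret M: prob_space M by (rule M)
  have rv: "(\<lambda>x. (U i x, V i x)) \<in> borel_measurable M" for i
    using ind by (auto simp: M.indep_vars_def2)
  \<comment> \<open>The sample is described on the unit square only; the uniform margins of the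
    copula extend this to the whole plane.\<close>
  have law: "distr M borel (\<lambda>x. (U i x, V i x)) = P" for i
  proof (rule measure_eqI_unit_quadrants[symmetric, OF P(1,2)])
    show "prob_space (distr M borel (\<lambda>x. (U i x, V i x)))" by (rule M.prob_space_distr[OF rv])
    show "measure P (quadrant t) = measure (distr M borel (\<lambda>x. (U i x, V i x))) (quadrant t)"
      if sq: "t \<in> unit_square" for t
    proof -
      obtain u v where t: "t = (u, v)" "u \<in> {0..1}" "v \<in> {0..1}" using sq by (cases t) auto
      have "(\<lambda>x. (U i x, V i x)) -` quadrant t \<inter> space M = {x \<in> space M. U i x \<le> u \<and> V i x \<le> v}"
        by (auto simp: quadrant_def t)
      then show ?thesis using S[OF t(2,3), of i] C2[OF t(2,3)]
        by (simp add: measure_distr[OF rv] t cdf2_def)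
    qed
    show "measure P (quadrant (1, 1)) = 1" using cdf2_top by (simp add: cdf2_def)
    show "measure P (quadrant (0, 1)) = 0" "measure P (quadrant (1, 0)) = 0"
      using cdf2_zero[of "(0, 1)"] cdf2_zero[of "(1, 0)"] by (simp_all add: cdf2_def min_coord_def)
  qed simp
  interpret copula_sample P \<omega> M "\<lambda>i x. (U i x, V i x)"
    by unfold_locales (auto intro: ind law)
  have W: "weighted_process C U V \<omega> n x = restrict (wemp n x) unit_square" for n x
  proof
    fix t
    show "weighted_process C U V \<omega> n x t = restrict (wemp n x) unit_square t"
    proof (cases "t \<in> unit_square")
      case True
      then have "fst t \<in> {0..1}" "snd t \<in> {0..1}" by (auto simp: mem_Times_iff)
      then obtain u v where t: "t = (u, v)" "u \<in> {0..1}" "v \<in> {0..1}" by (metis prod.collapse)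
      show ?thesis
      \<comment> \<open>For n = 0 both sides are 0, by the conventions on \<open>sqrt 0\<close> and
        on the empty sum.\<close>
      proof (cases "n = 0")
        case True
        then show ?thesis using t by (simp add: weighted_process_def wemp_def empirical_process_def)
      next
        case False
        have "empirical_copula U V n x u v = empirical_cdf n x (u, v)"
          by (simp add: empirical_copula_def empirical_cdf_def quadrant_def indicator_def of_bool_def)
        then show ?thesis using t False C2[OF t(2,3)]
          by (simp add: weighted_process_def wemp_empirical_cdf empirical_process_def min_coord_def inv_weight_def)
      qed
    qed (auto simp: weighted_process_def restrict_def)
  qed
  have "weakly_converges_HJ M linf_square (weighted_process C U V \<omega>) noise gauss"
    using wemp_weakly_converges unfolding W[abs_def, symmetric] .
  moreover have "gauss y (u, v) = 0" if "u \<in> {0..1}" "v \<in> {0..1}" "u = 0 \<or> v = 0 \<or> (u, v) = (1, 1)" for y u v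
    by (rule gauss_boundary) (use that in \<open>auto simp: min_coord_def\<close>)
  moreover have "covariance noise (\<lambda>y. gauss y (u, v)) (\<lambda>y. gauss y (u', v')) =
         (C (min u u') (min v v') - C u v * C u' v') /
         (q_weight \<omega> (min u v) * q_weight \<omega> (min u' v'))"
    if uv: "u \<in> {0..1}" "v \<in> {0..1}" "u' \<in> {0..1}" "v' \<in> {0..1}"
      "min u v \<in> {0<..<1}" "min u' v' \<in> {0<..<1}" for u v u' v'
  proof -
    have "min u u' \<in> {0..1}" "min v v' \<in> {0..1}" using uv by auto
    then have "C (min u u') (min v v') = cdf2 (meet (u, v) (u', v'))" by (simp add: C2 meet_def)
    moreover have "covariance noise (\<lambda>y. gauss y (u, v)) (\<lambda>y. gauss y (u', v')) = wcov (u, v) (u', v')"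
      using uv by (intro gauss_covariance) auto
    ultimately show ?thesis using uv by (simp add: wcov_def C2 min_coord_def inv_weight_def)
  qed
  ultimately show ?thesis
    using gauss_gaussian gauss_centered gauss_continuous
    by (intro exI[of _ noise] exI[of _ gauss] conjI ballI impI) auto
qed

end
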